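(* Each smooth globally hyperbolic spacetime is the strong pointed Lorentzian Gromov--Hausdorff limit of finite (discrete) Lorentzian pre-length spaces. In fact, the same holds true for any globally hyperbolic spacetime with continuous Lorentzian metric, provided $I^+$ is an open relation. That is, for such $(M,g)$ there are a base point $o\in M$ and a cover $\mathcal U$ such that $(M,\ell_g,o,\mathcal U)$ is a covered Lorentzian pre-length space and is the strong pLGH-limit of a sequence of covered Lorentzian pre-length spaces whose underlying sets are finite (with discrete topology).
   Context: A spacetime $(M,g)$ is a connected time-oriented Lorentzian manifold, viewed as a Lorentzian pre-length space with its manifold topology and $\ell_g(p,q)=\sup\{L_g(\gamma):\gamma$ future directed causal from $p$ to $q\}$ ($=-\infty$ if $p\not\le q$; constant curves allowed if $p=q$). $I^+$ denotes the chronological relation $\{(p,q):p\ll q\}\subseteq M\times M$. Lorentzian pre-length space: a set $X$ with $\ell:X\times X\to\{-\infty\}\cup[0,\infty]$ satisfying $\ell(x,y)+\ell(y,z)\le\ell(x,z)$ for all $x,y,z$ (convention $-\infty+\infty=\infty+(-\infty)=-\infty$ on the left) and $\ell(x,x)\ge 0$ for all $x$, where $X$ carries a topology finer than (at least as fine as) the one generated by the sub-base of all $I^\pm(x)$. $\tau:=\max(0,\ell)$. $x\ll y$ iff $\ell(x,y)>0$, $x\le y$ iff $\ell(x,y)\ge0$; $I^+(x)=\{y:x\ll y\}$, $I^-(x)=\{y:y\ll x\}$, $J^+(x)=\{y:x\le y\}$, $J^-(x)=\{y:y\le x\}$, $J(x,y)=J^+(x)\cap J^-(y)$. $\varepsilon$-net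 for $A\subseteq X$: a collection $S=(J(p_i,q_i))_{i\in\Omega}$ of causal diamonds with $\tau(p_i,q_i)\le\varepsilon$ and $A\subseteq\bigcup_iJ(p_i,q_i)$ (w.l.o.g. each diamond meets $A$); $V(S)=\{p_i,q_i\}$. A correspondence between sets is a relation projecting onto both factors; its distortion is $\operatorname{dis}(R)=\sup_{(x,y),(x',y')\in R}|\ell(x,x')-\rho(y,y')|$ with $|-\infty-(-\infty)|=0$, $|-\infty-z|=+\infty$ for $z\in\mathbb R$; similarly $\operatorname{dis}(f)$ for a map $f$. LGH-convergence of subsets $A_n\subseteq X_n$ to $A\subseteq X$: for all $\varepsilon>0$ there exist $n_0$ and finite $\varepsilon$-nets $S$ for $A$ in $X$, $S_n$ for $A_n$ in $X_n$ ($n\ge n_0$) such that (1) $|S_n|=|S|$; (2) for $n\ge n_0$ there is a correspondence $R_n$ of $V(S_n)$ and $V(S)$ with $\operatorname{dis}(R_n)\to0$; (3) (extension property) for every $l\ge1$, if $S^l,S^l_n$ are finite $\frac1l$-nets for $A,A_n$ satisfying (1) and (2) with $\varepsilon=\frac1l$ (i.e. $|S^l_n|=|S^l|$ for all large $n$, with correspondences of $V(S^l_n)$ and $V(S^l)$ whose distortions tend to $0$ as $n\to\infty$) and $f^l_n:V(S^l)\to V(S^l_n)$ realizes a correspondence, there is an extension $f^{l+1}_{n'}:V(S^l)\cup V(S^{l+1})\to V(S^l_{n'})\cup V(S^{l+1}_{n'})$ of $f^l_{n'}$ with $\operatorname{dis}(f^{l+1}_{n'})\le\operatorname{dis}(f^l_{n'})$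 for some $n'\ge n$; (4) (forward density) with $\mathcal V=\bigcup_{l\ge1}V(S^l)$, each $x\in A\setminus\mathcal V$ is a limit of $x_k\in\mathcal V$ with $x_k\le x_{k+1}\le x$. Strong: in (4) one can take $x_k\ll x_{k+1}\ll x$. Covered Lorentzian pre-length space $(X,\ell,o,\mathcal U)$: $o\in X$ and a countable cover $\mathcal U=(U_k)_k$ of $X$ with $U_k\subseteq U_{k+1}$, $o\in U_k$, $\sup_{x,y\in U_k}\tau(x,y)<\infty$. (Strong) pLGH-convergence $(X_n,\ell_n,o_n,\mathcal U_n)\to(X,\ell,o,\mathcal U)$ means $U_{k,n}\to U_k$ (strongly) in the LGH sense for each $k$. *)

theory Defs
  imports "HOL-Analysis.Analysis"
begin

section \<open>Lorentzian pre-length spaces\<close>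

text \<open>Addition on the extended reals with the convention that a summand \<open>-\<infinity>\<close> always wins
  (in the library \<open>\<infinity> + (-\<infinity>) = \<infinity>\<close>).\<close>

definition ell_plus :: "ereal \<Rightarrow> ereal \<Rightarrow> ereal" where
  "ell_plus a b = (if a = -\<infinity> \<or> b = -\<infinity> then -\<infinity> else a + b)"

definition tau :: "('a \<Rightarrow> 'a \<Rightarrow> ereal) \<Rightarrow> 'a \<Rightarrow> 'a \<Rightarrow> ereal" where
  "tau l x y = max 0 (l x y)"

definition chron :: "('a \<Rightarrow> 'a \<Rightarrow> ereal) \<Rightarrow> 'a \<Rightarrow> 'a \<Rightarrow> bool" where
  "chron l x y \<longleftrightarrow> l x y > 0"

definition causal :: "('a \<Rightarrow> 'a \<Rightarrow> ereal) \<Rightarrow> 'a \<Rightarrow> 'a \<Rightarrow> bool" where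
  "causal l x y \<longleftrightarrow> l x y \<ge> 0"

definition chron_future :: "'a set \<Rightarrow> ('a \<Rightarrow> 'a \<Rightarrow> ereal) \<Rightarrow> 'a \<Rightarrow> 'a set" where
  "chron_future X l x = {y \<in> X. chron l x y}"

definition chron_past :: "'a set \<Rightarrow> ('a \<Rightarrow> 'a \<Rightarrow> ereal) \<Rightarrow> 'a \<Rightarrow> 'a set" where
  "chron_past X l x = {y \<in> X. chron l y x}"

definition diamond :: "'a set \<Rightarrow> ('a \<Rightarrow> 'a \<Rightarrow> ereal) \<Rightarrow> 'a \<Rightarrow> 'a \<Rightarrow> 'a set" where
  "diamond X l p q = {x \<in> X. causal l p x \<and> causal l x q}"

definition lorentzian_prelength_space :: "'a topology \<Rightarrow> ('a \<Rightarrow> 'a \<Rightarrow> ereal) \<Rightarrow> bool" where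
  "lorentzian_prelength_space T l \<longleftrightarrow>
     (\<forall>x\<in>topspace T. \<forall>y\<in>topspace T. l x y = -\<infinity> \<or> 0 \<le> l x y) \<and>
     (\<forall>x\<in>topspace T. \<forall>y\<in>topspace T. \<forall>z\<in>topspace T.
        ell_plus (l x y) (l y z) \<le> l x z) \<and>
     (\<forall>x\<in>topspace T. 0 \<le> l x x) \<and>
     (\<forall>W. openin (topology_generated_by
                   (chron_future (topspace T) l ` topspace T \<union>
                    chron_past (topspace T) l ` topspace T)) W
          \<longrightarrow> openin T W)"

definition covered_lorentzian_prelength_space ::
    "'a topology \<Rightarrow> ('a \<Rightarrow> 'a \<Rightarrow> ereal) \<Rightarrow> 'a \<Rightarrow> (nat \<Rightarrow> 'a set) \<Rightarrow> bool" where
  "covered_lorentzian_prelength_space T l b U \<longleftrightarrow>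
     lorentzian_prelength_space T l \<and>
     b \<in> topspace T \<and>
     (\<Union>k. U k) = topspace T \<and>
     (\<forall>k. U k \<subseteq> U (Suc k) \<and> b \<in> U k \<and> (SUP x\<in>U k. SUP y\<in>U k. tau l x y) < \<infinity>)"


section \<open>Nets, distortion and convergence\<close>

text \<open>A collection of causal diamonds is represented by the set of the pairs \<open>(p, q)\<close> of their
  endpoints, since the vertex set depends on these. Every diamond of a net of \<open>A\<close> is required
  to meet \<open>A\<close>.\<close>

definition eps_net :: "'a set \<Rightarrow> ('a \<Rightarrow> 'a \<Rightarrow> ereal) \<Rightarrow> real \<Rightarrow> 'a set \<Rightarrow> ('a \<times> 'a) set \<Rightarrow> bool" where
  "eps_net X l \<epsilon> A S \<longleftrightarrow>
     S \<subseteq> X \<times> X \<and>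
     (\<forall>(p, q)\<in>S. tau l p q \<le> ereal \<epsilon> \<and> diamond X l p q \<inter> A \<noteq> {}) \<and>
     A \<subseteq> (\<Union>(p, q)\<in>S. diamond X l p q)"

definition vertices :: "('a \<times> 'a) set \<Rightarrow> 'a set" where
  "vertices S = fst ` S \<union> snd ` S"

definition correspondence :: "'a set \<Rightarrow> 'b set \<Rightarrow> ('a \<times> 'b) set \<Rightarrow> bool" where
  "correspondence A B R \<longleftrightarrow> R \<subseteq> A \<times> B \<and> fst ` R = A \<and> snd ` R = B"

definition ell_diff :: "ereal \<Rightarrow> ereal \<Rightarrow> ennreal" where
  "ell_diff a b = (if a = b then 0 else e2ennreal \<bar>a - b\<bar>)"

definition distortion ::
    "('a \<Rightarrow> 'a \<Rightarrow> ereal) \<Rightarrow> ('b \<Rightarrow> 'b \<Rightarrow> ereal) \<Rightarrow> ('a \<times> 'b) set \<Rightarrow> ennreal" where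
  "distortion l r R = (SUP (x, y)\<in>R. SUP (x', y')\<in>R. ell_diff (l x x') (r y y'))"

definition map_distortion ::
    "('a \<Rightarrow> 'a \<Rightarrow> ereal) \<Rightarrow> ('b \<Rightarrow> 'b \<Rightarrow> ereal) \<Rightarrow> 'a set \<Rightarrow> ('a \<Rightarrow> 'b) \<Rightarrow> ennreal" where
  "map_distortion l r D f = distortion l r ((\<lambda>x. (x, f x)) ` D)"

text \<open>\<open>S \<epsilon>\<close> and \<open>Sn \<epsilon> n\<close> (for \<open>n \<ge> N \<epsilon>\<close>) are nets of the limit set \<open>A\<close> and of the approximating
  sets \<open>An n\<close>, of equal cardinality, and \<open>R \<epsilon> n\<close> are correspondences of their vertices with
  distortion tending to \<open>0\<close>.\<close>

definition LGH_nets ::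
    "(nat \<Rightarrow> 'b set) \<Rightarrow> (nat \<Rightarrow> 'b \<Rightarrow> 'b \<Rightarrow> ereal) \<Rightarrow> (nat \<Rightarrow> 'b set) \<Rightarrow>
     'a set \<Rightarrow> ('a \<Rightarrow> 'a \<Rightarrow> ereal) \<Rightarrow> 'a set \<Rightarrow>
     (real \<Rightarrow> nat) \<Rightarrow> (real \<Rightarrow> ('a \<times> 'a) set) \<Rightarrow> (real \<Rightarrow> nat \<Rightarrow> ('b \<times> 'b) set) \<Rightarrow>
     (real \<Rightarrow> nat \<Rightarrow> ('a \<times> 'b) set) \<Rightarrow> bool" where
  "LGH_nets Xn ls An X l A N S Sn R \<longleftrightarrow>
     (\<forall>\<epsilon>>0.
        finite (S \<epsilon>) \<and> eps_net X l \<epsilon> A (S \<epsilon>) \<and>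
        (\<forall>n\<ge>N \<epsilon>.
           finite (Sn \<epsilon> n) \<and> eps_net (Xn n) (ls n) \<epsilon> (An n) (Sn \<epsilon> n) \<and>
           card (Sn \<epsilon> n) = card (S \<epsilon>) \<and>
           correspondence (vertices (S \<epsilon>)) (vertices (Sn \<epsilon> n)) (R \<epsilon> n)) \<and>
        (\<lambda>n. distortion l (ls n) (R \<epsilon> n)) \<longlonglongrightarrow> 0)"

text \<open>The extension property concerns arbitrary maps \<open>f n\<close> realizing the correspondences, that is,
  maps whose graphs are contained in them.\<close>

definition LGH_extension ::
    "(nat \<Rightarrow> 'b \<Rightarrow> 'b \<Rightarrow> ereal) \<Rightarrow> ('a \<Rightarrow> 'a \<Rightarrow> ereal) \<Rightarrow>
     (real \<Rightarrow> nat) \<Rightarrow> (real \<Rightarrow> ('a \<times> 'a) set) \<Rightarrow> (real \<Rightarrow> nat \<Rightarrow> ('b \<times> 'b) set) \<Rightarrow>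
     (real \<Rightarrow> nat \<Rightarrow> ('a \<times> 'b) set) \<Rightarrow> bool" where
  "LGH_extension ls l N S Sn R \<longleftrightarrow>
     (\<forall>m\<ge>1. let \<epsilon> = 1 / real m; \<epsilon>' = 1 / real (Suc m);
                V = vertices (S \<epsilon>); V' = vertices (S \<epsilon>') in
        \<forall>f. (\<forall>n\<ge>N \<epsilon>. \<forall>x\<in>V. (x, f n x) \<in> R \<epsilon> n) \<longrightarrow>
          (\<forall>n\<ge>N \<epsilon>. \<exists>n'\<ge>n. n' \<ge> N \<epsilon>' \<and>
             (\<exists>F. (\<forall>x\<in>V. F x = f n' x) \<and>
                  F ` (V \<union> V') \<subseteq> vertices (Sn \<epsilon> n') \<union> vertices (Sn \<epsilon>' n') \<and>
                  map_distortion l (ls n') (V \<union> V') F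
                    \<le> map_distortion l (ls n') V (f n'))))"

definition strong_forward_density ::
    "'a topology \<Rightarrow> ('a \<Rightarrow> 'a \<Rightarrow> ereal) \<Rightarrow> 'a set \<Rightarrow> 'a set \<Rightarrow> bool" where
  "strong_forward_density T l A V \<longleftrightarrow>
     (\<forall>x\<in>A - V. \<exists>s::nat \<Rightarrow> 'a.
        (\<forall>k. s k \<in> V \<and> chron l (s k) (s (Suc k)) \<and> chron l (s k) x) \<and>
        limitin T s x sequentially)"

definition strong_LGH_convergence ::
    "(nat \<Rightarrow> 'b topology) \<Rightarrow> (nat \<Rightarrow> 'b \<Rightarrow> 'b \<Rightarrow> ereal) \<Rightarrow> (nat \<Rightarrow> 'b set) \<Rightarrow>
     'a topology \<Rightarrow> ('a \<Rightarrow> 'a \<Rightarrow> ereal) \<Rightarrow> 'a set \<Rightarrow> bool" where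
  "strong_LGH_convergence Tn ls An T l A \<longleftrightarrow>
     (\<exists>N S Sn R.
        LGH_nets (\<lambda>n. topspace (Tn n)) ls An (topspace T) l A N S Sn R \<and>
        LGH_extension ls l N S Sn R \<and>
        strong_forward_density T l A (\<Union>m\<in>{1..}. vertices (S (1 / real m))))"

text \<open>The base points enter only through the notion of a covered space.\<close>

definition strong_pLGH_convergence ::
    "(nat \<Rightarrow> 'b topology) \<Rightarrow> (nat \<Rightarrow> 'b \<Rightarrow> 'b \<Rightarrow> ereal) \<Rightarrow> (nat \<Rightarrow> 'b) \<Rightarrow> (nat \<Rightarrow> nat \<Rightarrow> 'b set) \<Rightarrow>
     'a topology \<Rightarrow> ('a \<Rightarrow> 'a \<Rightarrow> ereal) \<Rightarrow> 'a \<Rightarrow> (nat \<Rightarrow> 'a set) \<Rightarrow> bool" where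
  "strong_pLGH_convergence Tn ls bs Us T l b U \<longleftrightarrow>
     (\<forall>n. covered_lorentzian_prelength_space (Tn n) (ls n) (bs n) (Us n)) \<and>
     covered_lorentzian_prelength_space T l b U \<and>
     (\<forall>k. strong_LGH_convergence Tn ls (\<lambda>n. Us n k) T l (U k))"


section \<open>Spacetimes\<close>

text \<open>\<open>C\<^sup>k\<close> maps on an open subset of a Euclidean space, via iterated directional derivatives.\<close>

primrec Ck_on :: "nat \<Rightarrow> 'a::euclidean_space set \<Rightarrow> ('a \<Rightarrow> 'b::real_normed_vector) \<Rightarrow> bool" where
  "Ck_on 0 S f \<longleftrightarrow> continuous_on S f"
| "Ck_on (Suc k) S f \<longleftrightarrow>
     (\<forall>x\<in>S. f differentiable (at x)) \<and> (\<forall>v. Ck_on k S (\<lambda>x. frechet_derivative f (at x) v))"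

definition smooth_on :: "'a::euclidean_space set \<Rightarrow> ('a \<Rightarrow> 'b::real_normed_vector) \<Rightarrow> bool" where
  "smooth_on S f \<longleftrightarrow> (\<forall>k. Ck_on k S f)"

text \<open>A chart \<open>(U, \<phi>)\<close>; the values of \<open>\<phi>\<close> outside \<open>U\<close> are irrelevant.\<close>

type_synonym ('m, 'e) chart = "'m set \<times> ('m \<Rightarrow> 'e)"

text \<open>Tensor fields are given by their chart representations: \<open>metric M c p v w\<close> is the metric at
  \<open>p\<close> applied to the tangent vectors with coordinates \<open>v\<close>, \<open>w\<close> in the chart \<open>c\<close>, and
  \<open>time_field M c p\<close> are the coordinates in \<open>c\<close> of the vector field fixing the time orientation.\<close>

record ('m, 'e) lorentz_structure =
  mtop :: "'m topology"
  atlas :: "('m, 'e) chart set"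
  metric :: "('m, 'e) chart \<Rightarrow> 'm \<Rightarrow> 'e \<Rightarrow> 'e \<Rightarrow> real"
  time_field :: "('m, 'e) chart \<Rightarrow> 'm \<Rightarrow> 'e"

definition transition :: "('m, 'e) chart \<Rightarrow> ('m, 'e) chart \<Rightarrow> 'e \<Rightarrow> 'e" where
  "transition c d = snd d \<circ> inv_into (fst c) (snd c)"

definition smooth_manifold :: "'m topology \<Rightarrow> ('m, 'e::euclidean_space) chart set \<Rightarrow> bool" where
  "smooth_manifold T \<A> \<longleftrightarrow>
     Hausdorff_space T \<and> second_countable T \<and>
     (\<Union>c\<in>\<A>. fst c) = topspace T \<and>
     (\<forall>(U, \<phi>)\<in>\<A>. openin T U \<and> open (\<phi> ` U) \<and>
        homeomorphic_map (subtopology T U) (top_of_set (\<phi> ` U)) \<phi>) \<and>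
     (\<forall>c\<in>\<A>. \<forall>d\<in>\<A>. smooth_on (snd c ` (fst c \<inter> fst d)) (transition c d))"

text \<open>Signature \<open>(-,+,\<dots>,+)\<close>: there is an orthonormal basis with exactly one negative vector.\<close>

definition lorentzian_form :: "('e::euclidean_space \<Rightarrow> 'e \<Rightarrow> real) \<Rightarrow> bool" where
  "lorentzian_form B \<longleftrightarrow>
     bilinear B \<and> (\<forall>v w. B v w = B w v) \<and>
     (\<exists>e::'e \<Rightarrow> 'e. \<exists>i0\<in>Basis. \<forall>i\<in>Basis. \<forall>j\<in>Basis.
        B (e i) (e j) = (if i \<noteq> j then 0 else if i = i0 then -1 else 1))"

definition continuous_lorentzian_metric :: "('m, 'e::euclidean_space) lorentz_structure \<Rightarrow> bool" where
  "continuous_lorentzian_metric M \<longleftrightarrow>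
     (\<forall>c\<in>atlas M. \<forall>p\<in>fst c. lorentzian_form (metric M c p)) \<and>
     (\<forall>c\<in>atlas M. \<forall>v w.
        continuous_map (subtopology (mtop M) (fst c)) euclideanreal (\<lambda>p. metric M c p v w)) \<and>
     (\<forall>c\<in>atlas M. \<forall>d\<in>atlas M. \<forall>p\<in>fst c \<inter> fst d.
        let D = frechet_derivative (transition c d) (at (snd c p)) in
        \<forall>v w. metric M c p v w = metric M d p (D v) (D w))"

definition smooth_metric :: "('m, 'e::euclidean_space) lorentz_structure \<Rightarrow> bool" where
  "smooth_metric M \<longleftrightarrow>
     (\<forall>c\<in>atlas M. \<forall>v w.
        smooth_on (snd c ` fst c) (\<lambda>x. metric M c (inv_into (fst c) (snd c) x) v w))"

definition time_orientation :: "('m, 'e::euclidean_space) lorentz_structure \<Rightarrow> bool" where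
  "time_orientation M \<longleftrightarrow>
     (\<forall>c\<in>atlas M. continuous_map (subtopology (mtop M) (fst c)) euclidean (time_field M c)) \<and>
     (\<forall>c\<in>atlas M. \<forall>p\<in>fst c. metric M c p (time_field M c p) (time_field M c p) < 0) \<and>
     (\<forall>c\<in>atlas M. \<forall>d\<in>atlas M. \<forall>p\<in>fst c \<inter> fst d.
        time_field M d p =
          frechet_derivative (transition c d) (at (snd c p)) (time_field M c p))"

definition spacetime :: "('m, 'e::euclidean_space) lorentz_structure \<Rightarrow> bool" where
  "spacetime M \<longleftrightarrow>
     smooth_manifold (mtop M) (atlas M) \<and>
     topspace (mtop M) \<noteq> {} \<and> connected_space (mtop M) \<and>
     continuous_lorentzian_metric M \<and> time_orientation M"

definition future_causal_vector ::
    "('m, 'e::euclidean_space) lorentz_structure \<Rightarrow> ('m, 'e) chart \<Rightarrow> 'm \<Rightarrow> 'e \<Rightarrow> bool" where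
  "future_causal_vector M c p v \<longleftrightarrow>
     v \<noteq> 0 \<and> metric M c p v v \<le> 0 \<and> metric M c p (time_field M c p) v < 0"

text \<open>Causal curves are locally Lipschitz continuous (in charts, equivalently with respect to any
  Riemannian metric), with future directed causal velocity almost everywhere. Constant curves
  are not included here.\<close>

definition causal_curve ::
    "('m, 'e::euclidean_space) lorentz_structure \<Rightarrow> real \<Rightarrow> real \<Rightarrow> (real \<Rightarrow> 'm) \<Rightarrow> bool" where
  "causal_curve M a b \<gamma> \<longleftrightarrow>
     a < b \<and>
     continuous_map (top_of_set {a..b}) (mtop M) \<gamma> \<and>
     (\<forall>t\<in>{a..b}. \<forall>c\<in>atlas M. \<gamma> t \<in> fst c \<longrightarrow>
        (\<exists>\<delta>>0. \<exists>L. \<gamma> ` ({a..b} \<inter> ball t \<delta>) \<subseteq> fst c \<and>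
                   L-lipschitz_on ({a..b} \<inter> ball t \<delta>) (snd c \<circ> \<gamma>))) \<and>
     (AE t in lebesgue. t \<in> {a..b} \<longrightarrow>
        (\<forall>c\<in>atlas M. \<gamma> t \<in> fst c \<longrightarrow>
           (\<exists>v. ((snd c \<circ> \<gamma>) has_vector_derivative v) (at t) \<and>
                future_causal_vector M c (\<gamma> t) v)))"

text \<open>The integrand \<open>sqrt (- g(\<gamma>', \<gamma>'))\<close>. At almost all parameters of a causal curve its value does not
  depend on the chosen chart.\<close>

definition causal_speed ::
    "('m, 'e::euclidean_space) lorentz_structure \<Rightarrow> (real \<Rightarrow> 'm) \<Rightarrow> real \<Rightarrow> real" where
  "causal_speed M \<gamma> t =
     (let c = (SOME c. c \<in> atlas M \<and> \<gamma> t \<in> fst c);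
          v = vector_derivative (snd c \<circ> \<gamma>) (at t)
      in sqrt (- metric M c (\<gamma> t) v v))"

definition lorentzian_length ::
    "('m, 'e::euclidean_space) lorentz_structure \<Rightarrow> real \<Rightarrow> real \<Rightarrow> (real \<Rightarrow> 'm) \<Rightarrow> ereal" where
  "lorentzian_length M a b \<gamma> =
     enn2ereal (\<integral>\<^sup>+t\<in>{a..b}. ennreal (causal_speed M \<gamma> t) \<partial>lebesgue)"

text \<open>The additional element \<open>0\<close> for \<open>p = q\<close> is the length of the constant curve. The supremum of the
  empty set is \<open>-\<infinity>\<close>.\<close>

definition time_separation ::
    "('m, 'e::euclidean_space) lorentz_structure \<Rightarrow> 'm \<Rightarrow> 'm \<Rightarrow> ereal" where
  "time_separation M p q =
     Sup ({lorentzian_length M a b \<gamma> | a b \<gamma>. causal_curve M a b \<gamma> \<and> \<gamma> a = p \<and> \<gamma> b = q} \<union>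
          (if p = q then {0} else {}))"

text \<open>Global hyperbolicity: no closed causal curves, and compact causal diamonds.\<close>

definition globally_hyperbolic :: "('m, 'e::euclidean_space) lorentz_structure \<Rightarrow> bool" where
  "globally_hyperbolic M \<longleftrightarrow>
     (\<forall>a b \<gamma>. causal_curve M a b \<gamma> \<longrightarrow> \<gamma> a \<noteq> \<gamma> b) \<and>
     (\<forall>p\<in>topspace (mtop M). \<forall>q\<in>topspace (mtop M).
        compactin (mtop M) (diamond (topspace (mtop M)) (time_separation M) p q))"

definition chronological_relation :: "('m, 'e::euclidean_space) lorentz_structure \<Rightarrow> ('m \<times> 'm) set" where
  "chronological_relation M =
     {(p, q) \<in> topspace (mtop M) \<times> topspace (mtop M). chron (time_separation M) p q}"

end

theory Submission
  imports Defs
begin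

text \<open>
  The approximating spaces are finite subsets of the spacetime itself, with the restricted time
  separation. Once every set \<open>U k\<close> of the cover has finite nets of arbitrarily small diamonds
  (\<open>net_of_compact\<close>), let the \<open>n\<close>-th space consist of the vertices of finitely many of these nets,
  together with one point of \<open>U k\<close> from each diamond. A net of \<open>U k\<close> is then also a net of the
  finite approximation of \<open>U k\<close>, with the same vertices, so that the correspondences are identity
  maps: their distortion is not merely small but zero, and every extension problem is solved by the
  identity. For strong forward density the nets are enlarged by degenerate diamonds
  \<open>J(d, d) = {d}\<close>, where \<open>d\<close> runs through a countable dense set; since \<open>U k\<close> is open and every point
  is a limit of points in its chronological past, such points \<open>d\<close> climb to any \<open>x \<in> U k\<close>. This is
  \<open>finite_approximation\<close>; it uses only order and topology.

  What the geometry has to supply is therefore: diamonds are compact and the causal order is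
  antisymmetric (global hyperbolicity), the chronological relation is open, every point is a limit
  of points in its chronological past and future, the time separation is finite, and it is
  small near the diagonal.

  The last two points rest on an estimate in charts. Near a point there is a linear function which grows
  along each future causal vector \<open>v\<close> at least like \<open>k \<cdot> |v|\<close> (\<open>cone_ball_exists\<close>), so a causal
  curve inside a coordinate ball has length at most a constant times the radius
  (\<open>cone_ball_length\<close>). To apply this to all causal curves between nearby points these curves have to
  be trapped in the ball. This is strong causality, and it follows from order and topology: openness of
  the chronological relation and closedness of the diamonds make the causal relation closed
  (\<open>not_causal_stable\<close>), so by antisymmetry no causal curve between points close to \<open>x\<close> can meet
  a given compact set avoiding \<open>x\<close> (\<open>locally_avoids_compact\<close>), in particular a coordinate sphere.
  Finiteness of the time separation between \<open>p\<close> and \<open>q\<close> then follows by covering the compact diamond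
  by small sets and cutting a curve at the times at which it leaves one of them for good
  (\<open>finite_cover_length\<close>).

  If the metric is smooth, openness of the chronological relation has to be proved. A causal curve of
  positive length has a timelike velocity at some parameter; near this parameter it can be replaced by a
  straight chord, and such a chord stays timelike when both of its endpoints are moved
  (\<open>positive_length_stable_chord\<close>). The rest of the curve need not be timelike anywhere. But as the
  metric is Lipschitz in charts, a short causal curve can be translated and remains causal if it is
  tilted a little towards the future (\<open>perturbed_curve\<close>), so one endpoint may be moved freely at the
  expense of a small change of the other one. Composing these steps along the curve moves its endpoints
  independently (\<open>curve_stable\<close>, \<open>stably_chronI\<close>).
\<close>

section \<open>Causality in spaces with compact diamonds\<close>

lemma compactin_finite_cover:
  assumes "compactin T K" and W: "\<And>z. z \<in> K \<Longrightarrow> openin T (W z) \<and> z \<in> W z"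
  obtains Z where "finite Z" "Z \<subseteq> K" "K \<subseteq> (\<Union>z\<in>Z. W z)"
proof -
  have "(\<forall>U\<in>W ` K. openin T U) \<and> K \<subseteq> \<Union>(W ` K)" using W by blast
  then have "\<exists>\<F>. finite \<F> \<and> \<F> \<subseteq> W ` K \<and> K \<subseteq> \<Union>\<F>"
    using \<open>compactin T K\<close> unfolding compactin_def by meson
  then obtain \<F> where \<F>: "finite \<F>" "\<F> \<subseteq> W ` K" "K \<subseteq> \<Union>\<F>" by blast
  then obtain Z where "Z \<subseteq> K" "finite Z" "\<F> = W ` Z" by (meson finite_subset_image)
  then show ?thesis using that \<F>(3) by blast
qed

text \<open>The part of global hyperbolicity that concerns order and topology only. The approximation by finite
  spaces and the proof of strong causality use neither curves nor charts.\<close>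

locale compact_diamond_space =
  fixes T :: "'a topology" and l :: "'a \<Rightarrow> 'a \<Rightarrow> ereal"
  assumes ell_values: "\<And>x y. x \<in> topspace T \<Longrightarrow> y \<in> topspace T \<Longrightarrow> l x y = -\<infinity> \<or> 0 \<le> l x y"
    and ell_triangle: "\<And>x y z. x \<in> topspace T \<Longrightarrow> y \<in> topspace T \<Longrightarrow> z \<in> topspace T \<Longrightarrow>
          ell_plus (l x y) (l y z) \<le> l x z"
    and ell_diag: "\<And>x. x \<in> topspace T \<Longrightarrow> l x x = 0"
    and causal_antisym: "\<And>x y. x \<in> topspace T \<Longrightarrow> y \<in> topspace T \<Longrightarrow>
          causal l x y \<Longrightarrow> causal l y x \<Longrightarrow> x = y"
    and open_chron: "openin (prod_topology T T) {(p, q) \<in> topspace T \<times> topspace T. chron l p q}"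
    and past_accumulates: "\<And>x W. openin T W \<Longrightarrow> x \<in> W \<Longrightarrow> \<exists>p\<in>W. chron l p x"
    and future_accumulates: "\<And>x W. openin T W \<Longrightarrow> x \<in> W \<Longrightarrow> \<exists>q\<in>W. chron l x q"
    and compact_diamonds: "\<And>p q. p \<in> topspace T \<Longrightarrow> q \<in> topspace T \<Longrightarrow>
          compactin T (diamond (topspace T) l p q)"
    and hausdorff: "Hausdorff_space T"
    and countable_base: "second_countable T"
    and nonempty: "topspace T \<noteq> {}"
begin

lemma chron_imp_causal: "chron l x y \<Longrightarrow> causal l x y"
  by (simp add: chron_def causal_def)

lemma causal_refl: "x \<in> topspace T \<Longrightarrow> causal l x x"
  by (simp add: causal_def ell_diag)

lemma causal_trans:
  assumes "x \<in> topspace T" "y \<in> topspace T" "z \<in> topspace T" "causal l x y" "causal l y z"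
  shows "causal l x z" and "l x y \<le> l x z" and "l y z \<le> l x z"
proof -
  have "l x y \<ge> 0" "l y z \<ge> 0" using assms by (auto simp: causal_def)
  then have "l x y + l y z \<le> l x z"
    using ell_triangle[OF assms(1-3)] by (auto simp: ell_plus_def split: if_splits)
  moreover have "l x y \<le> l x y + l y z" "l y z \<le> l x y + l y z"
    using \<open>l x y \<ge> 0\<close> \<open>l y z \<ge> 0\<close> by (simp_all add: add_increasing add_increasing2)
  ultimately show "causal l x z" "l x y \<le> l x z" "l y z \<le> l x z"
    using \<open>l x y \<ge> 0\<close> by (auto simp: causal_def intro: order_trans)
qed

lemma openin_chron_future: 
  assumes "x \<in> topspace T" shows "openin T (chron_future (topspace T) l x)"
proof -
  have "continuous_map T (prod_topology T T) (\<lambda>y. (x, y))"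
    using assms by (simp add: continuous_map_pairedI)
  from openin_continuous_map_preimage[OF this open_chron]
  show ?thesis using assms by (simp add: chron_future_def conj_commute cong: conj_cong)
qed

lemma openin_chron_past: 
  assumes "x \<in> topspace T" shows "openin T (chron_past (topspace T) l x)"
proof -
  have "continuous_map T (prod_topology T T) (\<lambda>y. (y, x))"
    using assms by (simp add: continuous_map_pairedI)
  from openin_continuous_map_preimage[OF this open_chron]
  show ?thesis using assms by (simp add: chron_past_def conj_commute cong: conj_cong)
qed

lemma prelength: "lorentzian_prelength_space T l"
proof -
  have "openin T W"
    if "openin (topology_generated_by (chron_future (topspace T) l ` topspace T \<union>
          chron_past (topspace T) l ` topspace T)) W" for W
  proof -
    have "generate_topology_on (chron_future (topspace T) l ` topspace T \<union>
          chron_past (topspace T) l ` topspace T) W"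
      using that openin_topology_generated_by by blast
    then show ?thesis
      by induction (auto intro: openin_chron_future openin_chron_past)
  qed
  then show ?thesis
    unfolding lorentzian_prelength_space_def
    using ell_values ell_triangle ell_diag by auto
qed

lemma closedin_diamond:
  "p \<in> topspace T \<Longrightarrow> q \<in> topspace T \<Longrightarrow> closedin T (diamond (topspace T) l p q)"
  using compact_diamonds compactin_imp_closedin hausdorff by blast

text \<open>The causal relation is closed because diamonds are. If all \<open>p0 \<lless> p\<close> were causally before \<open>q\<close>, then
  points \<open>p' \<lless> p\<close> tending to \<open>p\<close> would lie in one closed diamond \<open>J(p1, q)\<close>, and so would \<open>p\<close>. Hence some
  \<open>p0 \<lless> p\<close> is not causally before \<open>q\<close>, and \<open>I\<^sup>+(p0)\<close> is the neighbourhood of \<open>p\<close>. The points near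
  \<open>q\<close> that \<open>p0\<close> reaches lie in a closed diamond \<open>J(p0, q1)\<close>, which does not contain \<open>q\<close>.\<close>

lemma not_causal_stable:
  assumes p: "p \<in> topspace T" and q: "q \<in> topspace T" and "\<not> causal l p q"
  obtains V W where "openin T V" "p \<in> V" "openin T W" "q \<in> W"
    "\<And>p' q'. p' \<in> V \<Longrightarrow> q' \<in> W \<Longrightarrow> \<not> causal l p' q'"
proof -
  have "\<exists>p0\<in>topspace T. chron l p0 p \<and> \<not> causal l p0 q"
  proof (rule ccontr)
    assume contra: "\<not> ?thesis"
    obtain p1 where p1: "p1 \<in> topspace T" "chron l p1 p"
      using past_accumulates[OF openin_topspace p] by blast
    define W where "W = chron_future (topspace T) l p1 - diamond (topspace T) l p1 q"
    have "openin T W" unfolding W_def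
      by (intro openin_diff openin_chron_future closedin_diamond p1 q)
    moreover have "p \<in> W" using p p1 assms(3) by (auto simp: W_def chron_future_def diamond_def)
    ultimately obtain p' where p': "p' \<in> W" "chron l p' p" using past_accumulates by blast
    then have "p' \<in> topspace T" "chron l p1 p'" by (auto simp: W_def chron_future_def)
    with contra p' show False by (auto simp: W_def diamond_def chron_imp_causal)
  qed
  then obtain p0 where p0: "p0 \<in> topspace T" "chron l p0 p" "\<not> causal l p0 q" by blast
  obtain q1 where q1: "q1 \<in> topspace T" "chron l q q1"
    using future_accumulates[OF openin_topspace q] by blast
  define W where "W = chron_past (topspace T) l q1 - diamond (topspace T) l p0 q1"
  have "openin T W" unfolding W_def
    by (intro openin_diff openin_chron_past closedin_diamond p0 q1)
  moreover have "q \<in> W" using q q1 p0 by (auto simp: W_def chron_past_def diamond_def)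
  moreover have "\<not> causal l p' q'" if "p' \<in> chron_future (topspace T) l p0" "q' \<in> W" for p' q'
  proof
    assume "causal l p' q'"
    moreover have "p' \<in> topspace T" "q' \<in> topspace T" "chron l p0 p'" "chron l q' q1"
      using that by (auto simp: W_def chron_future_def chron_past_def)
    ultimately have "q' \<in> diamond (topspace T) l p0 q1"
      using p0 q1 causal_trans(1)[of p0 p' q'] by (auto simp: diamond_def chron_imp_causal)
    then show False using that by (auto simp: W_def)
  qed
  moreover have "p \<in> chron_future (topspace T) l p0" using p p0 by (simp add: chron_future_def)
  ultimately show ?thesis using that openin_chron_future[OF p0(1)] by blast
qed

text \<open>Strong causality in the form needed for trapping curves: by antisymmetry no \<open>z \<noteq> x\<close> satisfies
  \<open>x \<le> z \<le> x\<close>, this failure is stable since the causal relation is closed, and compactness of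
  \<open>K\<close> allows one neighbourhood of \<open>x\<close> to serve all \<open>z \<in> K\<close>.\<close>

lemma locally_avoids_compact:
  assumes x: "x \<in> topspace T" and K: "compactin T K" and "x \<notin> K"
  obtains V where "openin T V" "x \<in> V"
    "\<And>p q z. p \<in> V \<Longrightarrow> q \<in> V \<Longrightarrow> z \<in> K \<Longrightarrow> \<not> (causal l p z \<and> causal l z q)"
proof -
  have KX: "K \<subseteq> topspace T" using K by (rule compactin_subset_topspace)
  have "\<exists>V W. openin T V \<and> x \<in> V \<and> openin T W \<and> z \<in> W \<and>
      (\<forall>p\<in>V. \<forall>q\<in>V. \<forall>z'\<in>W. \<not> (causal l p z' \<and> causal l z' q))" if "z \<in> K" for z
  proof -
    have z: "z \<in> topspace T" "z \<noteq> x" using that KX \<open>x \<notin> K\<close> by auto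
    then consider "\<not> causal l x z" | "\<not> causal l z x" using causal_antisym x by blast
    then show ?thesis
    proof cases
      case 1 then show ?thesis using not_causal_stable[OF x z(1)] by metis
    next
      case 2 then show ?thesis using not_causal_stable[OF z(1) x] by metis
    qed
  qed
  then obtain V W where VW: "\<And>z. z \<in> K \<Longrightarrow> openin T (V z) \<and> x \<in> V z \<and> openin T (W z) \<and> z \<in> W z \<and>
      (\<forall>p\<in>V z. \<forall>q\<in>V z. \<forall>z'\<in>W z. \<not> (causal l p z' \<and> causal l z' q))"
    by metis
  obtain Z where Z: "finite Z" "Z \<subseteq> K" "K \<subseteq> (\<Union>z\<in>Z. W z)"
    using compactin_finite_cover[OF K, of W] VW by blast
  show ?thesis
  proof
    show "openin T (topspace T \<inter> (\<Inter>z\<in>Z. V z))"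
      using Z VW by (cases "Z = {}") (auto intro!: openin_Int openin_Inter)
    show "x \<in> topspace T \<inter> (\<Inter>z\<in>Z. V z)" using x Z VW by auto
    show "\<not> (causal l p z \<and> causal l z q)"
      if "p \<in> topspace T \<inter> (\<Inter>z\<in>Z. V z)" "q \<in> topspace T \<inter> (\<Inter>z\<in>Z. V z)" "z \<in> K" for p q z
    proof -
      obtain z0 where z0: "z0 \<in> Z" "z \<in> W z0" using Z \<open>z \<in> K\<close> by blast
      then have "p \<in> V z0" "q \<in> V z0" using that by auto
      then show ?thesis using z0 Z(2) VW[of z0] by blast
    qed
  qed
qed

text \<open>The diamonds are spanned by points \<open>p \<lless> x \<lless> q\<close> so close to \<open>x\<close> that \<open>l p q \<le> \<epsilon>\<close>. Their
  chronological interiors \<open>I\<^sup>+(p) \<inter> I\<^sup>-(q)\<close> are open and cover \<open>K\<close>.\<close>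

lemma net_of_compact:
  assumes K: "compactin T K" and "A \<subseteq> K" and "\<epsilon> > 0"
    and small: "\<And>x. x \<in> topspace T \<Longrightarrow> \<exists>V. openin T V \<and> x \<in> V \<and> (\<forall>p\<in>V. \<forall>q\<in>V. l p q \<le> ereal \<epsilon>)"
  obtains S where "finite S" "eps_net (topspace T) l \<epsilon> A S"
proof -
  have KX: "K \<subseteq> topspace T" using K by (rule compactin_subset_topspace)
  have "\<exists>p q. p \<in> topspace T \<and> q \<in> topspace T \<and> chron l p x \<and> chron l x q \<and> l p q \<le> ereal \<epsilon>"
    if "x \<in> K" for x
  proof -
    obtain V where V: "openin T V" "x \<in> V" "\<forall>p\<in>V. \<forall>q\<in>V. l p q \<le> ereal \<epsilon>"
      using small[of x] \<open>x \<in> K\<close> KX by auto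
    then show ?thesis
      using past_accumulates[OF V(1,2)] future_accumulates[OF V(1,2)] openin_subset[OF V(1)] by blast
  qed
  then obtain p q where pq: "\<And>x. x \<in> K \<Longrightarrow> p x \<in> topspace T \<and> q x \<in> topspace T \<and>
      chron l (p x) x \<and> chron l x (q x) \<and> l (p x) (q x) \<le> ereal \<epsilon>" by metis
  define W where "W x = chron_future (topspace T) l (p x) \<inter> chron_past (topspace T) l (q x)" for x
  have W: "openin T (W x)" "x \<in> W x" if "x \<in> K" for x
    using pq[OF that] that KX
    by (auto simp: W_def chron_future_def chron_past_def
         intro!: openin_Int openin_chron_future[unfolded chron_future_def]
           openin_chron_past[unfolded chron_past_def])
  obtain Z where Z: "finite Z" "Z \<subseteq> K" "K \<subseteq> (\<Union>z\<in>Z. W z)"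
    using compactin_finite_cover[OF K, of W] W by blast
  define S where "S = {(p z, q z) | z. z \<in> Z \<and> diamond (topspace T) l (p z) (q z) \<inter> A \<noteq> {}}"
  show ?thesis
  proof
    have "S \<subseteq> (\<lambda>z. (p z, q z)) ` Z" by (auto simp: S_def)
    then show "finite S" using Z(1) by (meson finite_imageI finite_subset)
    have "\<exists>(a, b)\<in>S. x \<in> diamond (topspace T) l a b" if "x \<in> A" for x
    proof -
      obtain z where z: "z \<in> Z" "x \<in> W z" using Z(3) \<open>A \<subseteq> K\<close> \<open>x \<in> A\<close> by blast
      then have "x \<in> diamond (topspace T) l (p z) (q z)"
        by (auto simp: W_def chron_future_def chron_past_def diamond_def chron_imp_causal)
      then show ?thesis using that z by (auto simp: S_def)
    qed
    then show "eps_net (topspace T) l \<epsilon> A S"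
      using pq Z(2) \<open>\<epsilon> > 0\<close> by (auto simp: eps_net_def S_def tau_def)
  qed
qed

text \<open>Finite unions of sets \<open>I\<^sup>+(p) \<inter> I\<^sup>-(q)\<close> are open and contained in a compact set. Both properties
  are used later: openness for approximating points of \<open>U k\<close> from within by a dense sequence,
  compactness for finite nets. Countably many of these sets suffice as the space is Lindelof.\<close>

lemma exhaustion:
  obtains b U where "b \<in> topspace T" "(\<Union>k. U k) = topspace T"
    "\<And>k. openin T (U k)" "\<And>k. U k \<subseteq> U (Suc k)" "\<And>k::nat. b \<in> U k"
    "\<And>k. \<exists>P. finite P \<and> P \<subseteq> topspace T \<times> topspace T \<and> U k \<subseteq> (\<Union>(p, q)\<in>P. diamond (topspace T) l p q)"
proof -
  define D where "D p q = chron_future (topspace T) l p \<inter> chron_past (topspace T) l q" for p q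
  define \<D> where "\<D> = {D p q | p q. p \<in> topspace T \<and> q \<in> topspace T}"
  have mem: "\<exists>p q. p \<in> topspace T \<and> q \<in> topspace T \<and> x \<in> D p q" if "x \<in> topspace T" for x
    using past_accumulates[OF openin_topspace that] future_accumulates[OF openin_topspace that] that
    by (auto simp: D_def chron_future_def chron_past_def)
  have D_open: "openin T W" if "W \<in> \<D>" for W
    using that by (auto simp: \<D>_def D_def intro!: openin_Int openin_chron_future openin_chron_past)
  have "\<Union>\<D> = topspace T"
  proof
    show "\<Union>\<D> \<subseteq> topspace T" using D_open openin_subset by fast
    show "topspace T \<subseteq> \<Union>\<D>"
    proof
      fix x assume "x \<in> topspace T"
      then obtain p q where "p \<in> topspace T" "q \<in> topspace T" "x \<in> D p q" using mem by blast
      then show "x \<in> \<Union>\<D>" unfolding \<D>_def by blast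
    qed
  qed
  moreover have "Lindelof_space T" by (rule second_countable_imp_Lindelof_space[OF countable_base])
  ultimately obtain \<V> where \<V>: "countable \<V>" "\<V> \<subseteq> \<D>" "\<Union>\<V> = topspace T"
    using D_open unfolding Lindelof_space_def by (elim allE[of _ \<D>]) auto
  then have "\<V> \<noteq> {}" using nonempty by (metis Union_empty)
  define V where "V = from_nat_into \<V>"
  have V: "V j \<in> \<D>" "range V = \<V>" for j
    unfolding V_def using \<V>(2) from_nat_into[OF \<open>\<V> \<noteq> {}\<close>, of j]
      range_from_nat_into[OF \<open>\<V> \<noteq> {}\<close> \<V>(1)] by auto
  obtain b where b: "b \<in> topspace T" using nonempty by blast
  obtain j0 where j0: "b \<in> V j0" using V(2) \<V>(3) b by (metis UnionE rangeE)
  define U where "U k = (\<Union>j\<le>k + j0. V j)" for k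
  have D_sub: "D p q \<subseteq> diamond (topspace T) l p q" for p q
    by (auto simp: D_def chron_future_def chron_past_def diamond_def chron_imp_causal)
  have V_dia: "\<exists>p q. p \<in> topspace T \<and> q \<in> topspace T \<and> V j \<subseteq> diamond (topspace T) l p q" for j
    using V(1)[of j] D_sub unfolding \<D>_def by blast
  then obtain p q where pq: "\<And>j. p j \<in> topspace T \<and> q j \<in> topspace T \<and> V j \<subseteq> diamond (topspace T) l (p j) (q j)"
    by metis
  show ?thesis
  proof
    show "b \<in> topspace T" by fact
    show "(\<Union>k. U k) = topspace T"
    proof -
      have "x \<in> U j" if "x \<in> V j" for x j using that unfolding U_def by fastforce
      then have "(\<Union>k. U k) = \<Union>(range V)" unfolding U_def by blast
      then show ?thesis using V(2) \<V>(3) by simp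
    qed
    show "openin T (U k)" for k using V(1) D_open by (auto simp: U_def)
    show "U k \<subseteq> U (Suc k)" for k by (force simp: U_def)
    show "b \<in> U k" for k using j0 by (auto simp: U_def)
    show "\<exists>P. finite P \<and> P \<subseteq> topspace T \<times> topspace T \<and> U k \<subseteq> (\<Union>(p, q)\<in>P. diamond (topspace T) l p q)" for k
    proof (intro exI conjI)
      show "U k \<subseteq> (\<Union>(p, q)\<in>(\<lambda>j. (p j, q j)) ` {..k + j0}. diamond (topspace T) l p q)"
        using pq unfolding U_def by fastforce
    qed (use pq in auto)
  qed
qed

text \<open>If \<open>x \<in> J(p, q)\<close> and \<open>y \<in> J(p', q')\<close> with \<open>x \<le> y\<close>, then \<open>p \<le> x \<le> y \<le> q'\<close> and so \<open>l x y \<le> l p q'\<close>,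
  which leaves finitely many values.\<close>

lemma tau_bounded_on_diamonds:
  assumes fin: "\<And>x y. x \<in> topspace T \<Longrightarrow> y \<in> topspace T \<Longrightarrow> l x y < \<infinity>"
    and P: "finite P" "P \<subseteq> topspace T \<times> topspace T" and A: "A \<subseteq> (\<Union>(p, q)\<in>P. diamond (topspace T) l p q)"
  shows "(SUP x\<in>A. SUP y\<in>A. tau l x y) < \<infinity>"
proof -
  define B where "B = Max (insert 0 ((\<lambda>((p, _), (_, q)). tau l p q) ` (P \<times> P)))"
  have F: "finite (insert 0 ((\<lambda>((p, _), (_, q)). tau l p q) ` (P \<times> P)))" using P by simp
  have "B \<in> insert 0 ((\<lambda>((p, _), (_, q)). tau l p q) ` (P \<times> P))"
    unfolding B_def by (rule Max_in[OF F]) simp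
  moreover have "tau l p q < \<infinity>" if "p \<in> topspace T" "q \<in> topspace T" for p q
    using fin[OF that] by (auto simp: tau_def max_def)
  ultimately have "B < \<infinity>" using P by (auto simp del: ereal_infty_less)
  moreover have "tau l x y \<le> B" if xy: "x \<in> A" "y \<in> A" for x y
  proof (cases "causal l x y")
    case True
    have "x \<in> (\<Union>(p, q)\<in>P. diamond (topspace T) l p q)" "y \<in> (\<Union>(p, q)\<in>P. diamond (topspace T) l p q)"
      using xy A by blast+
    then obtain p q p' q' where pq: "(p, q) \<in> P" "x \<in> diamond (topspace T) l p q"
      "(p', q') \<in> P" "y \<in> diamond (topspace T) l p' q'"
      by blast
    then have X: "p \<in> topspace T" "q' \<in> topspace T" "x \<in> topspace T" "y \<in> topspace T"
      "causal l p x" "causal l y q'"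
      using P by (auto simp: diamond_def)
    have "l x y \<le> l p q'"
      using causal_trans(2)[OF X(3,4,2) True X(6)] causal_trans(3)[OF X(1,3,2) X(5)]
        causal_trans(1)[OF X(3,4,2) True X(6)] by (meson order_trans)
    then have "tau l x y \<le> tau l p q'" by (auto simp: tau_def max_def)
    also have "\<dots> \<le> B" unfolding B_def using pq by (intro Max_ge[OF F]) force
    finally show ?thesis .
  next
    case False
    then have "tau l x y = 0" by (auto simp: tau_def causal_def max_def)
    then show ?thesis unfolding B_def using F by simp
  qed
  then have "(SUP x\<in>A. SUP y\<in>A. tau l x y) \<le> B" by (intro SUP_least) auto
  ultimately show ?thesis by (metis le_less_trans)
qed

text \<open>If \<open>y \<lless> x\<close>, then \<open>I\<^sup>+(y)\<close> is a neighbourhood of \<open>x\<close>, and \<open>x\<close> is a limit of its chronological past. So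
  \<open>I\<^sup>+(y) \<inter> I\<^sup>-(x)\<close> is open and meets every neighbourhood of \<open>x\<close>, and the next term of the sequence can
  be taken from it and from the dense sequence.\<close>

lemma chronological_approximation:
  assumes d: "\<And>W. openin T W \<Longrightarrow> W \<noteq> {} \<Longrightarrow> \<exists>j. d j \<in> W" and "openin T A" and x: "x \<in> A"
  shows "\<exists>s::nat \<Rightarrow> 'a. (\<forall>k. s k \<in> A \<inter> range d \<and> chron l (s k) (s (Suc k)) \<and> chron l (s k) x)
            \<and> limitin T s x sequentially"
proof -
  have xX: "x \<in> topspace T" using assms openin_subset by blast
  obtain \<B> where \<B>: "countable \<B>" "\<And>V. V \<in> \<B> \<Longrightarrow> openin T V"
    "\<And>V y. openin T V \<Longrightarrow> y \<in> V \<Longrightarrow> \<exists>W\<in>\<B>. y \<in> W \<and> W \<subseteq> V"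
    using countable_base unfolding second_countable_def by metis
  define \<N> where "\<N> = {V \<in> \<B>. x \<in> V}"
  have \<N>: "countable \<N>" "\<N> \<noteq> {}"
    using \<B>(1) \<B>(3)[OF openin_topspace xX] by (auto simp: \<N>_def)
  define B where "B n = A \<inter> (\<Inter>j\<le>n. from_nat_into \<N> j)" for n :: nat
  have mem: "from_nat_into \<N> j \<in> \<N>" for j using \<N> by (simp add: from_nat_into)
  have B: "openin T (B n)" "x \<in> B n" for n
    using mem \<B>(2) assms by (auto simp: B_def \<N>_def intro!: openin_Int openin_Inter)
  have step: "\<exists>z. z \<in> B n \<inter> range d \<and> chron l z x \<and> chron l y z"
    if y: "y \<in> topspace T" "chron l y x" for y n
  proof -
    define W where "W = B n \<inter> chron_past (topspace T) l x \<inter> chron_future (topspace T) l y"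
    have "openin T W" unfolding W_def
      by (intro openin_Int B openin_chron_past openin_chron_future xX y)
    moreover have "W \<noteq> {}"
    proof -
      have "openin T (B n \<inter> chron_future (topspace T) l y)" "x \<in> B n \<inter> chron_future (topspace T) l y"
        using B y xX by (auto intro!: openin_chron_future openin_Int) (auto simp: chron_future_def)
      then obtain p where "p \<in> B n \<inter> chron_future (topspace T) l y" "chron l p x"
        using past_accumulates by blast
      then show ?thesis by (auto simp: W_def chron_past_def chron_future_def)
    qed
    ultimately obtain j where "d j \<in> W" using d by blast
    then show ?thesis by (auto simp: W_def chron_past_def chron_future_def)
  qed
  obtain y0 where y0: "y0 \<in> topspace T" "chron l y0 x" using past_accumulates[OF openin_topspace xX] by blast
  have BX: "B n \<subseteq> topspace T" for n using B openin_subset by blast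
  have "\<exists>s. \<forall>n. (s n \<in> B n \<inter> range d \<and> chron l (s n) x) \<and> chron l (s n) (s (Suc n))"
  proof (rule dependent_nat_choice)
    show "\<exists>z. z \<in> B 0 \<inter> range d \<and> chron l z x" using step[OF y0] by blast
    show "\<exists>y. (y \<in> B (Suc n) \<inter> range d \<and> chron l y x) \<and> chron l z y"
      if "z \<in> B n \<inter> range d \<and> chron l z x" for z n
      using step[of z "Suc n"] that BX by blast
  qed
  then obtain s where s: "\<And>n. s n \<in> B n \<inter> range d \<and> chron l (s n) x \<and> chron l (s n) (s (Suc n))"
    by blast
  have "limitin T s x sequentially"
    unfolding limitin_def
  proof (intro conjI allI impI)
    fix V assume V: "openin T V \<and> x \<in> V"
    then obtain W where W: "W \<in> \<N>" "W \<subseteq> V" using \<B>(3) by (force simp: \<N>_def)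
    then obtain j where "from_nat_into \<N> j = W" using \<N> by (meson from_nat_into_surj)
    then have "s n \<in> V" if "n \<ge> j" for n using s[of n] W that by (auto simp: B_def)
    then show "\<forall>\<^sub>F n in sequentially. s n \<in> V" by (auto simp: eventually_sequentially)
  qed (fact xX)
  then show ?thesis using s by (intro exI[of _ s]) (auto simp: B_def)
qed

lemma countable_dense_sequence:
  obtains d :: "nat \<Rightarrow> 'a" where "\<And>W. openin T W \<Longrightarrow> W \<noteq> {} \<Longrightarrow> \<exists>j. d j \<in> W"
proof -
  obtain \<B> where \<B>: "countable \<B>" "\<And>V. V \<in> \<B> \<Longrightarrow> openin T V"
    "\<And>V y. openin T V \<Longrightarrow> y \<in> V \<Longrightarrow> \<exists>W\<in>\<B>. y \<in> W \<and> W \<subseteq> V"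
    using countable_base unfolding second_countable_def by metis
  have "\<exists>j. (SOME x. x \<in> from_nat_into \<B> j) \<in> W" if W: "openin T W" "W \<noteq> {}" for W
  proof -
    obtain x V where V: "x \<in> V" "V \<in> \<B>" "V \<subseteq> W" using W \<B>(3) by (metis equals0I)
    then obtain j where "from_nat_into \<B> j = V" using \<B>(1) from_nat_into_surj by metis
    then show ?thesis using V by (metis someI subsetD)
  qed
  then show ?thesis by (rule that)
qed

end

section \<open>Approximation by finite subsets\<close>

lemma distortion_isometric:
  assumes "\<And>x y x' y'. (x, y) \<in> R \<Longrightarrow> (x', y') \<in> R \<Longrightarrow> r y y' = l x x'"
  shows "distortion l r R = 0"
proof -
  have "ell_diff (l (fst u) (fst v)) (r (snd u) (snd v)) = 0" if "u \<in> R" "v \<in> R" for u v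
    using assms[of "fst u" "snd u" "fst v" "snd v"] that by (simp add: ell_diff_def)
  then have "distortion l r R \<le> 0"
    unfolding distortion_def case_prod_unfold by (intro SUP_least) (metis order_refl)
  then show ?thesis by simp
qed

lemma finite_SUP_tau_less_top:
  assumes "finite A" and "\<And>x y. x \<in> A \<Longrightarrow> y \<in> A \<Longrightarrow> l x y < (\<infinity>::ereal)"
  shows "(SUP x\<in>A. SUP y\<in>A. tau l x y) < \<infinity>"
proof -
  define B where "B = Max (insert 0 ((\<lambda>(x, y). tau l x y) ` (A \<times> A)))"
  have F: "finite (insert 0 ((\<lambda>(x, y). tau l x y) ` (A \<times> A)))" using assms by simp
  have "B \<in> insert 0 ((\<lambda>(x, y). tau l x y) ` (A \<times> A))" unfolding B_def by (rule Max_in[OF F]) simp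
  moreover have "tau l x y < \<infinity>" if "x \<in> A" "y \<in> A" for x y
    using assms(2)[OF that] by (auto simp: tau_def max_def)
  ultimately have "B < \<infinity>" by (auto simp del: ereal_infty_less)
  moreover have "tau l x y \<le> B" if "x \<in> A" "y \<in> A" for x y
    unfolding B_def using that by (intro Max_ge[OF F]) force
  then have "(SUP x\<in>A. SUP y\<in>A. tau l x y) \<le> B" by (intro SUP_least) auto
  ultimately show ?thesis by (metis le_less_trans)
qed

context compact_diamond_space
begin

text \<open>Points of the finite spaces are natural numbers; \<open>h\<close> will decode them.\<close>

lemma prelength_pullback_discrete:
  assumes "\<And>i. i \<in> I \<Longrightarrow> h i \<in> topspace T"
  shows "lorentzian_prelength_space (discrete_topology I) (\<lambda>i j. l (h i) (h j))"
proof -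
  have "openin (discrete_topology I) W"
    if "openin (topology_generated_by (chron_future I r ` I \<union> chron_past I r ` I)) W" for W r
  proof -
    have "generate_topology_on (chron_future I r ` I \<union> chron_past I r ` I) W"
      using that openin_topology_generated_by by blast
    then show ?thesis
      by induction (auto simp: chron_future_def chron_past_def)
  qed
  then show ?thesis
    using assms unfolding lorentzian_prelength_space_def
    by (auto simp: ell_diag ell_triangle ell_values)
qed

text \<open>All correspondences below are graphs of the coding map \<open>e\<close>, which preserves \<open>l\<close>. Their distortion is
  zero, so that the extension of a map on the vertices of one net to those of the next is again \<open>e\<close>.\<close>

theorem finite_approximation:
  assumes fin: "\<And>x y. x \<in> topspace T \<Longrightarrow> y \<in> topspace T \<Longrightarrow> l x y < \<infinity>"
    and small: "\<And>x \<epsilon>. x \<in> topspace T \<Longrightarrow> \<epsilon> > 0 \<Longrightarrow>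
          \<exists>V. openin T V \<and> x \<in> V \<and> (\<forall>p\<in>V. \<forall>q\<in>V. l p q \<le> ereal \<epsilon>)"
  shows "\<exists>b U. covered_lorentzian_prelength_space T l b U \<and>
           (\<exists>(X::nat \<Rightarrow> nat set) ls bs Us.
              (\<forall>n. finite (X n) \<and>
                   covered_lorentzian_prelength_space (discrete_topology (X n)) (ls n) (bs n) (Us n)) \<and>
              strong_pLGH_convergence (\<lambda>n. discrete_topology (X n)) ls bs Us T l b U)"
proof -
  obtain b U where b: "b \<in> topspace T" and U_cover: "(\<Union>k. U k) = topspace T"
    and U_open: "\<And>k. openin T (U k)" and U_mono: "\<And>k. U k \<subseteq> U (Suc k)" and bU: "\<And>k::nat. b \<in> U k"
    and U_dia: "\<And>k. \<exists>P. finite P \<and> P \<subseteq> topspace T \<times> topspace T \<and>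
          U k \<subseteq> (\<Union>(p, q)\<in>P. diamond (topspace T) l p q)"
    by (rule exhaustion) (rule that)
  have UX: "U k \<subseteq> topspace T" for k using U_cover by blast
  obtain P where P: "\<And>k. finite (P k) \<and> P k \<subseteq> topspace T \<times> topspace T \<and>
          U k \<subseteq> (\<Union>(p, q)\<in>P k. diamond (topspace T) l p q)"
    using U_dia by metis
  have covered: "covered_lorentzian_prelength_space T l b U"
    unfolding covered_lorentzian_prelength_space_def
    using prelength b U_cover U_mono bU tau_bounded_on_diamonds[OF fin, of "P k" "U k" for k] P by blast
  have K: "compactin T (\<Union>(p, q)\<in>P k. diamond (topspace T) l p q)" for k
    using P[of k] by (intro compactin_Union) (auto intro: compact_diamonds)
  have "\<exists>S. finite S \<and> eps_net (topspace T) l \<epsilon> (U k) S" if "\<epsilon> > 0" for k \<epsilon>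
    using net_of_compact[OF K[of k] _ that, of "U k"] P[of k] small that by metis
  moreover define Net0 where "Net0 k \<epsilon> = (SOME S. finite S \<and> eps_net (topspace T) l \<epsilon> (U k) S)" for k \<epsilon>
  ultimately have Net0: "finite (Net0 k \<epsilon>) \<and> eps_net (topspace T) l \<epsilon> (U k) (Net0 k \<epsilon>)" if "\<epsilon> > 0" for k \<epsilon>
    using that by (metis (mono_tags, lifting) someI_ex)
  obtain d :: "nat \<Rightarrow> 'a" where d: "\<And>W. openin T W \<Longrightarrow> W \<noteq> {} \<Longrightarrow> \<exists>j. d j \<in> W"
    by (rule countable_dense_sequence) (rule that)
  \<comment> \<open>The degenerate diamonds at the points of the dense sequence only serve the forward density; each of them
  belongs to all nets from some \<open>m\<close> on.\<close>
  define Net where "Net k m = Net0 k (1 / real m) \<union> {(d j, d j) | j. j \<le> m \<and> d j \<in> U k}" for k m :: nat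
  have Net: "finite (Net k m)" "eps_net (topspace T) l (1 / real m) (U k) (Net k m)" if "m \<ge> 1" for k m
  proof -
    have "{(d j, d j) | j. j \<le> m \<and> d j \<in> U k} \<subseteq> (\<lambda>j. (d j, d j)) ` {..m}" by auto
    then have "finite {(d j, d j) | j. j \<le> m \<and> d j \<in> U k}" by (meson finite_atMost finite_imageI finite_subset)
    then show "finite (Net k m)" using Net0[of "1 / real m" k] that by (simp add: Net_def)
    have "tau l (d j) (d j) \<le> ereal (1 / real m) \<and> diamond (topspace T) l (d j) (d j) \<inter> U k \<noteq> {}"
      if "d j \<in> U k" for j
    proof -
      have "d j \<in> topspace T" using that UX by blast
      then show ?thesis using that by (auto simp: tau_def ell_diag diamond_def causal_refl)
    qed
    then show "eps_net (topspace T) l (1 / real m) (U k) (Net k m)"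
      using Net0[of "1 / real m" k] that UX unfolding eps_net_def Net_def by fastforce
  qed
  have net_vertices: "vertices (Net k m) \<subseteq> topspace T" if "m \<ge> 1" for k m
    using Net(2)[OF that, of k] unfolding eps_net_def vertices_def by auto
  \<comment> \<open>Every diamond of a net has to meet the covered set. One common point is kept in the finite space.\<close>
  define witness where "witness k = (\<lambda>(p, q). SOME x. x \<in> diamond (topspace T) l p q \<inter> U k)" for k
  have witness: "witness k (p, q) \<in> diamond (topspace T) l p q \<inter> U k" if "(p, q) \<in> Net k m" "m \<ge> 1" for p q k m
  proof -
    have "diamond (topspace T) l p q \<inter> U k \<noteq> {}" using Net(2)[OF that(2), of k] that(1) unfolding eps_net_def by blast
    then show ?thesis unfolding witness_def case_prod_conv by (rule some_in_eq[THEN iffD2])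
  qed
  define Y where "Y n = insert b (\<Union>k\<le>n. \<Union>m\<in>{1..n}. vertices (Net k m) \<union> witness k ` Net k m)" for n
  have Y: "finite (Y n)" "Y n \<subseteq> topspace T" "b \<in> Y n" for n
  proof -
    have "finite (vertices (Net k m))" if "m \<ge> 1" for k m
      using Net(1)[OF that] by (simp add: vertices_def)
    then show "finite (Y n)" using Net(1) by (auto simp: Y_def)
    show "Y n \<subseteq> topspace T"
      using net_vertices b witness UX by (fastforce simp: Y_def)
    show "b \<in> Y n" by (simp add: Y_def)
  qed
  define W where "W = (\<Union>n. Y n)"
  have "countable W" unfolding W_def using Y(1) by (intro countable_UN) (auto intro: countable_finite)
  then obtain e :: "'a \<Rightarrow> nat" where e: "inj_on e W" by (rule countableE)
  define h where "h = the_inv_into W e"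
  have h: "h (e x) = x" if "x \<in> W" for x using e that by (simp add: h_def the_inv_into_f_f)
  have YW: "x \<in> W" if "x \<in> Y n" for x n using that by (auto simp: W_def)
  have hY: "h i \<in> Y n" if "i \<in> e ` Y n" for i n using that h YW by auto
  define X where "X n = e ` Y n" for n
  define ls where "ls = (\<lambda>(n::nat) i j. l (h i) (h j))"
  define bs where "bs = (\<lambda>n::nat. e b)"
  \<comment> \<open>The clause for \<open>k > n\<close> makes the union over \<open>k\<close> the whole finite space; convergence for a fixed \<open>k\<close>
  concerns only \<open>n \<ge> k\<close>.\<close>
  define Us where "Us n k = e ` (if k \<le> n then Y n \<inter> U k else Y n)" for n k :: nat
  have covered_n: "covered_lorentzian_prelength_space (discrete_topology (X n)) (ls n) (bs n) (Us n)" for n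
    unfolding covered_lorentzian_prelength_space_def
  proof (intro conjI allI)
    show "lorentzian_prelength_space (discrete_topology (X n)) (ls n)"
      unfolding ls_def by (rule prelength_pullback_discrete) (use hY Y(2) in \<open>auto simp: X_def\<close>)
    show "bs n \<in> topspace (discrete_topology (X n))" using Y(3) by (auto simp: bs_def X_def)
    have "Us n (Suc n) = e ` Y n" "Us n k \<subseteq> e ` Y n" for k by (auto simp: Us_def)
    then show "(\<Union>k. Us n k) = topspace (discrete_topology (X n))"
      unfolding X_def topspace_discrete_topology by blast
    fix k
    show "Us n k \<subseteq> Us n (Suc k)" using U_mono[of k] by (auto simp: Us_def)
    show "bs n \<in> Us n k" using Y(3) bU by (auto simp: bs_def Us_def)
    have "Us n k \<subseteq> X n" by (auto simp: Us_def X_def)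
    then show "(SUP x\<in>Us n k. SUP y\<in>Us n k. tau (ls n) x y) < \<infinity>"
    proof (intro finite_SUP_tau_less_top)
      show "finite (Us n k)" using Y(1) \<open>Us n k \<subseteq> X n\<close> by (auto simp: X_def intro: finite_subset)
      fix x y assume "x \<in> Us n k" "y \<in> Us n k"
      then have "h x \<in> Y n" "h y \<in> Y n" using \<open>Us n k \<subseteq> X n\<close> hY by (auto simp: X_def)
      then show "ls n x y < \<infinity>" unfolding ls_def using Y(2) fin by blast
    qed
  qed
  have conv: "strong_LGH_convergence (\<lambda>n. discrete_topology (X n)) ls (\<lambda>n. Us n k) T l (U k)" for k
  proof -
    \<comment> \<open>Nets are constructed for \<open>\<epsilon> = 1 / m\<close>, and there \<open>\<mu>\<close> has to return \<open>m\<close> itself.\<close>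
    define \<mu> where "\<mu> \<epsilon> = nat \<lceil>1 / \<epsilon>\<rceil>" for \<epsilon> :: real
    have \<mu>_inv: "\<mu> (1 / real m) = m" for m by (simp add: \<mu>_def)
    have \<mu>: "\<mu> \<epsilon> \<ge> 1" "1 / real (\<mu> \<epsilon>) \<le> \<epsilon>" if "\<epsilon> > 0" for \<epsilon>
    proof -
      have "1 / \<epsilon> > 0" using that by simp
      then show "\<mu> \<epsilon> \<ge> 1" by (simp add: \<mu>_def nat_le_iff Suc_le_eq)
      have "1 / \<epsilon> \<le> real (\<mu> \<epsilon>)" by (simp add: \<mu>_def real_nat_ceiling_ge)
      then show "1 / real (\<mu> \<epsilon>) \<le> \<epsilon>"
        using that \<open>\<mu> \<epsilon> \<ge> 1\<close> by (simp add: field_simps)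
    qed
    define N where "N \<epsilon> = max k (\<mu> \<epsilon>)" for \<epsilon>
    define S where "S \<epsilon> = Net k (\<mu> \<epsilon>)" for \<epsilon>
    define Sn where "Sn \<epsilon> n = map_prod e e ` S \<epsilon>" for \<epsilon> and n :: nat
    define R where "R \<epsilon> n = (\<lambda>x. (x, e x)) ` vertices (S \<epsilon>)" for \<epsilon> and n :: nat
    have SY: "vertices (S \<epsilon>) \<subseteq> Y n" "witness k ` S \<epsilon> \<subseteq> Y n" if "n \<ge> N \<epsilon>" "\<epsilon> > 0" for \<epsilon> n
    proof -
      have "k \<le> n" "\<mu> \<epsilon> \<in> {1..n}" using that \<mu>(1)[OF that(2)] by (auto simp: N_def)
      then show "vertices (S \<epsilon>) \<subseteq> Y n" "witness k ` S \<epsilon> \<subseteq> Y n" unfolding Y_def S_def by blast+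
    qed
    have SW: "x \<in> W" if "x \<in> vertices (S \<epsilon>)" "\<epsilon> > 0" for x \<epsilon>
      using SY(1)[of \<epsilon> "N \<epsilon>"] that YW by blast
    have vertices_Sn: "vertices (Sn \<epsilon> n) = e ` vertices (S \<epsilon>)" for \<epsilon> n
      by (simp add: vertices_def Sn_def image_Un image_image)
    have dist: "distortion l (ls n) ((\<lambda>x. (x, e x)) ` A) = 0" if "A \<subseteq> W" for A n
      using that h by (intro distortion_isometric) (auto simp: ls_def subset_iff)
    have "LGH_nets (\<lambda>n. topspace (discrete_topology (X n))) ls (\<lambda>n. Us n k) (topspace T) l (U k) N S Sn R"
      unfolding LGH_nets_def
    proof (intro allI impI conjI)
      fix \<epsilon> :: real assume \<epsilon>: "\<epsilon> > 0"
      show finS: "finite (S \<epsilon>)" using Net(1)[OF \<mu>(1)[OF \<epsilon>]] by (simp add: S_def)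
      have net: "eps_net (topspace T) l (1 / real (\<mu> \<epsilon>)) (U k) (S \<epsilon>)" using Net(2)[OF \<mu>(1)[OF \<epsilon>]] by (simp add: S_def)
      have mono: "t \<le> ereal (1 / real (\<mu> \<epsilon>)) \<Longrightarrow> t \<le> ereal \<epsilon>" for t
        using \<mu>(2)[OF \<epsilon>] by (meson ereal_less_eq(3) order_trans)
      then show netS: "eps_net (topspace T) l \<epsilon> (U k) (S \<epsilon>)" using net unfolding eps_net_def by blast
      have inS: "inj_on (map_prod e e) (S \<epsilon>)"
      proof (rule inj_onI)
        fix u v assume "u \<in> S \<epsilon>" "v \<in> S \<epsilon>" "map_prod e e u = map_prod e e v"
        moreover have "fst u \<in> W" "snd u \<in> W" if "u \<in> S \<epsilon>" for u
          using SW[OF _ \<epsilon>] that by (auto simp: vertices_def)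
        ultimately show "u = v" 
          using e unfolding inj_on_def by (metis fst_map_prod prod.expand snd_map_prod)
      qed
      show "(\<lambda>n. distortion l (ls n) (R \<epsilon> n)) \<longlonglongrightarrow> 0"
        using dist[of "vertices (S \<epsilon>)"] SW[OF _ \<epsilon>] by (simp add: R_def subset_iff)
      fix n assume n: "N \<epsilon> \<le> n"
      show "finite (Sn \<epsilon> n)" using finS by (simp add: Sn_def)
      show "card (Sn \<epsilon> n) = card (S \<epsilon>)" using inS by (simp add: Sn_def card_image)
      show "correspondence (vertices (S \<epsilon>)) (vertices (Sn \<epsilon> n)) (R \<epsilon> n)"
        unfolding correspondence_def vertices_Sn R_def by (auto simp: image_image)
      have "k \<le> n" using n by (simp add: N_def)
      then have Usk: "Us n k = e ` (Y n \<inter> U k)" by (simp add: Us_def)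
      have pqY: "p \<in> Y n" "q \<in> Y n" if "(p, q) \<in> S \<epsilon>" for p q
        using SY(1)[OF n \<epsilon>] that by (force simp: vertices_def)+
      have dia: "e x \<in> diamond (X n) (ls n) (e p) (e q)"
        if "x \<in> Y n" "p \<in> Y n" "q \<in> Y n" "x \<in> diamond (topspace T) l p q" for x p q
        using that h YW by (auto simp: diamond_def X_def ls_def causal_def)
      show "eps_net (topspace (discrete_topology (X n))) (ls n) \<epsilon> (Us n k) (Sn \<epsilon> n)"
        unfolding eps_net_def
      proof (intro conjI)
        show "Sn \<epsilon> n \<subseteq> topspace (discrete_topology (X n)) \<times> topspace (discrete_topology (X n))"
          using pqY by (auto simp: Sn_def X_def)
        have "tau (ls n) (e p) (e q) \<le> ereal \<epsilon> \<and> diamond (X n) (ls n) (e p) (e q) \<inter> Us n k \<noteq> {}"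
          if pq: "(p, q) \<in> S \<epsilon>" for p q
        proof
          have "tau l p q \<le> ereal \<epsilon>" using netS pq unfolding eps_net_def by blast
          then show "tau (ls n) (e p) (e q) \<le> ereal \<epsilon>" using pqY[OF pq] h YW by (simp add: tau_def ls_def)
          have "witness k (p, q) \<in> diamond (topspace T) l p q \<inter> U k"
            using witness[of p q k "\<mu> \<epsilon>"] pq \<mu>(1)[OF \<epsilon>] by (simp add: S_def)
          moreover have "witness k (p, q) \<in> Y n" using SY(2)[OF n \<epsilon>] pq by blast
          ultimately have "e (witness k (p, q)) \<in> diamond (X n) (ls n) (e p) (e q) \<inter> Us n k"
            using dia pqY[OF pq] Usk by auto
          then show "diamond (X n) (ls n) (e p) (e q) \<inter> Us n k \<noteq> {}" by blast
        qed
        then show "\<forall>(p, q)\<in>Sn \<epsilon> n. tau (ls n) p q \<le> ereal \<epsilon> \<and>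
            diamond (topspace (discrete_topology (X n))) (ls n) p q \<inter> Us n k \<noteq> {}"
          by (auto simp: Sn_def)
        show "Us n k \<subseteq> (\<Union>(p, q)\<in>Sn \<epsilon> n. diamond (topspace (discrete_topology (X n))) (ls n) p q)"
        proof
          fix i assume "i \<in> Us n k"
          then obtain x where x: "x \<in> Y n" "x \<in> U k" "i = e x" using Usk by blast
          then obtain p q where pq: "(p, q) \<in> S \<epsilon>" "x \<in> diamond (topspace T) l p q"
            using netS unfolding eps_net_def by blast
          then have "(e p, e q) \<in> Sn \<epsilon> n" "i \<in> diamond (X n) (ls n) (e p) (e q)"
            using dia x pqY[OF pq(1)] by (force simp: Sn_def)+
          then show "i \<in> (\<Union>(p, q)\<in>Sn \<epsilon> n. diamond (topspace (discrete_topology (X n))) (ls n) p q)"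
            by auto
        qed
      qed
    qed
    moreover have "LGH_extension ls l N S Sn R"
      unfolding LGH_extension_def Let_def
    proof (intro allI impI)
      fix m f n
      assume m: "1 \<le> m" and f: "\<forall>n\<ge>N (1 / real m). \<forall>x\<in>vertices (S (1 / real m)). (x, f n x) \<in> R (1 / real m) n"
        and n: "N (1 / real m) \<le> n"
      define n' where "n' = max n (N (1 / real (Suc m)))"
      have n': "n' \<ge> n" "n' \<ge> N (1 / real (Suc m))" by (auto simp: n'_def)
      have "\<forall>x\<in>vertices (S (1 / real m)). e x = f n' x"
      proof
        fix x assume "x \<in> vertices (S (1 / real m))"
        then have "(x, f n' x) \<in> R (1 / real m) n'" using f n n' by (meson order_trans)
        then show "e x = f n' x" by (auto simp: R_def)
      qed
      moreover have "e ` (vertices (S (1 / real m)) \<union> vertices (S (1 / real (Suc m))))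
          \<subseteq> vertices (Sn (1 / real m) n') \<union> vertices (Sn (1 / real (Suc m)) n')"
        by (auto simp: vertices_Sn)
      moreover have "map_distortion l (ls n') (vertices (S (1 / real m)) \<union> vertices (S (1 / real (Suc m)))) e = 0"
        unfolding map_distortion_def using SW m by (intro dist) (auto simp del: of_nat_Suc)
      ultimately show "\<exists>n'\<ge>n. N (1 / real (Suc m)) \<le> n' \<and>
         (\<exists>F. (\<forall>x\<in>vertices (S (1 / real m)). F x = f n' x) \<and>
           F ` (vertices (S (1 / real m)) \<union> vertices (S (1 / real (Suc m))))
              \<subseteq> vertices (Sn (1 / real m) n') \<union> vertices (Sn (1 / real (Suc m)) n') \<and>
           map_distortion l (ls n') (vertices (S (1 / real m)) \<union> vertices (S (1 / real (Suc m)))) F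
             \<le> map_distortion l (ls n') (vertices (S (1 / real m))) (f n'))"
        using n' by (intro exI[of _ n'] conjI exI[of _ e]) simp_all
    qed
    moreover have "strong_forward_density T l (U k) (\<Union>m\<in>{1..}. vertices (S (1 / real m)))"
      unfolding strong_forward_density_def
    proof
      fix x assume "x \<in> U k - (\<Union>m\<in>{1..}. vertices (S (1 / real m)))"
      then have "x \<in> U k" by simp
      then obtain s :: "nat \<Rightarrow> 'a" where s: "\<forall>i. s i \<in> U k \<inter> range d \<and> chron l (s i) (s (Suc i)) \<and> chron l (s i) x"
        "limitin T s x sequentially"
        using chronological_approximation[OF d U_open \<open>x \<in> U k\<close>] by blast
      have "U k \<inter> range d \<subseteq> (\<Union>m\<in>{1..}. vertices (S (1 / real m)))"
      proof
        fix y assume "y \<in> U k \<inter> range d"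
        then obtain j where j: "y = d j" "d j \<in> U k" by blast
        then have "(d j, d j) \<in> Net k (Suc j)" by (auto simp: Net_def)
        then have "y \<in> vertices (S (1 / real (Suc j)))"
          unfolding S_def \<mu>_inv vertices_def using j by force
        then show "y \<in> (\<Union>m\<in>{1..}. vertices (S (1 / real m)))" by force
      qed
      then have "\<forall>i. s i \<in> (\<Union>m\<in>{1..}. vertices (S (1 / real m))) \<and> chron l (s i) (s (Suc i)) \<and> chron l (s i) x"
        using s(1) by (meson subsetD)
      then show "\<exists>s. (\<forall>i. s i \<in> (\<Union>m\<in>{1..}. vertices (S (1 / real m))) \<and> chron l (s i) (s (Suc i)) \<and> chron l (s i) x)
           \<and> limitin T s x sequentially"
        using s(2) by (intro exI[of _ s] conjI)
    qed
    ultimately show ?thesis unfolding strong_LGH_convergence_def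
      by (intro exI[of _ N] exI[of _ S] exI[of _ Sn] exI[of _ R] conjI)
  qed
  show ?thesis
    unfolding strong_pLGH_convergence_def
    using covered covered_n conv Y(1)
    by (intro exI[of _ b] exI[of _ U] conjI exI[of _ X] exI[of _ ls] exI[of _ bs] exI[of _ Us] allI)
       (simp_all add: X_def)
qed

end

section \<open>Lower integrals and Lipschitz functions\<close>

text \<open>The length integrates the speed computed in a chart that is chosen separately at each parameter, and the
  measurability of this function is not obvious. The integral of an arbitrary nonnegative function is a
  lower integral; it is attained by a measurable minorant, to which the rules for measurable functions
  apply. This gives superadditivity, translation invariance and additivity over subsets in general.\<close>

lemma nn_integral_minorant:
  obtains g where "g \<in> borel_measurable M" "\<And>x. g x \<le> f x" "integral\<^sup>N M g = integral\<^sup>N M f"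
proof -
  have "{g. simple_function M g \<and> g \<le> f} \<noteq> {}"
    by (auto intro!: exI[of _ "\<lambda>_. 0"] simp: le_fun_def)
  from ennreal_SUP_countable_SUP[OF this, of "integral\<^sup>S M"]
  obtain r :: "nat \<Rightarrow> ennreal" where r: "range r \<subseteq> integral\<^sup>S M ` {g. simple_function M g \<and> g \<le> f}"
    "integral\<^sup>N M f = (SUP n. r n)"
    unfolding nn_integral_def by blast
  then have "\<forall>n. \<exists>g. simple_function M g \<and> g \<le> f \<and> r n = integral\<^sup>S M g" by blast
  then obtain g where g: "\<And>n. simple_function M (g n)" "\<And>n. g n \<le> f" "\<And>n. r n = integral\<^sup>S M (g n)"
    by metis
  define h where "h x = (SUP n. g n x)" for x
  have [measurable]: "h \<in> borel_measurable M"
    unfolding h_def using g(1) by (intro borel_measurable_SUP) (auto intro: borel_measurable_simple_function)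
  have le: "h x \<le> f x" for x unfolding h_def using g(2) by (auto intro!: SUP_least simp: le_fun_def)
  have "integral\<^sup>N M f \<le> integral\<^sup>N M h"
    unfolding r(2)
  proof (rule SUP_least)
    fix n
    have "r n = integral\<^sup>N M (g n)" using g by (simp add: nn_integral_eq_simple_integral)
    also have "\<dots> \<le> integral\<^sup>N M h" unfolding h_def by (intro nn_integral_mono SUP_upper) simp
    finally show "r n \<le> integral\<^sup>N M h" .
  qed
  moreover have "integral\<^sup>N M h \<le> integral\<^sup>N M f" by (intro nn_integral_mono le)
  ultimately show ?thesis using le that[of h] by auto
qed

lemma nn_integral_superadditive:
  "integral\<^sup>N M f + integral\<^sup>N M g \<le> (\<integral>\<^sup>+x. f x + g x \<partial>M)"
proof -
  obtain f' where [measurable]: "f' \<in> borel_measurable M" and f': "\<And>x. f' x \<le> f x" "integral\<^sup>N M f' = integral\<^sup>N M f"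
    by (rule nn_integral_minorant) (rule that)
  obtain g' where [measurable]: "g' \<in> borel_measurable M" and g': "\<And>x. g' x \<le> g x" "integral\<^sup>N M g' = integral\<^sup>N M g"
    by (rule nn_integral_minorant) (rule that)
  have "integral\<^sup>N M f + integral\<^sup>N M g = (\<integral>\<^sup>+x. f' x + g' x \<partial>M)"
    by (simp add: nn_integral_add f'(2)[symmetric] g'(2)[symmetric])
  also have "\<dots> \<le> (\<integral>\<^sup>+x. f x + g x \<partial>M)" by (intro nn_integral_mono add_mono f' g')
  finally show ?thesis .
qed

lemma nn_integral_translation_lebesgue:
  fixes f :: "real \<Rightarrow> ennreal"
  shows "integral\<^sup>N lebesgue f \<le> (\<integral>\<^sup>+x. f (s + x) \<partial>lebesgue)"
proof -
  obtain f' where f'm: "f' \<in> borel_measurable lebesgue" and f': "\<And>x. f' x \<le> f x"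
    "integral\<^sup>N lebesgue f' = integral\<^sup>N lebesgue f"
    by (rule nn_integral_minorant) (rule that)
  have "integral\<^sup>N lebesgue f = (\<integral>\<^sup>+x. f' (s + x) \<partial>lebesgue)"
    using nn_integral_real_affine_lebesgue[OF f'm, of 1 s] f' by simp
  also have "\<dots> \<le> (\<integral>\<^sup>+x. f (s + x) \<partial>lebesgue)" by (intro nn_integral_mono f')
  finally show ?thesis .
qed

lemma nn_integral_subadditive_on_cover:
  assumes [measurable]: "A \<in> sets M" "B \<in> sets M" and "C \<subseteq> A \<union> B"
  shows "(\<integral>\<^sup>+x\<in>C. f x \<partial>M) \<le> (\<integral>\<^sup>+x\<in>A. f x \<partial>M) + (\<integral>\<^sup>+x\<in>B. f x \<partial>M)"
proof -
  obtain f' where [measurable]: "f' \<in> borel_measurable M" and f': "\<And>x. f' x \<le> f x * indicator C x"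
    "integral\<^sup>N M f' = (\<integral>\<^sup>+x\<in>C. f x \<partial>M)"
    by (rule nn_integral_minorant) (rule that)
  have f'C: "f' x \<le> f x" "x \<notin> C \<Longrightarrow> f' x = 0" for x
    using f'(1)[of x] by (cases "x \<in> C"; simp)+
  have "f' x \<le> f' x * indicator A x + f' x * indicator B x" for x
    using f'C(2)[of x] \<open>C \<subseteq> A \<union> B\<close> by (cases "x \<in> A"; cases "x \<in> B") (auto simp: indicator_def)
  then have "(\<integral>\<^sup>+x\<in>C. f x \<partial>M) \<le> (\<integral>\<^sup>+x. f' x * indicator A x + f' x * indicator B x \<partial>M)"
    unfolding f'(2)[symmetric] by (intro nn_integral_mono)
  also have "\<dots> = (\<integral>\<^sup>+x\<in>A. f' x \<partial>M) + (\<integral>\<^sup>+x\<in>B. f' x \<partial>M)"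
    by (rule nn_integral_add) auto
  also have "\<dots> \<le> (\<integral>\<^sup>+x\<in>A. f x \<partial>M) + (\<integral>\<^sup>+x\<in>B. f x \<partial>M)"
    by (intro add_mono nn_integral_mono mult_right_mono f'C) auto
  finally show ?thesis .
qed

lemma AE_lebesgue_translation:
  fixes P :: "real \<Rightarrow> bool"
  assumes "AE t in lebesgue. P t" shows "AE t in lebesgue. P (t + s)"
proof -
  obtain N where N: "negligible N" "{t. \<not> P t} \<subseteq> N"
    using assms by (auto simp: eventually_ae_filter negligible_iff_null_sets)
  have "negligible ((+) (-s) ` N)" using N(1) by (rule negligible_translation)
  moreover have "{t. \<not> P (t + s)} \<subseteq> (+) (-s) ` N"
  proof
    fix t assume "t \<in> {t. \<not> P (t + s)}"
    then have "t + s \<in> N" "t = (+) (-s) (t + s)" using N(2) by auto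
    then show "t \<in> (+) (-s) ` N" by blast
  qed
  ultimately show ?thesis
    by (intro AE_I'[of "(+) (-s) ` N"]) (auto simp: negligible_iff_null_sets)
qed

text \<open>The difference quotients of \<open>f\<close> are bounded by \<open>L\<close> and converge to \<open>g\<close> almost everywhere. Their
  integrals are differences of mean values of \<open>f\<close> over short intervals at \<open>b\<close> and \<open>a\<close>, and converge
  to \<open>f b - f a\<close>. Dominated convergence identifies the two limits.\<close>

lemma lipschitz_fundamental_theorem:
  fixes f g :: "real \<Rightarrow> real"
  assumes "a < b" and lip: "L-lipschitz_on {a..b} f"
    and deriv: "AE t in lebesgue. t \<in> {a..b} \<longrightarrow> (f has_real_derivative g t) (at t)"
    and pos: "AE t in lebesgue. t \<in> {a..b} \<longrightarrow> 0 \<le> g t"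
  shows "(\<integral>\<^sup>+t\<in>{a..b}. ennreal (g t) \<partial>lebesgue) = ennreal (f b - f a)"
proof -
  \<comment> \<open>Constant extension beyond the interval, so that the difference quotients are defined up to \<open>b\<close>.\<close>
  define F where "F t = f (max a (min b t))" for t
  have L: "L \<ge> 0" using lip by (rule lipschitz_on_nonneg)
  have Fl: "\<bar>F s - F t\<bar> \<le> L * \<bar>s - t\<bar>" for s t
  proof -
    have "\<bar>F s - F t\<bar> \<le> L * \<bar>max a (min b s) - max a (min b t)\<bar>"
      unfolding F_def using lipschitz_onD[OF lip, of "max a (min b s)" "max a (min b t)"] \<open>a < b\<close>
      by (auto simp: dist_real_def)
    also have "\<dots> \<le> L * \<bar>s - t\<bar>" using L by (intro mult_left_mono) auto
    finally show ?thesis .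
  qed
  have Fcont: "continuous_on S F" for S
  proof -
    have "L-lipschitz_on S F" using Fl L by (intro lipschitz_onI) (auto simp: dist_real_def)
    then show ?thesis by (rule lipschitz_on_continuous_on)
  qed
  have [measurable]: "F \<in> borel_measurable lborel" "F \<in> borel_measurable borel"
    using Fcont[of UNIV] by (auto intro: borel_measurable_continuous_onI)
  define h where "h n = 1 / real (Suc n)" for n
  have h: "h n > 0" "h \<longlonglongrightarrow> 0" for n
    unfolding h_def by (simp, rule LIMSEQ_inverse_real_of_nat[unfolded inverse_eq_divide])
  define D where "D n t = indicator {a..b} t * ((F (t + h n) - F t) / h n)" for n t
  have [measurable]: "D n \<in> borel_measurable borel" for n unfolding D_def by measurable
  have ae_ab: "AE t in lebesgue. t \<noteq> a \<and> t \<noteq> b"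
    using AE_I'[of "{a,b}" lebesgue "\<lambda>t. t \<noteq> a \<and> t \<noteq> b"] by (auto simp: negligible_iff_null_sets[symmetric])
  have lim: "AE t in lebesgue. (\<lambda>n. D n t) \<longlonglongrightarrow> indicator {a..b} t * g t"
    using deriv ae_ab
  proof eventually_elim
    case (elim t)
    show ?case
    proof (cases "t \<in> {a..b}")
      case True
      then have t: "a < t" "t < b" "(f has_real_derivative g t) (at t)" using elim by auto
      have "((\<lambda>x. (f (t + x) - f t) / x) \<longlongrightarrow> g t) (at 0)" using t(3) by (simp add: DERIV_def)
      then have "(\<lambda>n. (f (t + h n) - f t) / h n) \<longlonglongrightarrow> g t"
        by (rule filterlim_compose) (use h in \<open>auto simp: filterlim_at less_imp_neq[symmetric]\<close>)
      moreover have "\<forall>\<^sub>F n in sequentially. (f (t + h n) - f t) / h n = D n t"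
      proof -
        have "\<forall>\<^sub>F n in sequentially. h n < b - t"
          using h(2) t(2) by (intro order_tendstoD) auto
        then show ?thesis
        proof eventually_elim
          case (elim n)
          have "F (t + h n) = f (t + h n)" "F t = f t" using elim t h(1)[of n] by (auto simp: F_def)
          then show ?case using True by (simp add: D_def)
        qed
      qed
      ultimately show ?thesis using True by (auto intro: Lim_transform_eventually)
    qed (simp add: D_def)
  qed
  have bound: "\<bar>D n t\<bar> \<le> indicator {a..b} t * L" for n t
    using Fl[of "t + h n" t] h(1)[of n] L by (auto simp: D_def indicator_def field_simps)
  have Dm: "D n \<in> borel_measurable lebesgue" for n by (rule measurable_completion) simp
  have gm: "(\<lambda>t. indicator {a..b} t * g t) \<in> borel_measurable lebesgue"
  proof -
    have "(\<lambda>t. lim (\<lambda>n. D n t)) \<in> borel_measurable lebesgue" using Dm by (rule borel_measurable_lim_metric)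
    moreover have "AE t in lebesgue. lim (\<lambda>n. D n t) = indicator {a..b} t * g t"
      using lim by eventually_elim (rule limI)
    ultimately show ?thesis by (rule borel_measurable_AE)
  qed
  have wi: "integrable lebesgue (\<lambda>t. indicator {a..b} t * L)"
    by (intro integrable_mult_left) (use \<open>a < b\<close> in \<open>auto simp: integrable_indicator_iff\<close>)
  have bound': "AE t in lebesgue. norm (D n t) \<le> indicator {a..b} t * L" for n using bound by simp
  have int_lim: "(\<lambda>n. integral\<^sup>L lebesgue (D n)) \<longlonglongrightarrow> (LINT t|lebesgue. indicator {a..b} t * g t)"
    by (rule integral_dominated_convergence[OF gm Dm wi lim bound'])
  have int_g: "integrable lebesgue (\<lambda>t. indicator {a..b} t * g t)"
    by (rule integrable_dominated_convergence[OF gm Dm wi lim bound'])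
  define \<Phi> where "\<Phi> x = integral {a..x} F" for x
  have Fint: "F integrable_on {c..d}" for c d by (intro integrable_continuous_real Fcont)
  have intD: "integral\<^sup>L lebesgue (D n) = (\<Phi> (b + h n) - \<Phi> b) / h n - (\<Phi> (a + h n) - \<Phi> a) / h n" for n
  proof -
    have hn: "h n > 0" by (rule h)
    have cD: "continuous_on {a..b} (\<lambda>t. (F (t + h n) - F t) / h n)"
      by (intro continuous_intros continuous_on_compose2[OF Fcont[of UNIV]]) (use hn in auto)
    have "integral\<^sup>L lebesgue (D n) = integral\<^sup>L lborel (D n)"
      by (rule integral_completion) simp
    also have "\<dots> = (LINT t:{a..b}|lborel. (F (t + h n) - F t) / h n)"
      unfolding D_def set_lebesgue_integral_def real_scaleR_def by (rule refl)
    also have "\<dots> = integral {a..b} (\<lambda>t. (F (t + h n) - F t) / h n)"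
      by (intro set_borel_integral_eq_integral borel_integrable_atLeastAtMost' cD)
    also have "\<dots> = (integral {a..b} (\<lambda>t. F (t + h n)) - integral {a..b} F) / h n"
    proof -
      have "(\<lambda>t. F (t + h n)) integrable_on {a..b}"
        by (intro integrable_continuous_real continuous_on_compose2[OF Fcont[of UNIV]] continuous_intros) auto
      then show ?thesis using Fint by (simp add: integral_diff)
    qed
    also have "integral {a..b} (\<lambda>t. F (t + h n)) = integral {a + h n..b + h n} F"
      using integral_shift[OF Fcont, of a b "h n"] by (simp add: o_def)
    also have "integral {a + h n..b + h n} F = \<Phi> (b + h n) - \<Phi> (a + h n)"
      using Henstock_Kurzweil_Integration.integral_combine[where a = a and c = "a + h n" and b = "b + h n" and f = F] Fint hn \<open>a < b\<close> by (simp add: \<Phi>_def)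
    also have "integral {a..b} F = \<Phi> b - \<Phi> a" by (simp add: \<Phi>_def)
    finally show ?thesis by (simp add: diff_divide_distrib)
  qed
  have \<Phi>d: "(\<lambda>n. (\<Phi> (x + h n) - \<Phi> x) / h n) \<longlonglongrightarrow> F x" if "x \<ge> a" for x
  proof -
    have "((\<lambda>u. integral {a..u} F) has_real_derivative F x) (at x within {a..x + 1})"
      by (rule integral_has_real_derivative[OF Fcont]) (use that in auto)
    then have "((\<lambda>y. (\<Phi> y - \<Phi> x) / (y - x)) \<longlongrightarrow> F x) (at x within {a..x + 1})"
      by (simp add: has_field_derivative_iff \<Phi>_def)
    moreover have "filterlim (\<lambda>n. x + h n) (at x within {a..x + 1}) sequentially"
    proof -
      have "(\<lambda>n. x + h n) \<longlonglongrightarrow> x" using tendsto_add[OF tendsto_const h(2), of x] by simp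
      moreover have "x + h n \<noteq> x \<and> x + h n \<in> {a..x + 1}" for n
        using h(1)[of n] that by (simp add: h_def add_increasing2)
      ultimately show ?thesis by (auto simp: filterlim_at)
    qed
    ultimately have "(\<lambda>n. (\<Phi> (x + h n) - \<Phi> x) / (x + h n - x)) \<longlonglongrightarrow> F x" by (rule filterlim_compose)
    then show ?thesis by simp
  qed
  have "(\<lambda>n. integral\<^sup>L lebesgue (D n)) \<longlonglongrightarrow> F b - F a"
    unfolding intD using \<open>a < b\<close> by (intro tendsto_diff \<Phi>d) auto
  then have eq: "(LINT t|lebesgue. indicator {a..b} t * g t) = f b - f a"
    using LIMSEQ_unique[OF int_lim] \<open>a < b\<close> by (simp add: F_def)
  have "(\<integral>\<^sup>+t\<in>{a..b}. ennreal (g t) \<partial>lebesgue) = (\<integral>\<^sup>+t. ennreal (indicator {a..b} t * g t) \<partial>lebesgue)"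
    by (intro nn_integral_cong) (simp add: indicator_def)
  also have "\<dots> = ennreal (LINT t|lebesgue. indicator {a..b} t * g t)"
    using pos by (intro nn_integral_eq_integral int_g) (auto simp: indicator_def)
  finally show ?thesis by (simp add: eq)
qed

lemma locally_lipschitz_imp_lipschitz:
  fixes f :: "real \<Rightarrow> 'a::metric_space"
  assumes "a \<le> b" and loc: "\<And>t. t \<in> {a..b} \<Longrightarrow> \<exists>\<delta>>0. \<exists>L. L-lipschitz_on ({a..b} \<inter> ball t \<delta>) f"
  shows "\<exists>L. L-lipschitz_on {a..b} f"
proof -
  have "a \<le> a \<and> b \<le> b \<longrightarrow> (\<exists>L. L-lipschitz_on {a..b} f)"
    using \<open>a \<le> b\<close>
  proof (induction rule: Bolzano[where P = "\<lambda>x y. a \<le> x \<and> y \<le> b \<longrightarrow> (\<exists>L. L-lipschitz_on {x..y} f)"])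
    case (trans x y z)
    show ?case
    proof
      assume "a \<le> x \<and> z \<le> b"
      then obtain L K where "L-lipschitz_on {x..y} f" "K-lipschitz_on {y..z} f"
        using trans by auto
      from lipschitz_on_concat_max[OF this] show "\<exists>L. L-lipschitz_on {x..z} f" by auto
    qed
  next
    case (local t)
    then obtain \<delta> L where \<delta>: "\<delta> > 0" "L-lipschitz_on ({a..b} \<inter> ball t \<delta>) f" using loc[of t] by (metis atLeastAtMost_iff)
    show ?case
    proof (rule exI[of _ \<delta>], intro conjI allI impI)
      fix x y assume "x \<le> t \<and> t \<le> y \<and> y - x < \<delta>" "a \<le> x \<and> y \<le> b"
      then have "{x..y} \<subseteq> {a..b} \<inter> ball t \<delta>" by (auto simp: dist_real_def)
      then show "\<exists>L. L-lipschitz_on {x..y} f" using \<delta>(2) lipschitz_on_subset by blast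
    qed (fact \<delta>)
  qed
  then show ?thesis by simp
qed

text \<open>The partial derivatives are continuous, hence bounded on a compact ball, and they bound the operator norm
  of the derivative.\<close>

lemma Ck1_locally_lipschitz:
  fixes f :: "'a::euclidean_space \<Rightarrow> 'b::real_normed_vector"
  assumes "open S" "x \<in> S" "Ck_on (Suc 0) S f"
  obtains r L where "r > 0" "cball x r \<subseteq> S" "L-lipschitz_on (cball x r) f"
proof -
  obtain r where r: "r > 0" "cball x r \<subseteq> S" using assms open_contains_cball by blast
  define D where "D y = frechet_derivative f (at y)" for y
  have der: "(f has_derivative D y) (at y)" if "y \<in> S" for y
    using assms that by (simp add: D_def frechet_derivative_works)
  have "\<exists>B. \<forall>y\<in>cball x r. norm (D y i) \<le> B" for i
  proof -
    have "continuous_on (cball x r) (\<lambda>y. D y i)"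
      using assms r by (auto simp: D_def intro: continuous_on_subset)
    then have "bounded ((\<lambda>y. D y i) ` cball x r)"
      by (intro compact_imp_bounded compact_continuous_image) auto
    then show ?thesis by (auto simp: bounded_iff)
  qed
  then obtain B where B: "\<And>i y. y \<in> cball x r \<Longrightarrow> norm (D y i) \<le> B i" by metis
  define L where "L = (\<Sum>i\<in>Basis. B i)"
  have "onorm (D y) \<le> L" if y: "y \<in> cball x r" for y
  proof (rule onorm_le)
    fix v
    have lin: "linear (D y)" using der y r has_derivative_linear by blast
    have "D y v = D y (\<Sum>i\<in>Basis. (v \<bullet> i) *\<^sub>R i)" by (simp add: euclidean_representation)
    also have "\<dots> = (\<Sum>i\<in>Basis. (v \<bullet> i) *\<^sub>R D y i)" using lin by (simp add: linear_sum linear_scale)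
    finally have "norm (D y v) \<le> (\<Sum>i\<in>Basis. norm ((v \<bullet> i) *\<^sub>R D y i))" by (metis norm_sum)
    also have "\<dots> \<le> (\<Sum>i\<in>Basis. norm v * B i)"
      using B y by (intro sum_mono) (auto intro!: mult_mono Basis_le_norm)
    finally show "norm (D y v) \<le> L * norm v" by (simp add: L_def sum_distrib_left mult.commute)
  qed
  note on = this
  have "norm (f y - f z) \<le> L * norm (y - z)" if "y \<in> cball x r" "z \<in> cball x r" for y z
  proof (rule differentiable_bound[of "cball x r" f D])
    show "(f has_derivative D w) (at w within cball x r)" if "w \<in> cball x r" for w
      using der[of w] that r has_derivative_at_withinI by blast
    show "onorm (D w) \<le> L" if "w \<in> cball x r" for w using on[OF that] .
  qed (rule convex_cball that)+
  moreover have "L \<ge> 0"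
  proof -
    have "B i \<ge> 0" for i using order_trans[OF norm_ge_zero B[of x i]] r(1) by simp
    then show ?thesis by (simp add: L_def sum_nonneg)
  qed
  ultimately have "L-lipschitz_on (cball x r) f" by (auto intro!: lipschitz_onI simp: dist_norm)
  with r that show ?thesis by blast
qed

section \<open>Charts and causal curves\<close>

locale lorentz_spacetime =
  fixes M :: "('m, 'e::euclidean_space) lorentz_structure"
  assumes spacetime: "spacetime M"
begin

abbreviation coord_inv :: "('m, 'e) chart \<Rightarrow> 'e \<Rightarrow> 'm" where
  "coord_inv c \<equiv> inv_into (fst c) (snd c)"

lemma manifold: "smooth_manifold (mtop M) (atlas M)"
  using spacetime by (simp add: spacetime_def)

lemma chart_at: "p \<in> topspace (mtop M) \<Longrightarrow> \<exists>c\<in>atlas M. p \<in> fst c"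
  using manifold by (auto simp: smooth_manifold_def)

lemma chart_props:
  assumes "c \<in> atlas M"
  shows openin_chart: "openin (mtop M) (fst c)" and open_chart_image: "open (snd c ` fst c)"
    and homeomorphic_chart: "homeomorphic_map (subtopology (mtop M) (fst c)) (top_of_set (snd c ` fst c)) (snd c)"
  using manifold assms by (auto simp: smooth_manifold_def case_prod_unfold)

lemma chart_subset: "c \<in> atlas M \<Longrightarrow> fst c \<subseteq> topspace (mtop M)"
  using openin_chart openin_subset by blast

lemma inj_on_chart: "c \<in> atlas M \<Longrightarrow> inj_on (snd c) (fst c)"
  using homeomorphic_chart[of c] chart_subset[of c]
  by (simp add: homeomorphic_map_def Int_absorb1)

lemma coord_inv_coord: "c \<in> atlas M \<Longrightarrow> p \<in> fst c \<Longrightarrow> coord_inv c (snd c p) = p"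
  by (simp add: inj_on_chart)

lemma coord_coord_inv: "x \<in> snd c ` fst c \<Longrightarrow> snd c (coord_inv c x) = x"
  by (rule f_inv_into_f)

lemma coord_inv_in: "x \<in> snd c ` fst c \<Longrightarrow> coord_inv c x \<in> fst c"
  by (rule inv_into_into)

lemma continuous_coord:
  assumes "c \<in> atlas M" shows "continuous_map (subtopology (mtop M) (fst c)) euclidean (snd c)"
  using homeomorphic_imp_continuous_map[OF homeomorphic_chart[OF assms]]
  by (simp add: continuous_map_in_subtopology)

lemma continuous_coord_inv:
  assumes "c \<in> atlas M"
  shows "continuous_map (top_of_set (snd c ` fst c)) (subtopology (mtop M) (fst c)) (coord_inv c)"
proof -
  obtain g where g: "homeomorphic_maps (subtopology (mtop M) (fst c)) (top_of_set (snd c ` fst c)) (snd c) g"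
    using homeomorphic_chart[OF assms] homeomorphic_map_maps by blast
  have "g x = coord_inv c x" if "x \<in> snd c ` fst c" for x
    using that g assms chart_subset[OF assms] by (auto simp: homeomorphic_maps_def coord_inv_coord subset_iff)
  then show ?thesis
    using g by (auto simp: homeomorphic_maps_def intro: continuous_map_eq)
qed

lemma openin_chart_preimage:
  assumes "c \<in> atlas M" "open W" shows "openin (mtop M) {p \<in> fst c. snd c p \<in> W}"
proof -
  have "openin (subtopology (mtop M) (fst c)) {p \<in> topspace (subtopology (mtop M) (fst c)). snd c p \<in> W}"
    using continuous_coord[OF assms(1)] assms(2) by (intro openin_continuous_map_preimage) auto
  then show ?thesis
    using openin_chart[OF assms(1)] chart_subset[OF assms(1)]
    by (simp add: openin_open_subtopology Int_absorb1)
qed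

lemma open_coord_image:
  assumes "c \<in> atlas M" "openin (mtop M) W" shows "open (snd c ` (fst c \<inter> W))"
proof -
  have "openin (subtopology (mtop M) (fst c)) (fst c \<inter> W)"
    using assms by (metis inf_commute openin_subtopology_Int)
  then have "openin (top_of_set (snd c ` fst c)) (snd c ` (fst c \<inter> W))"
    using homeomorphic_imp_open_map[OF homeomorphic_chart[OF assms(1)]] by (simp add: open_map_def)
  then show ?thesis using open_chart_image[OF assms(1)] openin_open_eq by blast
qed

lemma smooth_transition:
  assumes "c \<in> atlas M" "d \<in> atlas M"
  shows "Ck_on k (snd c ` (fst c \<inter> fst d)) (transition c d)"
  using manifold assms by (auto simp: smooth_manifold_def smooth_on_def)

lemma transition_has_derivative:
  assumes "c \<in> atlas M" "d \<in> atlas M" "p \<in> fst c \<inter> fst d"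
  shows "(transition c d has_derivative frechet_derivative (transition c d) (at (snd c p))) (at (snd c p))"
  using smooth_transition[OF assms(1,2), of "Suc 0"] assms(3) by (auto simp: frechet_derivative_works)

lemma transition_coord: "c \<in> atlas M \<Longrightarrow> p \<in> fst c \<Longrightarrow> transition c d (snd c p) = snd d p"
  by (simp add: transition_def coord_inv_coord)

lemma velocity_chart_change:
  assumes "c \<in> atlas M" "d \<in> atlas M" "\<gamma> t \<in> fst c \<inter> fst d"
    and v: "((snd c \<circ> \<gamma>) has_vector_derivative v) (at t)" and ev: "\<forall>\<^sub>F s in nhds t. \<gamma> s \<in> fst c"
  shows "((snd d \<circ> \<gamma>) has_vector_derivative
           frechet_derivative (transition c d) (at (snd c (\<gamma> t))) v) (at t)"
proof -
  let ?D = "frechet_derivative (transition c d) (at (snd c (\<gamma> t)))"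
  have D: "(transition c d has_derivative ?D) (at ((snd c \<circ> \<gamma>) t))"
    using transition_has_derivative[OF assms(1-3)] by simp
  have "((transition c d \<circ> (snd c \<circ> \<gamma>)) has_derivative (\<lambda>h. ?D (h *\<^sub>R v))) (at t)"
    using diff_chain_at[OF v[unfolded has_vector_derivative_def] D] by (simp add: o_def)
  moreover have "(\<lambda>h. ?D (h *\<^sub>R v)) = (\<lambda>h. h *\<^sub>R ?D v)"
    using has_derivative_linear[OF D] by (simp add: linear_scale)
  ultimately have *: "((transition c d \<circ> (snd c \<circ> \<gamma>)) has_derivative (\<lambda>h. h *\<^sub>R ?D v)) (at t)" by simp
  have "\<forall>\<^sub>F s in nhds t. (transition c d \<circ> (snd c \<circ> \<gamma>)) s = (snd d \<circ> \<gamma>) s"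
    using ev by eventually_elim (simp add: transition_coord assms(1))
  then obtain S where S: "open S" "t \<in> S" "\<And>s. s \<in> S \<Longrightarrow> (transition c d \<circ> (snd c \<circ> \<gamma>)) s = (snd d \<circ> \<gamma>) s"
    by (auto simp: eventually_nhds)
  show ?thesis
    unfolding has_vector_derivative_def by (rule has_derivative_transform_within_open[OF * S])
qed

lemma metric_lorentzian: "c \<in> atlas M \<Longrightarrow> p \<in> fst c \<Longrightarrow> lorentzian_form (metric M c p)"
  using spacetime by (simp add: spacetime_def continuous_lorentzian_metric_def)

lemma metric_bilinear: "c \<in> atlas M \<Longrightarrow> p \<in> fst c \<Longrightarrow> bilinear (metric M c p)"
  using metric_lorentzian by (simp add: lorentzian_form_def)

lemma metric_sym: "c \<in> atlas M \<Longrightarrow> p \<in> fst c \<Longrightarrow> metric M c p v w = metric M c p w v"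
  using metric_lorentzian by (simp add: lorentzian_form_def)

lemma metric_continuous:
  "c \<in> atlas M \<Longrightarrow> continuous_map (subtopology (mtop M) (fst c)) euclideanreal (\<lambda>p. metric M c p v w)"
  using spacetime by (simp add: spacetime_def continuous_lorentzian_metric_def)

lemma metric_chart_change:
  assumes "c \<in> atlas M" "d \<in> atlas M" "p \<in> fst c \<inter> fst d"
  defines "D \<equiv> frechet_derivative (transition c d) (at (snd c p))"
  shows "metric M c p v w = metric M d p (D v) (D w)"
proof -
  have "\<forall>c\<in>atlas M. \<forall>d\<in>atlas M. \<forall>p\<in>fst c \<inter> fst d.
        let D = frechet_derivative (transition c d) (at (snd c p)) in
        \<forall>v w. metric M c p v w = metric M d p (D v) (D w)"
    using spacetime by (simp add: spacetime_def continuous_lorentzian_metric_def)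
  then have "let D = D in \<forall>v w. metric M c p v w = metric M d p (D v) (D w)"
    unfolding D_def using assms(1-3) by blast
  then show ?thesis unfolding Let_def by blast
qed

lemma time_field_chart_change:
  assumes "c \<in> atlas M" "d \<in> atlas M" "p \<in> fst c \<inter> fst d"
  shows "time_field M d p = frechet_derivative (transition c d) (at (snd c p)) (time_field M c p)"
proof -
  have "time_orientation M" using spacetime by (simp add: spacetime_def)
  then show ?thesis using assms unfolding time_orientation_def by blast
qed

lemma time_field_timelike:
  "c \<in> atlas M \<Longrightarrow> p \<in> fst c \<Longrightarrow> metric M c p (time_field M c p) (time_field M c p) < 0"
  using spacetime unfolding spacetime_def time_orientation_def by blast

lemma time_field_continuous:
  "c \<in> atlas M \<Longrightarrow> continuous_map (subtopology (mtop M) (fst c)) euclidean (time_field M c)"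
  using spacetime unfolding spacetime_def time_orientation_def by blast

lemma future_causal_chart_change:
  assumes "c \<in> atlas M" "d \<in> atlas M" "p \<in> fst c \<inter> fst d" "future_causal_vector M c p v"
  shows "future_causal_vector M d p (frechet_derivative (transition c d) (at (snd c p)) v)"
proof -
  let ?D = "frechet_derivative (transition c d) (at (snd c p))"
  have "metric M d p (time_field M d p) (?D v) = metric M c p (time_field M c p) v"
    "metric M d p (?D v) (?D v) = metric M c p v v"
    unfolding time_field_chart_change[OF assms(1-3)] by (rule metric_chart_change[symmetric, OF assms(1-3)])+
  moreover have "?D v \<noteq> 0"
  proof
    assume "?D v = 0"
    then have "metric M d p (time_field M d p) (?D v) = 0"
      using metric_bilinear[of d p] assms by (simp add: bilinear_rzero)
    with calculation assms(4) show False by (simp add: future_causal_vector_def)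
  qed
  ultimately show ?thesis using assms(4) by (simp add: future_causal_vector_def)
qed

text \<open>The two pointwise conditions on a causal curve are separated since they localize differently. This one
  depends only on the curve near \<open>t\<close> and is required almost everywhere; \<open>lipschitz_at\<close> is required
  at every parameter, the end points included, and refers to the parameter interval.\<close>

definition causal_at :: "(real \<Rightarrow> 'm) \<Rightarrow> real \<Rightarrow> bool" where
  "causal_at \<gamma> t \<longleftrightarrow> (\<forall>c\<in>atlas M. \<gamma> t \<in> fst c \<longrightarrow>
     (\<exists>v. ((snd c \<circ> \<gamma>) has_vector_derivative v) (at t) \<and> future_causal_vector M c (\<gamma> t) v))"

definition lipschitz_at :: "real set \<Rightarrow> (real \<Rightarrow> 'm) \<Rightarrow> real \<Rightarrow> bool" where
  "lipschitz_at I \<gamma> t \<longleftrightarrow> (\<forall>c\<in>atlas M. \<gamma> t \<in> fst c \<longrightarrow>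
     (\<exists>\<delta>>0. \<exists>L. \<gamma> ` (I \<inter> ball t \<delta>) \<subseteq> fst c \<and> L-lipschitz_on (I \<inter> ball t \<delta>) (snd c \<circ> \<gamma>)))"

lemma causal_curve_iff: "causal_curve M a b \<gamma> \<longleftrightarrow>
     a < b \<and> continuous_map (top_of_set {a..b}) (mtop M) \<gamma> \<and>
     (\<forall>t\<in>{a..b}. lipschitz_at {a..b} \<gamma> t) \<and> (AE t in lebesgue. t \<in> {a..b} \<longrightarrow> causal_at \<gamma> t)"
  unfolding causal_curve_def lipschitz_at_def causal_at_def by (rule refl)

lemma causal_at_cong:
  assumes "\<forall>\<^sub>F s in nhds t. \<gamma> s = \<gamma>' s" "causal_at \<gamma> t" shows "causal_at \<gamma>' t"
proof -
  obtain S where S: "open S" "t \<in> S" "\<And>s. s \<in> S \<Longrightarrow> \<gamma> s = \<gamma>' s"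
    using assms(1) by (auto simp: eventually_nhds)
  have "((snd c \<circ> \<gamma>') has_vector_derivative v) (at t)" if "((snd c \<circ> \<gamma>) has_vector_derivative v) (at t)" for c v
    using has_vector_derivative_transform_within_open[OF that S(1,2)] S(3) by simp
  then show ?thesis using assms(2) S unfolding causal_at_def by metis
qed

lemma causal_speed_cong:
  assumes "\<forall>\<^sub>F s in nhds t. \<gamma> s = \<gamma>' s" shows "causal_speed M \<gamma> t = causal_speed M \<gamma>' t"
proof -
  have "vector_derivative (snd c \<circ> \<gamma>) (at t) = vector_derivative (snd c \<circ> \<gamma>') (at t)" for c :: "('m, 'e) chart"
    using assms by (intro vector_derivative_cong_eq) (auto elim: eventually_mono)
  moreover have "\<gamma> t = \<gamma>' t" using assms eventually_nhds_x_imp_x by blast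
  ultimately show ?thesis by (simp add: causal_speed_def Let_def)
qed

lemma curve_eventually_in:
  fixes \<gamma> :: "real \<Rightarrow> 'm"
  assumes "continuous_map (top_of_set {a..b}) (mtop M) \<gamma>" "a < t" "t < b" "openin (mtop M) W" "\<gamma> t \<in> W"
  shows "\<forall>\<^sub>F s in nhds t. \<gamma> s \<in> W"
proof -
  have "openin (top_of_set {a..b}) {s \<in> topspace (top_of_set {a..b}). \<gamma> s \<in> W}"
    using assms(1,4) by (rule openin_continuous_map_preimage)
  then obtain V where V: "open V" "{s \<in> {a..b}. \<gamma> s \<in> W} = {a..b} \<inter> V"
    by (auto simp: openin_open)
  have "open (V \<inter> {a<..<b})" by (intro open_Int V open_greaterThanLessThan)
  moreover have "t \<in> {s \<in> {a..b}. \<gamma> s \<in> W}" using assms(2,3,5) by simp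
  then have "t \<in> V \<inter> {a<..<b}" unfolding V(2) using assms(2,3) by simp
  moreover have "\<gamma> s \<in> W" if "s \<in> V \<inter> {a<..<b}" for s
  proof -
    have "s \<in> {a..b} \<inter> V" using that by simp
    then show ?thesis unfolding V(2)[symmetric] by simp
  qed
  ultimately show ?thesis unfolding eventually_nhds by blast
qed

text \<open>Any chart computes the speed, because the metric coefficients in two charts are related by the derivative of
  the transition map, just as the velocities are.\<close>

lemma causal_speed_chart:
  assumes \<gamma>: "continuous_map (top_of_set {a..b}) (mtop M) \<gamma>" "a < t" "t < b"
    and "c \<in> atlas M" "\<gamma> t \<in> fst c" and v: "((snd c \<circ> \<gamma>) has_vector_derivative v) (at t)"
  shows "causal_speed M \<gamma> t = sqrt (- metric M c (\<gamma> t) v v)"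
proof -
  define d where "d = (SOME d. d \<in> atlas M \<and> \<gamma> t \<in> fst d)"
  have d: "d \<in> atlas M \<and> \<gamma> t \<in> fst d" unfolding d_def by (rule someI[of _ c]) (use assms in auto)
  have ev: "\<forall>\<^sub>F s in nhds t. \<gamma> s \<in> fst c" using curve_eventually_in[OF \<gamma> openin_chart] assms by auto
  have "vector_derivative (snd d \<circ> \<gamma>) (at t) = frechet_derivative (transition c d) (at (snd c (\<gamma> t))) v"
    by (rule vector_derivative_at[OF velocity_chart_change[OF _ _ _ v ev]]) (use assms d in auto)
  moreover have "causal_speed M \<gamma> t = sqrt (- metric M d (\<gamma> t) (vector_derivative (snd d \<circ> \<gamma>) (at t)) (vector_derivative (snd d \<circ> \<gamma>) (at t)))"
    by (simp add: causal_speed_def Let_def d_def)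
  ultimately show ?thesis using metric_chart_change[of c d "\<gamma> t" v v] assms d by simp
qed

lemma AE_not_in_finite: "finite F \<Longrightarrow> AE t in lebesgue. (t::real) \<notin> F"
  using negligible_finite[of F] unfolding negligible_iff_null_sets by (rule AE_I') auto

lemma causal_curve_restrict:
  assumes "causal_curve M a b \<gamma>" "a \<le> a'" "a' < b'" "b' \<le> b"
  shows "causal_curve M a' b' \<gamma>"
  unfolding causal_curve_iff
proof (intro conjI ballI)
  have sub: "{a'..b'} \<subseteq> {a..b}" using assms(2,4) by auto
  show "continuous_map (top_of_set {a'..b'}) (mtop M) \<gamma>"
    using assms(1) continuous_map_from_subtopology_mono[OF _ sub] unfolding causal_curve_iff by blast
  show "lipschitz_at {a'..b'} \<gamma> t" if "t \<in> {a'..b'}" for t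
  proof -
    have "lipschitz_at {a..b} \<gamma> t" using assms(1) sub that unfolding causal_curve_iff by blast
    moreover have "{a'..b'} \<inter> ball t \<delta> \<subseteq> {a..b} \<inter> ball t \<delta>" for \<delta> using sub by auto
    ultimately show ?thesis unfolding lipschitz_at_def by (meson image_mono lipschitz_on_subset order_trans)
  qed
  show "AE t in lebesgue. t \<in> {a'..b'} \<longrightarrow> causal_at \<gamma> t"
    using assms(1) sub unfolding causal_curve_iff by (auto elim: eventually_mono)
qed (rule assms(3))

lemma causal_curve_shift:
  assumes "causal_curve M a b \<gamma>"
  shows "causal_curve M (a - s) (b - s) (\<lambda>t. \<gamma> (s + t))"
    and "lorentzian_length M a b \<gamma> \<le> lorentzian_length M (a - s) (b - s) (\<lambda>t. \<gamma> (s + t))"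
proof -
  have diff: "((\<lambda>t. f (s + t)) has_vector_derivative v) (at t) \<longleftrightarrow> (f has_vector_derivative v) (at (s + t))"
    for f :: "real \<Rightarrow> 'e" and v t
  proof
    have sh: "((+) s has_vector_derivative 1) (at t)" for s t :: real
      unfolding has_real_derivative_iff_has_vector_derivative[symmetric]
      using DERIV_add[OF DERIV_const DERIV_ident, of s t] by simp
    show "(f has_vector_derivative v) (at (s + t)) \<Longrightarrow> ((\<lambda>t. f (s + t)) has_vector_derivative v) (at t)"
      using vector_diff_chain_at[OF sh, of f v s t] by (simp add: o_def)
    show "(f has_vector_derivative v) (at (s + t))" if "((\<lambda>t. f (s + t)) has_vector_derivative v) (at t)"
      using vector_diff_chain_at[OF sh, of "\<lambda>t. f (s + t)" v "-s" "s + t"] that by (simp add: o_def)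
  qed
  have good: "causal_at \<gamma> (s + t) \<longleftrightarrow> causal_at (\<lambda>t. \<gamma> (s + t)) t" for t
  proof -
    have "((snd c \<circ> (\<lambda>t. \<gamma> (s + t))) has_vector_derivative v) (at t) \<longleftrightarrow>
        ((snd c \<circ> \<gamma>) has_vector_derivative v) (at (s + t))" for c :: "('m, 'e) chart" and v
      using diff[of "snd c \<circ> \<gamma>" v t] by (simp add: o_def)
    then show ?thesis by (simp only: causal_at_def)
  qed
  have "a < b" and cont: "continuous_map (top_of_set {a..b}) (mtop M) \<gamma>"
    and lip: "\<And>t. t \<in> {a..b} \<Longrightarrow> lipschitz_at {a..b} \<gamma> t"
    and ae: "AE t in lebesgue. t \<in> {a..b} \<longrightarrow> causal_at \<gamma> t"
    using assms by (auto simp: causal_curve_iff)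
  show "causal_curve M (a - s) (b - s) (\<lambda>t. \<gamma> (s + t))"
    unfolding causal_curve_iff
  proof (intro conjI ballI)
    show "a - s < b - s" using \<open>a < b\<close> by simp
    have "continuous_map (top_of_set {a - s..b - s}) (top_of_set {a..b}) ((+) s)"
      by (auto simp: continuous_map_in_subtopology intro!: continuous_intros)
    from continuous_map_compose[OF this cont]
    show "continuous_map (top_of_set {a - s..b - s}) (mtop M) (\<lambda>t. \<gamma> (s + t))" by (simp add: o_def)
    show "AE t in lebesgue. t \<in> {a - s..b - s} \<longrightarrow> causal_at (\<lambda>t. \<gamma> (s + t)) t"
      using AE_lebesgue_translation[OF ae, of s] 
      by eventually_elim (use good in \<open>auto simp: add.commute[of _ s]\<close>)
    fix t assume t: "t \<in> {a - s..b - s}"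
    then have l: "lipschitz_at {a..b} \<gamma> (s + t)" by (intro lip) auto
    show "lipschitz_at {a - s..b - s} (\<lambda>t. \<gamma> (s + t)) t"
      unfolding lipschitz_at_def
    proof (intro ballI impI)
      fix c assume "c \<in> atlas M" "\<gamma> (s + t) \<in> fst c"
      then obtain \<delta> L where \<delta>: "\<delta> > 0" "\<gamma> ` ({a..b} \<inter> ball (s + t) \<delta>) \<subseteq> fst c"
        "L-lipschitz_on ({a..b} \<inter> ball (s + t) \<delta>) (snd c \<circ> \<gamma>)"
        using l unfolding lipschitz_at_def by blast
      have mem: "s + u \<in> {a..b} \<inter> ball (s + t) \<delta>" if "u \<in> {a - s..b - s} \<inter> ball t \<delta>" for u
        using that by (auto simp: dist_real_def)
      have "L-lipschitz_on ({a - s..b - s} \<inter> ball t \<delta>) (snd c \<circ> (\<lambda>t. \<gamma> (s + t)))"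
        using lipschitz_onD[OF \<delta>(3) mem mem] lipschitz_on_nonneg[OF \<delta>(3)]
        by (intro lipschitz_onI) auto
      moreover have "(\<lambda>t. \<gamma> (s + t)) ` ({a - s..b - s} \<inter> ball t \<delta>) \<subseteq> fst c" using mem \<delta>(2) by blast
      ultimately show "\<exists>\<delta>>0. \<exists>L. (\<lambda>t. \<gamma> (s + t)) ` ({a - s..b - s} \<inter> ball t \<delta>) \<subseteq> fst c \<and>
             L-lipschitz_on ({a - s..b - s} \<inter> ball t \<delta>) (snd c \<circ> (\<lambda>t. \<gamma> (s + t)))"
        using \<delta>(1) by blast
    qed
  qed
  have "vector_derivative (snd c \<circ> (\<lambda>t. \<gamma> (s + t))) (at t) = vector_derivative (snd c \<circ> \<gamma>) (at (s + t))"
    for c :: "('m, 'e) chart" and t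
    using diff[of "snd c \<circ> \<gamma>" _ t] by (simp add: vector_derivative_def o_def)
  then have sp: "causal_speed M (\<lambda>t. \<gamma> (s + t)) t = causal_speed M \<gamma> (s + t)" for t
    by (simp add: causal_speed_def Let_def)
  have "(\<integral>\<^sup>+t\<in>{a..b}. ennreal (causal_speed M \<gamma> t) \<partial>lebesgue)
      \<le> (\<integral>\<^sup>+t. ennreal (causal_speed M \<gamma> (s + t)) * indicator {a..b} (s + t) \<partial>lebesgue)"
    by (rule nn_integral_translation_lebesgue)
  also have "\<dots> = (\<integral>\<^sup>+t\<in>{a - s..b - s}. ennreal (causal_speed M (\<lambda>t. \<gamma> (s + t)) t) \<partial>lebesgue)"
    by (intro nn_integral_cong) (auto simp: sp indicator_def)
  finally show "lorentzian_length M a b \<gamma> \<le> lorentzian_length M (a - s) (b - s) (\<lambda>t. \<gamma> (s + t))"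
    by (simp add: lorentzian_length_def less_eq_ennreal.rep_eq)
qed

text \<open>A parameter outside a closed interval has a neighbourhood disjoint from it. So for a curve composed of
  pieces only those pieces matter whose interval contains \<open>t\<close>.\<close>

lemma lipschitz_piece:
  assumes "closed I" and eq: "\<And>s. s \<in> I \<Longrightarrow> \<gamma> s = \<gamma>' s" and lip: "t \<in> I \<Longrightarrow> lipschitz_at I \<gamma>' t"
    and d: "d \<in> atlas M" "\<gamma> t \<in> fst d"
  shows "\<exists>\<delta>>0. \<exists>L. \<gamma> ` (I \<inter> ball t \<delta>) \<subseteq> fst d \<and> L-lipschitz_on (I \<inter> ball t \<delta>) (snd d \<circ> \<gamma>)"
proof (cases "t \<in> I")
  case True
  then obtain \<delta> L where \<delta>: "\<delta> > 0" "\<gamma>' ` (I \<inter> ball t \<delta>) \<subseteq> fst d" "L-lipschitz_on (I \<inter> ball t \<delta>) (snd d \<circ> \<gamma>')"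
    using lip[unfolded lipschitz_at_def] d eq[OF True] by metis
  moreover have "\<gamma> ` (I \<inter> ball t \<delta>) \<subseteq> fst d" using \<delta>(2) eq by auto
  moreover have "L-lipschitz_on (I \<inter> ball t \<delta>) (snd d \<circ> \<gamma>)"
    by (rule lipschitz_on_transform[OF \<delta>(3)]) (use eq in auto)
  ultimately show ?thesis by blast
next
  case False
  then obtain \<delta> where "\<delta> > 0" "ball t \<delta> \<subseteq> - I"
    using \<open>closed I\<close> open_contains_ball by (metis ComplI open_Compl)
  then have "I \<inter> ball t \<delta> = {}" by blast
  then show ?thesis using \<open>\<delta> > 0\<close> by (intro exI[of _ \<delta>] conjI exI[of _ 0]) auto
qed

text \<open>At the junction the Lipschitz constants of both pieces are combined. All other conditions are local and
  ignore a single parameter; the lengths add up by superadditivity of the lower integral.\<close>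

lemma causal_curve_concat:
  assumes \<gamma>1: "causal_curve M a b \<gamma>1" and \<gamma>2: "causal_curve M b c \<gamma>2" and eq: "\<gamma>1 b = \<gamma>2 b"
  defines "\<gamma> \<equiv> \<lambda>t. if t \<le> b then \<gamma>1 t else \<gamma>2 t"
  shows "causal_curve M a c \<gamma>"
    and "lorentzian_length M a b \<gamma>1 + lorentzian_length M b c \<gamma>2 \<le> lorentzian_length M a c \<gamma>"
proof -
  have "a < b" "b < c" using assms by (auto simp: causal_curve_iff)
  have near1: "\<forall>\<^sub>F s in nhds t. \<gamma>1 s = \<gamma> s" if "t < b" for t
    unfolding eventually_nhds by (intro exI[of _ "{..<b}"]) (use that in \<open>auto simp: \<gamma>_def\<close>)
  have near2: "\<forall>\<^sub>F s in nhds t. \<gamma>2 s = \<gamma> s" if "t > b" for t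
    unfolding eventually_nhds by (intro exI[of _ "{b<..}"]) (use that in \<open>auto simp: \<gamma>_def\<close>)
  have \<gamma>eq2: "\<gamma> t = \<gamma>2 t" if "t \<ge> b" for t using that eq by (cases "t = b") (auto simp: \<gamma>_def)
  have \<gamma>eq1: "\<gamma> t = \<gamma>1 t" if "t \<le> b" for t using that by (auto simp: \<gamma>_def)
  show "causal_curve M a c \<gamma>"
    unfolding causal_curve_iff
  proof (intro conjI ballI)
    show "a < c" using \<open>a < b\<close> \<open>b < c\<close> by simp
    have s1: "subtopology (top_of_set {a..c}) {x \<in> topspace (top_of_set {a..c}). x \<le> b} = top_of_set {a..b}"
      using \<open>b < c\<close> by (auto simp: subtopology_subtopology intro!: arg_cong[where f = "subtopology euclidean"])
    have s2: "subtopology (top_of_set {a..c}) {x \<in> topspace (top_of_set {a..c}). b \<le> x} = top_of_set {b..c}"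
      using \<open>a < b\<close> by (auto simp: subtopology_subtopology intro!: arg_cong[where f = "subtopology euclidean"])
    show "continuous_map (top_of_set {a..c}) (mtop M) \<gamma>"
      unfolding \<gamma>_def
      by (rule continuous_map_cases_le; (subst s1 s2)?) (use \<gamma>1 \<gamma>2 eq in \<open>auto simp: causal_curve_iff\<close>)
    have "AE t in lebesgue. t \<notin> {b}" by (rule AE_not_in_finite) simp
    moreover have "AE t in lebesgue. t \<in> {a..b} \<longrightarrow> causal_at \<gamma>1 t" "AE t in lebesgue. t \<in> {b..c} \<longrightarrow> causal_at \<gamma>2 t"
      using \<gamma>1 \<gamma>2 by (auto simp: causal_curve_iff)
    ultimately show "AE t in lebesgue. t \<in> {a..c} \<longrightarrow> causal_at \<gamma> t"
    proof eventually_elim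
      case (elim t)
      then consider "t < b" | "t > b" by fastforce
      then show ?case using elim causal_at_cong[OF near1] causal_at_cong[OF near2] by cases auto
    qed
    have e1: "\<gamma> s = \<gamma>1 s" if "s \<in> {a..b}" for s using \<gamma>eq1 that by simp
    have e2: "\<gamma> s = \<gamma>2 s" if "s \<in> {b..c}" for s using \<gamma>eq2 that by simp
    have l1: "lipschitz_at {a..b} \<gamma>1 s" if "s \<in> {a..b}" for s using \<gamma>1 that by (simp add: causal_curve_iff)
    have l2: "lipschitz_at {b..c} \<gamma>2 s" if "s \<in> {b..c}" for s using \<gamma>2 that by (simp add: causal_curve_iff)
    fix t assume t: "t \<in> {a..c}"
    show "lipschitz_at {a..c} \<gamma> t"
      unfolding lipschitz_at_def
    proof (intro ballI impI)
      fix d assume d: "d \<in> atlas M" "\<gamma> t \<in> fst d"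
      obtain \<delta> L \<delta>' L' where 1: "\<delta> > 0" "\<gamma> ` ({a..b} \<inter> ball t \<delta>) \<subseteq> fst d" "L-lipschitz_on ({a..b} \<inter> ball t \<delta>) (snd d \<circ> \<gamma>)"
        and 2: "\<delta>' > 0" "\<gamma> ` ({b..c} \<inter> ball t \<delta>') \<subseteq> fst d" "L'-lipschitz_on ({b..c} \<inter> ball t \<delta>') (snd d \<circ> \<gamma>)"
        using lipschitz_piece[OF closed_atLeastAtMost e1 l1 d] lipschitz_piece[OF closed_atLeastAtMost e2 l2 d] by blast
      define \<epsilon> where "\<epsilon> = min \<delta> \<delta>'"
      define x y where "x = max a (t - \<epsilon> / 2)" and "y = min c (t + \<epsilon> / 2)"
      have sub1: "{x..min b y} \<subseteq> {a..b} \<inter> ball t \<delta>" and sub2: "{max b x..y} \<subseteq> {b..c} \<inter> ball t \<delta>'"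
        using 1(1) 2(1) by (auto simp: x_def y_def \<epsilon>_def dist_real_def)
      have "(max L L')-lipschitz_on {x..y} (snd d \<circ> \<gamma>)"
      proof (cases "x \<le> b \<and> b \<le> y")
        case True
        then have "(max L L')-lipschitz_on {x..y} (\<lambda>s. if s \<le> b then (snd d \<circ> \<gamma>) s else (snd d \<circ> \<gamma>) s)"
          using lipschitz_on_subset[OF 1(3) sub1] lipschitz_on_subset[OF 2(3) sub2]
          by (intro lipschitz_on_concat_max) (auto simp: min_absorb1 max_absorb1)
        then show ?thesis by simp
      next
        case False
        then have "{x..y} \<subseteq> {x..min b y} \<or> {x..y} \<subseteq> {max b x..y}" by auto
        then show ?thesis
          using lipschitz_on_subset[OF 1(3) sub1] lipschitz_on_subset[OF 2(3) sub2]
          by (meson lipschitz_on_le lipschitz_on_subset max.cobounded1 max.cobounded2)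
      qed
      moreover have "{a..c} \<inter> ball t (\<epsilon> / 2) \<subseteq> {x..y}" 
      proof
        fix u assume "u \<in> {a..c} \<inter> ball t (\<epsilon> / 2)"
        then have "a \<le> u" "u \<le> c" "\<bar>t - u\<bar> < \<epsilon> / 2" by (auto simp: dist_real_def)
        moreover from this have "t - \<epsilon> / 2 \<le> u" "u \<le> t + \<epsilon> / 2" by linarith+
        ultimately show "u \<in> {x..y}" by (simp add: x_def y_def)
      qed
      moreover have "\<gamma> ` {x..y} \<subseteq> fst d"
      proof -
        have "{x..y} \<subseteq> {x..min b y} \<union> {max b x..y}" by auto
        then have "\<gamma> ` {x..y} \<subseteq> \<gamma> ` ({a..b} \<inter> ball t \<delta>) \<union> \<gamma> ` ({b..c} \<inter> ball t \<delta>')" using sub1 sub2 by blast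
        then show ?thesis using 1(2) 2(2) by blast
      qed
      ultimately show "\<exists>\<delta>>0. \<exists>L. \<gamma> ` ({a..c} \<inter> ball t \<delta>) \<subseteq> fst d \<and> L-lipschitz_on ({a..c} \<inter> ball t \<delta>) (snd d \<circ> \<gamma>)"
        using 1(1) 2(1) by (intro exI[of _ "\<epsilon> / 2"] conjI exI[of _ "max L L'"])
          (auto simp: \<epsilon>_def intro: lipschitz_on_subset)
    qed
  qed
  let ?s1 = "\<lambda>t. ennreal (causal_speed M \<gamma>1 t) * indicator {a..b} t"
  let ?s2 = "\<lambda>t. ennreal (causal_speed M \<gamma>2 t) * indicator {b..c} t"
  have "integral\<^sup>N lebesgue ?s1 + integral\<^sup>N lebesgue ?s2 \<le> (\<integral>\<^sup>+t. ?s1 t + ?s2 t \<partial>lebesgue)"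
    by (rule nn_integral_superadditive)
  also have "\<dots> \<le> (\<integral>\<^sup>+t\<in>{a..c}. ennreal (causal_speed M \<gamma> t) \<partial>lebesgue)"
  proof (rule nn_integral_mono_AE)
    have "AE t in lebesgue. t \<notin> {b}" by (rule AE_not_in_finite) simp
    then show "AE t in lebesgue. ?s1 t + ?s2 t \<le> ennreal (causal_speed M \<gamma> t) * indicator {a..c} t"
    proof eventually_elim
      case (elim t)
      then consider "t < b" | "t > b" by fastforce
      then show ?case
        using causal_speed_cong[OF near1, of t] causal_speed_cong[OF near2, of t] \<open>a < b\<close> \<open>b < c\<close>
        by cases (auto simp: indicator_def)
    qed
  qed
  finally show "lorentzian_length M a b \<gamma>1 + lorentzian_length M b c \<gamma>2 \<le> lorentzian_length M a c \<gamma>"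
    by (simp add: lorentzian_length_def less_eq_ennreal.rep_eq plus_ennreal.rep_eq)
qed

lemma length_split:
  assumes "a \<le> s" "s \<le> b"
  shows "lorentzian_length M a b \<gamma> \<le> lorentzian_length M a s \<gamma> + lorentzian_length M s b \<gamma>"
proof -
  have "(\<integral>\<^sup>+t\<in>{a..b}. ennreal (causal_speed M \<gamma> t) \<partial>lebesgue)
     \<le> (\<integral>\<^sup>+t\<in>{a..s}. ennreal (causal_speed M \<gamma> t) \<partial>lebesgue) + (\<integral>\<^sup>+t\<in>{s..b}. ennreal (causal_speed M \<gamma> t) \<partial>lebesgue)"
    by (rule nn_integral_subadditive_on_cover) (use assms in auto)
  then show ?thesis by (simp add: lorentzian_length_def less_eq_ennreal.rep_eq plus_ennreal.rep_eq)
qed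

lemma length_nonneg: "0 \<le> lorentzian_length M a b \<gamma>"
  by (simp add: lorentzian_length_def)

lemma length_degenerate: "lorentzian_length M a a \<gamma> = 0"
proof -
  have "{a..a} \<in> null_sets lebesgue" by (auto simp: negligible_iff_null_sets[symmetric])
  then have "(\<integral>\<^sup>+t\<in>{a..a}. ennreal (causal_speed M \<gamma> t) \<partial>lebesgue) = 0"
    by (rule nn_integral_null_set)
  then show ?thesis by (simp add: lorentzian_length_def zero_ennreal.rep_eq)
qed

section \<open>The time separation\<close>

abbreviation ell :: "'m \<Rightarrow> 'm \<Rightarrow> ereal" where "ell \<equiv> time_separation M"

lemma curve_in_space: "causal_curve M a b \<gamma> \<Longrightarrow> t \<in> {a..b} \<Longrightarrow> \<gamma> t \<in> topspace (mtop M)"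
  by (auto simp: causal_curve_iff continuous_map_def)

lemma time_separation_ge_length:
  assumes "causal_curve M a b \<gamma>" shows "lorentzian_length M a b \<gamma> \<le> ell (\<gamma> a) (\<gamma> b)"
  unfolding time_separation_def by (rule Sup_upper) (use assms in blast)

lemma time_separation_refl_nonneg: "0 \<le> ell p p"
  unfolding time_separation_def by (rule Sup_upper) simp

lemma time_separation_least:
  assumes "\<And>a b \<gamma>. causal_curve M a b \<gamma> \<Longrightarrow> \<gamma> a = p \<Longrightarrow> \<gamma> b = q \<Longrightarrow> lorentzian_length M a b \<gamma> \<le> B"
    and "p = q \<Longrightarrow> 0 \<le> B"
  shows "ell p q \<le> B"
  unfolding time_separation_def by (rule Sup_least) (use assms in \<open>auto split: if_splits\<close>)

lemma causal_iff: "causal ell p q \<longleftrightarrow> p = q \<or> (\<exists>a b \<gamma>. causal_curve M a b \<gamma> \<and> \<gamma> a = p \<and> \<gamma> b = q)"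
proof
  assume "causal ell p q"
  moreover have "ell p q \<le> -\<infinity>" if "\<not> (p = q \<or> (\<exists>a b \<gamma>. causal_curve M a b \<gamma> \<and> \<gamma> a = p \<and> \<gamma> b = q))"
    by (rule time_separation_least) (use that in auto)
  ultimately show "p = q \<or> (\<exists>a b \<gamma>. causal_curve M a b \<gamma> \<and> \<gamma> a = p \<and> \<gamma> b = q)"
    by (auto simp: causal_def)
next
  assume "p = q \<or> (\<exists>a b \<gamma>. causal_curve M a b \<gamma> \<and> \<gamma> a = p \<and> \<gamma> b = q)"
  then show "causal ell p q"
    using time_separation_refl_nonneg time_separation_ge_length length_nonneg
    unfolding causal_def by (metis order_trans)
qed

lemma chron_curve:
  assumes "chron ell p q"
  obtains a b \<gamma> where "causal_curve M a b \<gamma>" "\<gamma> a = p" "\<gamma> b = q" "lorentzian_length M a b \<gamma> > 0"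
proof -
  have "0 < Sup ({lorentzian_length M a b \<gamma> | a b \<gamma>. causal_curve M a b \<gamma> \<and> \<gamma> a = p \<and> \<gamma> b = q} \<union>
          (if p = q then {0} else {}))"
    using assms unfolding chron_def time_separation_def .
  then obtain u where "u \<in> {lorentzian_length M a b \<gamma> | a b \<gamma>. causal_curve M a b \<gamma> \<and> \<gamma> a = p \<and> \<gamma> b = q} \<union>
          (if p = q then {0} else {})" "0 < u"
    unfolding less_Sup_iff by blast
  then have "u \<in> {lorentzian_length M a b \<gamma> | a b \<gamma>. causal_curve M a b \<gamma> \<and> \<gamma> a = p \<and> \<gamma> b = q}"
    by (auto split: if_splits)
  then show ?thesis using that \<open>0 < u\<close> by blast
qed

lemma chronI: "causal_curve M a b \<gamma> \<Longrightarrow> lorentzian_length M a b \<gamma> > 0 \<Longrightarrow> chron ell (\<gamma> a) (\<gamma> b)"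
  using time_separation_ge_length unfolding chron_def by (meson less_le_trans)

lemma time_separation_values: "ell p q = -\<infinity> \<or> 0 \<le> ell p q"
proof (cases "causal ell p q")
  case False
  then have "\<not> (p = q \<or> (\<exists>a b \<gamma>. causal_curve M a b \<gamma> \<and> \<gamma> a = p \<and> \<gamma> b = q))" using causal_iff by blast
  then have "ell p q \<le> -\<infinity>" by (intro time_separation_least) auto
  then show ?thesis by simp
qed (simp add: causal_def)

lemma curves_join:
  assumes \<gamma>1: "causal_curve M a b \<gamma>1" and \<gamma>2: "causal_curve M c d \<gamma>2" and eq: "\<gamma>1 b = \<gamma>2 c"
  obtains e \<gamma> where "causal_curve M a e \<gamma>" "\<gamma> a = \<gamma>1 a" "\<gamma> e = \<gamma>2 d"
    "lorentzian_length M a b \<gamma>1 + lorentzian_length M c d \<gamma>2 \<le> lorentzian_length M a e \<gamma>"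
proof -
  define \<gamma>3 where "\<gamma>3 t = \<gamma>2 (c - b + t)" for t
  have 3: "causal_curve M b (d - c + b) \<gamma>3" "lorentzian_length M c d \<gamma>2 \<le> lorentzian_length M b (d - c + b) \<gamma>3"
    using causal_curve_shift[OF \<gamma>2, of "c - b"] by (simp_all add: \<gamma>3_def[abs_def] algebra_simps)
  have eq3: "\<gamma>1 b = \<gamma>3 b" by (simp add: \<gamma>3_def eq)
  have "a < b" "c < d" using \<gamma>1 \<gamma>2 by (auto simp: causal_curve_iff)
  have "lorentzian_length M a b \<gamma>1 + lorentzian_length M c d \<gamma>2
      \<le> lorentzian_length M a b \<gamma>1 + lorentzian_length M b (d - c + b) \<gamma>3"
    using 3 by (intro add_left_mono)
  also note causal_curve_concat(2)[OF \<gamma>1 3(1) eq3]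
  finally show ?thesis
    using \<open>a < b\<close> \<open>c < d\<close> by (intro that[OF causal_curve_concat(1)[OF \<gamma>1 3(1) eq3]]) (simp_all add: \<gamma>3_def)
qed

lemma causal_along_curve:
  assumes "causal_curve M a b \<gamma>" "a \<le> s" "s \<le> t" "t \<le> b" shows "causal ell (\<gamma> s) (\<gamma> t)"
proof (cases "s = t")
  case False
  then have "causal_curve M s t \<gamma>" using causal_curve_restrict[OF assms(1,2) _ assms(4)] assms(3) by simp
  then show ?thesis unfolding causal_iff by blast
qed (simp add: causal_iff)

lemma ereal_Sup_add_Sup_le:
  fixes A B :: "ereal set"
  assumes "A \<noteq> {}" "B \<noteq> {}" "\<And>u. u \<in> A \<Longrightarrow> 0 \<le> u" "\<And>v. v \<in> B \<Longrightarrow> 0 \<le> v"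
    and le: "\<And>u v. u \<in> A \<Longrightarrow> v \<in> B \<Longrightarrow> u + v \<le> C"
  shows "Sup A + Sup B \<le> C"
proof -
  have 1: "Sup A + v \<le> C" if "v \<in> B" for v
  proof -
    have "v \<noteq> -\<infinity>" using assms(4)[OF that] by auto
    then have "Sup A + v = (SUP u\<in>A. u + v)" using SUP_ereal_add_left[of A v "\<lambda>u. u"] \<open>A \<noteq> {}\<close> by simp
    then show ?thesis using le that by (simp add: SUP_least)
  qed
  obtain u where "u \<in> A" using \<open>A \<noteq> {}\<close> by blast
  then have "0 \<le> Sup A" using assms(3) by (meson Sup_upper order_trans)
  then have "Sup A \<noteq> -\<infinity>" by auto
  then have "Sup A + Sup B = (SUP v\<in>B. Sup A + v)" using SUP_ereal_add_right[of B "Sup A" "\<lambda>u. u"] \<open>B \<noteq> {}\<close> by simp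
  then show ?thesis using 1 by (simp add: SUP_least)
qed

lemma time_separation_triangle: "ell_plus (ell x y) (ell y z) \<le> ell x z"
proof (cases "causal ell x y \<and> causal ell y z")
  case False
  then have "ell x y = -\<infinity> \<or> ell y z = -\<infinity>" using time_separation_values by (auto simp: causal_def)
  then show ?thesis by (auto simp: ell_plus_def)
next
  case True
  let ?L = "\<lambda>p q. {lorentzian_length M a b \<gamma> | a b \<gamma>. causal_curve M a b \<gamma> \<and> \<gamma> a = p \<and> \<gamma> b = q} \<union>
          (if p = q then {0} else {})"
  have L: "ell p q = Sup (?L p q)" for p q by (simp add: time_separation_def)
  have ne: "?L p q \<noteq> {}" if "causal ell p q" for p q using that causal_iff[of p q] by auto
  have pos: "0 \<le> u" if "u \<in> ?L p q" for p q u using that length_nonneg by (auto split: if_splits)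
  have le: "u + v \<le> ell x z" if u: "u \<in> ?L x y" and v: "v \<in> ?L y z" for u v
  proof -
    consider "u = 0" "x = y" | "v = 0" "y = z" |
      a b \<gamma> c d \<gamma>' where "u = lorentzian_length M a b \<gamma>" "causal_curve M a b \<gamma>" "\<gamma> a = x" "\<gamma> b = y"
        "v = lorentzian_length M c d \<gamma>'" "causal_curve M c d \<gamma>'" "\<gamma>' c = y" "\<gamma>' d = z"
      using u v by (auto split: if_splits)
    then show ?thesis
    proof cases
      case 1 then show ?thesis using v by (simp add: L Sup_upper)
    next
      case 2 then show ?thesis using u by (simp add: L Sup_upper)
    next
      case 3
      then have "\<gamma> b = \<gamma>' c" by simp
      from curves_join[OF 3(2,6) this] obtain e \<gamma>'' where "causal_curve M a e \<gamma>''" "\<gamma>'' a = x" "\<gamma>'' e = z"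
        "u + v \<le> lorentzian_length M a e \<gamma>''" using 3 by metis
      then show ?thesis using time_separation_ge_length by (metis order_trans)
    qed
  qed
  have "Sup (?L x y) + Sup (?L y z) \<le> ell x z"
    by (rule ereal_Sup_add_Sup_le[OF ne[OF conjunct1[OF True]] ne[OF conjunct2[OF True]] pos pos le])
  then show ?thesis using True unfolding L[symmetric] by (auto simp: ell_plus_def causal_def)
qed

lemma causal_ell_trans:
  assumes "causal ell x y" "causal ell y z" shows "causal ell x z"
proof -
  have "0 \<le> ell x y + ell y z" "ell x y \<noteq> -\<infinity>" "ell y z \<noteq> -\<infinity>" using assms by (auto simp: causal_def)
  then show ?thesis using time_separation_triangle[of x y z] by (simp add: ell_plus_def causal_def)
qed

lemma causal_ell_antisym:
  assumes gh: "globally_hyperbolic M" and "causal ell p q" "causal ell q p"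
  shows "p = q"
proof (rule ccontr)
  assume "p \<noteq> q"
  then obtain a b \<gamma> c d \<gamma>' where
    1: "causal_curve M a b \<gamma>" "\<gamma> a = p" "\<gamma> b = q" and 2: "causal_curve M c d \<gamma>'" "\<gamma>' c = q" "\<gamma>' d = p"
    using assms causal_iff by metis
  then have "\<gamma> b = \<gamma>' c" by simp
  from curves_join[OF 1(1) 2(1) this] obtain e \<gamma>'' where "causal_curve M a e \<gamma>''" "\<gamma>'' a = p" "\<gamma>'' e = p"
    using 1 2 by metis
  then show False using gh unfolding globally_hyperbolic_def by metis
qed

lemma time_separation_diag: "globally_hyperbolic M \<Longrightarrow> ell p p = 0"
  by (intro antisym time_separation_least time_separation_refl_nonneg) (metis globally_hyperbolic_def, simp)

text \<open>The conditions on a causal curve refer to every chart, but one chart is enough: transition maps are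
  locally Lipschitz, and their derivatives respect the metric and the time orientation.\<close>

lemma chart_curveI:
  fixes x :: "real \<Rightarrow> 'e"
  assumes c: "c \<in> atlas M" and "a < b" and img: "x ` {a..b} \<subseteq> snd c ` fst c"
    and lip: "L-lipschitz_on {a..b} x"
    and der: "AE t in lebesgue. t \<in> {a..b} \<longrightarrow>
       (\<exists>v. (x has_vector_derivative v) (at t) \<and> future_causal_vector M c (coord_inv c (x t)) v)"
  shows "causal_curve M a b (coord_inv c \<circ> x)"
  unfolding causal_curve_iff
proof (intro conjI ballI)
  let ?\<gamma> = "coord_inv c \<circ> x"
  have \<gamma>c: "?\<gamma> t \<in> fst c" "snd c (?\<gamma> t) = x t" if "t \<in> {a..b}" for t
    using img that coord_inv_in[of "x t" c] coord_coord_inv[of "x t" c] by (auto simp: image_subset_iff)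
  have "continuous_map (top_of_set {a..b}) (top_of_set (snd c ` fst c)) x"
    using img lipschitz_on_continuous_on[OF lip] by (simp add: continuous_map_in_subtopology image_subset_iff_funcset)
  from continuous_map_compose[OF this continuous_coord_inv[OF c]]
  show cont: "continuous_map (top_of_set {a..b}) (mtop M) ?\<gamma>" by (simp add: continuous_map_in_subtopology)
  show "lipschitz_at {a..b} ?\<gamma> t" if t: "t \<in> {a..b}" for t
    unfolding lipschitz_at_def
  proof (intro ballI impI)
    fix d assume d: "d \<in> atlas M" "?\<gamma> t \<in> fst d"
    let ?S = "snd c ` (fst c \<inter> fst d)"
    have "x t \<in> ?S" using \<gamma>c[OF t] d by (metis IntI image_eqI)
    moreover have "open ?S" by (rule open_coord_image[OF c openin_chart[OF d(1)]])
    ultimately obtain r K where r: "r > 0" "cball (x t) r \<subseteq> ?S" "K-lipschitz_on (cball (x t) r) (transition c d)"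
      using Ck1_locally_lipschitz[OF _ _ smooth_transition[OF c d(1)]] by metis
    define \<delta> where "\<delta> = r / (L + 1)"
    have "L \<ge> 0" using lip by (rule lipschitz_on_nonneg)
    then have "\<delta> > 0" using r by (simp add: \<delta>_def)
    have near: "x s \<in> cball (x t) r" if "s \<in> {a..b} \<inter> ball t \<delta>" for s
    proof -
      have "dist (x t) (x s) \<le> L * dist t s" using lipschitz_onD[OF lip] that t by auto
      also have "\<dots> \<le> (L + 1) * \<delta>" using that \<open>L \<ge> 0\<close> by (intro mult_mono) auto
      also have "\<dots> = r" using \<open>L \<ge> 0\<close> by (simp add: \<delta>_def)
      finally show ?thesis by simp
    qed
    have sub: "x s \<in> ?S" if "s \<in> {a..b} \<inter> ball t \<delta>" for s using near[OF that] r(2) by blast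
    have "?\<gamma> s \<in> fst d" if "s \<in> {a..b} \<inter> ball t \<delta>" for s
    proof -
      have "x s \<in> ?S" by (rule sub[OF that])
      then obtain p where "p \<in> fst c \<inter> fst d" "x s = snd c p" by blast
      then show ?thesis using c by (simp add: coord_inv_coord)
    qed
    moreover have "(K * L)-lipschitz_on ({a..b} \<inter> ball t \<delta>) (snd d \<circ> ?\<gamma>)"
    proof -
      have "(K * L)-lipschitz_on ({a..b} \<inter> ball t \<delta>) (\<lambda>s. transition c d (x s))"
        by (rule lipschitz_on_compose2[OF lipschitz_on_subset[OF lip] lipschitz_on_subset[OF r(3)]]) (use near in auto)
      then show ?thesis by (simp add: transition_def o_def)
    qed
    ultimately show "\<exists>\<delta>>0. \<exists>L. ?\<gamma> ` ({a..b} \<inter> ball t \<delta>) \<subseteq> fst d \<and> L-lipschitz_on ({a..b} \<inter> ball t \<delta>) (snd d \<circ> ?\<gamma>)"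
      using \<open>\<delta> > 0\<close> by blast
  qed
  have "AE t in lebesgue. t \<notin> {a, b}" by (rule AE_not_in_finite) simp
  with der show "AE t in lebesgue. t \<in> {a..b} \<longrightarrow> causal_at ?\<gamma> t"
  proof eventually_elim
    case (elim t)
    show ?case
    proof
      assume "t \<in> {a..b}"
      then have t: "a < t" "t < b" using elim by auto
      obtain v where v: "(x has_vector_derivative v) (at t)" "future_causal_vector M c (?\<gamma> t) v"
        using elim \<open>t \<in> {a..b}\<close> by auto
      have vc: "((snd c \<circ> ?\<gamma>) has_vector_derivative v) (at t)"
        by (rule has_vector_derivative_transform_within_open[OF v(1), of "{a<..<b}"])
          (use t \<gamma>c in \<open>auto simp: image_subset_iff\<close>)
      have ev: "\<forall>\<^sub>F s in nhds t. ?\<gamma> s \<in> fst c"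
        by (rule curve_eventually_in[OF cont t openin_chart[OF c]]) (use \<gamma>c t in auto)
      show "causal_at ?\<gamma> t"
        unfolding causal_at_def
      proof (intro ballI impI)
        fix d assume d: "d \<in> atlas M" "?\<gamma> t \<in> fst d"
        have cd: "?\<gamma> t \<in> fst c \<inter> fst d" using \<gamma>c(1) t d by auto
        show "\<exists>w. ((snd d \<circ> ?\<gamma>) has_vector_derivative w) (at t) \<and> future_causal_vector M d (?\<gamma> t) w"
          using velocity_chart_change[OF c d(1) cd vc ev] future_causal_chart_change[OF c d(1) cd v(2)] by blast
      qed
    qed
  qed
qed (fact \<open>a < b\<close>)

text \<open>The segment is required to be timelike by a uniform margin \<open>\<mu>\<close>, which bounds its length from below by
  \<open>sqrt \<mu>\<close>.\<close>

lemma segment_chron: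
  fixes y z :: 'e
  assumes c: "c \<in> atlas M" and "\<mu> > 0"
    and seg: "\<And>s. s \<in> {0..1} \<Longrightarrow> y + s *\<^sub>R (z - y) \<in> snd c ` fst c"
    and tl: "\<And>s. s \<in> {0..1} \<Longrightarrow> metric M c (coord_inv c (y + s *\<^sub>R (z - y))) (z - y) (z - y) \<le> - \<mu>"
    and fut: "\<And>s. s \<in> {0..1} \<Longrightarrow> metric M c (coord_inv c (y + s *\<^sub>R (z - y)))
         (time_field M c (coord_inv c (y + s *\<^sub>R (z - y)))) (z - y) < 0"
  shows "chron ell (coord_inv c y) (coord_inv c z)"
proof -
  define x where "x s = y + s *\<^sub>R (z - y)" for s
  let ?\<gamma> = "coord_inv c \<circ> x"
  have xd: "(x has_vector_derivative (z - y)) (at s)" for s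
    unfolding x_def by (auto intro!: derivative_eq_intros)
  have nz: "z - y \<noteq> 0"
  proof
    assume "z - y = 0"
    moreover have "coord_inv c y \<in> fst c" using seg[of 0] coord_inv_in[of y c] by simp
    ultimately have "metric M c (coord_inv c y) (z - y) (z - y) = 0"
      using metric_bilinear[OF c, of "coord_inv c y"] by (simp add: bilinear_lzero)
    then show False using tl[of 0] \<open>\<mu> > 0\<close> by simp
  qed
  have fc: "future_causal_vector M c (?\<gamma> s) (z - y)" if "s \<in> {0..1}" for s
    using nz tl[OF that] fut[OF that] \<open>\<mu> > 0\<close> by (simp add: future_causal_vector_def x_def)
  have curve: "causal_curve M 0 1 ?\<gamma>"
  proof (rule chart_curveI[OF c])
    show "x ` {0..1} \<subseteq> snd c ` fst c" using seg by (auto simp: x_def)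
    show "(norm (z - y))-lipschitz_on {0..1} x"
      by (intro lipschitz_onI) (simp_all add: x_def dist_norm scaleR_diff_left[symmetric])
    show "AE s in lebesgue. s \<in> {0..1} \<longrightarrow> (\<exists>v. (x has_vector_derivative v) (at s) \<and> future_causal_vector M c (coord_inv c (x s)) v)"
      using xd fc by (intro always_eventually) auto
  qed simp
  have cont: "continuous_map (top_of_set {0..1}) (mtop M) ?\<gamma>" using curve by (simp add: causal_curve_iff)
  have speed: "sqrt \<mu> \<le> causal_speed M ?\<gamma> s" if s: "0 < s" "s < 1" for s
  proof -
    have "((snd c \<circ> ?\<gamma>) has_vector_derivative (z - y)) (at s)"
      by (rule has_vector_derivative_transform_within_open[OF xd, of "{0<..<1}"])
        (use s seg in \<open>auto simp: x_def coord_coord_inv\<close>)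
    then have "causal_speed M ?\<gamma> s = sqrt (- metric M c (?\<gamma> s) (z - y) (z - y))"
      using s seg[of s] by (intro causal_speed_chart[OF cont _ _ c]) (auto simp: x_def coord_inv_in)
    then show ?thesis using tl[of s] s by (simp add: x_def)
  qed
  have "ennreal (sqrt \<mu>) = (\<integral>\<^sup>+s\<in>{0..1::real}. ennreal (sqrt \<mu>) \<partial>lebesgue)"
    by (simp add: nn_integral_cmult_indicator)
  also have "\<dots> \<le> (\<integral>\<^sup>+s\<in>{0..1}. ennreal (causal_speed M ?\<gamma> s) \<partial>lebesgue)"
  proof (rule nn_integral_mono_AE)
    have "AE s in lebesgue. s \<notin> {0, 1 :: real}" by (rule AE_not_in_finite) simp
    then show "AE s in lebesgue. ennreal (sqrt \<mu>) * indicator {0..1} s \<le> ennreal (causal_speed M ?\<gamma> s) * indicator {0..1} s"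
      by eventually_elim (auto simp: indicator_def intro!: ennreal_leI speed)
  qed
  finally have "ennreal (sqrt \<mu>) \<le> (\<integral>\<^sup>+s\<in>{0..1}. ennreal (causal_speed M ?\<gamma> s) \<partial>lebesgue)" .
  moreover have "0 < ennreal (sqrt \<mu>)" using \<open>\<mu> > 0\<close> by simp
  ultimately have "0 < (\<integral>\<^sup>+s\<in>{0..1}. ennreal (causal_speed M ?\<gamma> s) \<partial>lebesgue)" by (rule less_le_trans[rotated])
  then have "0 < lorentzian_length M 0 1 ?\<gamma>"
    by (simp add: lorentzian_length_def less_ennreal.rep_eq[symmetric] zero_ennreal.rep_eq[symmetric] del: zero_ennreal.rep_eq)
  from chronI[OF curve this] show ?thesis by (simp add: x_def)
qed

end

section \<open>Light cones in a chart\<close>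

text \<open>The map \<open>f\<close> sends the standard basis to the orthonormal one. It is injective because pairing
  with the orthonormal vectors recovers the coordinates up to sign, and thus bijective.\<close>

lemma lorentzian_form_expansion:
  fixes B :: "'e::euclidean_space \<Rightarrow> 'e \<Rightarrow> real"
  assumes "lorentzian_form B"
  obtains f and i0 :: 'e where "linear f" "surj f" "i0 \<in> Basis"
    "\<And>a b. B (f a) (f b) = a \<bullet> b - 2 * (a \<bullet> i0) * (b \<bullet> i0)"
proof -
  have bil: "bilinear B" using assms by (simp add: lorentzian_form_def)
  have linl: "linear (\<lambda>v. B v w)" and linr: "linear (B w)" for w using bil by (auto simp: bilinear_def)
  obtain e :: "'e \<Rightarrow> 'e" and i0 :: 'e where i0: "i0 \<in> Basis"
    and e: "\<And>i j. i \<in> Basis \<Longrightarrow> j \<in> Basis \<Longrightarrow> B (e i) (e j) = (if i \<noteq> j then 0 else if i = i0 then -1 else 1)"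
    using assms unfolding lorentzian_form_def by blast
  define f where "f a = (\<Sum>i\<in>Basis. (a \<bullet> i) *\<^sub>R e i)" for a :: 'e
  have lin: "linear f" unfolding f_def
    by (intro linearI) (simp_all add: inner_add_left scaleR_left_distrib sum.distrib scaleR_sum_right)
  have fe: "B (f a) (e j) = (a \<bullet> j) * (if j = i0 then -1 else 1)" if "j \<in> Basis" for a j
  proof -
    have "B (f a) (e j) = (\<Sum>i\<in>Basis. (a \<bullet> i) * B (e i) (e j))"
      unfolding f_def by (simp add: linear_sum[OF linl] linear_scale[OF linl])
    also have "\<dots> = (\<Sum>i\<in>Basis. if i = j then (a \<bullet> j) * (if j = i0 then -1 else 1) else 0)"
      using e that by (intro sum.cong) auto
    finally show ?thesis using that by simp
  qed
  have "a = 0" if "f a = 0" for a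
  proof (rule euclidean_eqI)
    fix j :: 'e assume "j \<in> Basis"
    then have "(a \<bullet> j) * (if j = i0 then -1 else 1) = 0"
      using fe[of j a] that bil by (simp add: bilinear_lzero)
    then show "a \<bullet> j = 0 \<bullet> j" by (auto split: if_splits)
  qed
  then have "inj f" using lin by (simp add: linear_injective_0)
  with lin have "surj f" by (rule linear_injective_imp_surjective) (rule refl)
  moreover have "B (f a) (f b) = a \<bullet> b - 2 * (a \<bullet> i0) * (b \<bullet> i0)" for a b
  proof -
    have "B (f a) (f b) = (\<Sum>j\<in>Basis. (b \<bullet> j) * B (f a) (e j))"
      unfolding f_def[of b] by (simp add: linear_sum[OF linr] linear_scale[OF linr])
    also have "\<dots> = (\<Sum>j\<in>Basis. (a \<bullet> j) * (b \<bullet> j) - (if j = i0 then 2 * (a \<bullet> i0) * (b \<bullet> i0) else 0))"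
      using fe by (intro sum.cong) auto
    also have "\<dots> = a \<bullet> b - 2 * (a \<bullet> i0) * (b \<bullet> i0)"
      using i0 by (simp add: sum_subtractf euclidean_inner[of a b])
    finally show ?thesis .
  qed
  ultimately show ?thesis using that lin i0 by blast
qed

text \<open>The Cauchy-Schwarz inequality for the spatial parts \<open>t'\<close>, \<open>u'\<close>: the spatial part of \<open>T\<close> is
  shorter than its time component, so if \<open>w\<close> were not spacelike, \<open>|t' \<bullet> u'|\<close> would be too small to
  match the product of the time components.\<close>

lemma lorentzian_form_orthogonal_pos:
  fixes B :: "'e::euclidean_space \<Rightarrow> 'e \<Rightarrow> real"
  assumes B: "lorentzian_form B" and "B T T < 0" "B T w = 0" "w \<noteq> 0"
  shows "B w w > 0"
proof -
  obtain f and i0 :: 'e where f: "linear f" "surj f" "i0 \<in> Basis"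
    "\<And>a b. B (f a) (f b) = a \<bullet> b - 2 * (a \<bullet> i0) * (b \<bullet> i0)"
    by (rule lorentzian_form_expansion[OF B]) (rule that)
  obtain t u where tu: "T = f t" "w = f u" using f(2) by (metis surjD)
  define t0 u0 where "t0 = t \<bullet> i0" and "u0 = u \<bullet> i0"
  define t' u' where "t' = t - t0 *\<^sub>R i0" and "u' = u - u0 *\<^sub>R i0"
  have ii: "i0 \<bullet> i0 = 1" using f(3) by simp
  have t: "t' \<bullet> t' = t \<bullet> t - t0\<^sup>2" and u: "u' \<bullet> u' = u \<bullet> u - u0\<^sup>2" and ut: "t' \<bullet> u' = t \<bullet> u - t0 * u0"
    using ii by (simp_all add: t'_def u'_def t0_def u0_def inner_diff_left inner_diff_right power2_eq_square inner_commute)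
  have 1: "t' \<bullet> t' < t0\<^sup>2" using assms(2) f(4) t by (simp add: tu t0_def power2_eq_square)
  have 2: "t' \<bullet> u' = t0 * u0" using assms(3) f(4) ut by (simp add: tu t0_def u0_def)
  show ?thesis
  proof (rule ccontr)
    assume "\<not> ?thesis"
    then have 3: "u' \<bullet> u' \<le> u0\<^sup>2" using f(4) u by (simp add: tu u0_def power2_eq_square)
    have CS: "(t' \<bullet> u')\<^sup>2 \<le> (t' \<bullet> t') * (u' \<bullet> u')" by (rule Cauchy_Schwarz_ineq)
    show False
    proof (cases "u0 = 0")
      case True
      then have "u' = 0" using 3 inner_ge_zero[of u'] by (metis inner_eq_zero_iff order_antisym zero_power2)
      then have "u = 0" using True by (simp add: u'_def)
      then show False using tu(2) \<open>w \<noteq> 0\<close> f(1) by (simp add: linear_0)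
    next
      case False
      have "(t' \<bullet> t') * (u' \<bullet> u') \<le> (t' \<bullet> t') * u0\<^sup>2" using 3 by (intro mult_left_mono) auto
      also have "\<dots> < t0\<^sup>2 * u0\<^sup>2" using 1 False by (intro mult_strict_right_mono) auto
      finally show False using CS 2 by (simp add: power_mult_distrib)
    qed
  qed
qed

text \<open>The form becomes positive definite when a multiple of the square of \<open>B T\<close> is added: the value
  \<open>K = 2 / |B T T|\<close> reverses the sign on the line through \<open>T\<close> and changes nothing on the orthogonal
  complement. On vectors with \<open>B v v \<le> 0\<close> this says that \<open>|B T v|\<close> dominates the norm.\<close>

lemma lorentzian_form_cone:
  fixes B :: "'e::euclidean_space \<Rightarrow> 'e \<Rightarrow> real"
  assumes B: "lorentzian_form B" and T: "B T T < 0"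
  obtains k K where "k > 0" "K > 0" "\<And>v. k * (norm v)\<^sup>2 \<le> B v v + K * (B T v)\<^sup>2"
proof -
  have bil: "bilinear B" and sym: "\<And>v w. B v w = B w v" using B by (auto simp: lorentzian_form_def)
  define K where "K = 2 / (- B T T)"
  define Q where "Q v = B v v + K * (B T v)\<^sup>2" for v
  have "K > 0" using T by (simp add: K_def)
  have Qpos: "Q v > 0" if "v \<noteq> 0" for v
  proof -
    define \<alpha> where "\<alpha> = B T v / B T T"
    define w where "w = v - \<alpha> *\<^sub>R T"
    have v: "v = \<alpha> *\<^sub>R T + w" by (simp add: w_def)
    have Tw: "B T w = 0" using T bil by (simp add: w_def bilinear_rsub bilinear_rmul \<alpha>_def)
    have "B v v = \<alpha>\<^sup>2 * B T T + B w w"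
      unfolding v using bil Tw sym[of w T]
      by (simp add: bilinear_ladd bilinear_radd bilinear_lmul bilinear_rmul power2_eq_square)
    moreover have "B T v = \<alpha> * B T T" using T by (simp add: \<alpha>_def)
    ultimately have "Q v = \<alpha>\<^sup>2 * (- B T T) + B w w"
      using T by (simp add: Q_def K_def power2_eq_square field_simps)
    moreover have "B w w > 0 \<or> w = 0" using lorentzian_form_orthogonal_pos[OF B T Tw] by blast
    moreover have "\<alpha> \<noteq> 0" if "w = 0" using that v \<open>v \<noteq> 0\<close> by auto
    moreover have "B w w = 0" if "w = 0" using that bil by (simp add: bilinear_lzero)
    moreover have "\<alpha>\<^sup>2 * (- B T T) \<ge> 0" using T by (intro mult_nonneg_nonneg) auto
    moreover have "\<alpha>\<^sup>2 * (- B T T) > 0" if "\<alpha> \<noteq> 0" using T that by (intro mult_pos_pos) auto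
    ultimately show ?thesis by (cases "w = 0") linarith+
  qed
  have cont: "continuous_on (sphere 0 1) Q"
  proof -
    have "bounded_bilinear B" using bil by (simp add: bilinear_conv_bounded_bilinear)
    then show ?thesis unfolding Q_def
      by (intro continuous_intros bounded_bilinear.continuous_on[of B])
  qed
  obtain b :: 'e where "b \<in> Basis" using nonempty_Basis by blast
  then have "sphere (0::'e) 1 \<noteq> {}" by (auto intro!: exI[of _ b])
  then obtain v0 where v0: "v0 \<in> sphere 0 1" "\<And>v. v \<in> sphere 0 1 \<Longrightarrow> Q v0 \<le> Q v"
    using continuous_attains_inf[OF compact_sphere _ cont] by blast
  have "Q v0 > 0" using v0(1) by (intro Qpos) auto
  moreover have "Q v0 * (norm v)\<^sup>2 \<le> Q v" for v
  proof (cases "v = 0")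
    case True then show ?thesis using bil by (simp add: Q_def bilinear_lzero bilinear_rzero)
  next
    case False
    define u where "u = v /\<^sub>R norm v"
    define n where "n = norm v"
    have "v = n *\<^sub>R u" using False by (simp add: u_def n_def)
    then have "Q v = Q (n *\<^sub>R u)" by simp
    also have "\<dots> = n\<^sup>2 * Q u"
      unfolding Q_def by (simp add: bilinear_lmul[OF bil] bilinear_rmul[OF bil] power2_eq_square algebra_simps)
    finally have "Q v = (norm v)\<^sup>2 * Q u" by (simp add: n_def)
    moreover have "Q v0 \<le> Q u" using False by (intro v0) (simp add: u_def)
    ultimately show ?thesis by (simp add: mult.commute[of _ "Q _"] mult_right_mono)
  qed
  ultimately show ?thesis using that \<open>K > 0\<close> by (auto simp: Q_def)
qed

lemma bilinear_small:
  fixes B :: "'e::euclidean_space \<Rightarrow> 'e \<Rightarrow> real"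
  assumes "bilinear B" and "\<And>i j. i \<in> Basis \<Longrightarrow> j \<in> Basis \<Longrightarrow> \<bar>B i j\<bar> \<le> \<eta>"
  shows "\<bar>B v w\<bar> \<le> (real DIM('e))\<^sup>2 * \<eta> * norm v * norm w"
proof -
  have "B v w = B (\<Sum>i\<in>Basis. (v \<bullet> i) *\<^sub>R i) (\<Sum>j\<in>Basis. (w \<bullet> j) *\<^sub>R j)" by (simp add: euclidean_representation)
  also have "\<dots> = (\<Sum>(i, j)\<in>Basis \<times> Basis. (v \<bullet> i) * (w \<bullet> j) * B i j)"
    using assms(1) by (simp add: bilinear_sum bilinear_lmul bilinear_rmul mult_ac)
  finally have "\<bar>B v w\<bar> \<le> (\<Sum>(i, j)\<in>Basis \<times> Basis. \<bar>(v \<bullet> i) * (w \<bullet> j) * B i j\<bar>)"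
    by (simp add: case_prod_unfold sum_abs)
  also have "\<dots> \<le> (\<Sum>(i, j)\<in>(Basis :: 'e set) \<times> (Basis :: 'e set). norm v * norm w * \<eta>)"
    using assms(2) by (intro sum_mono) (auto simp: abs_mult intro!: mult_mono Basis_le_norm)
  also have "\<dots> = (real DIM('e))\<^sup>2 * \<eta> * norm v * norm w"
    by (simp add: card_cartesian_product power2_eq_square)
  finally show ?thesis .
qed

context lorentz_spacetime
begin

text \<open>The metric coefficients, the time field and the future cone as functions of the coordinates \<open>x\<close> of a
  point, so that the estimates below take place in the vector space of coordinates.\<close>

definition G :: "('m, 'e) chart \<Rightarrow> 'e \<Rightarrow> 'e \<Rightarrow> 'e \<Rightarrow> real" where
  "G c x = metric M c (coord_inv c x)"

definition TF :: "('m, 'e) chart \<Rightarrow> 'e \<Rightarrow> 'e" where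
  "TF c x = time_field M c (coord_inv c x)"

definition fcv :: "('m, 'e) chart \<Rightarrow> 'e \<Rightarrow> 'e \<Rightarrow> bool" where
  "fcv c x v \<longleftrightarrow> v \<noteq> 0 \<and> G c x v v \<le> 0 \<and> G c x (TF c x) v < 0"

lemma fcv_iff: "future_causal_vector M c (coord_inv c x) v \<longleftrightarrow> fcv c x v"
  by (simp add: future_causal_vector_def fcv_def G_def TF_def)

lemma G_props:
  assumes "c \<in> atlas M" "x \<in> snd c ` fst c"
  shows G_lorentzian: "lorentzian_form (G c x)" and G_bilinear: "bilinear (G c x)"
    and G_sym: "G c x v w = G c x w v" and G_TF: "G c x (TF c x) (TF c x) < 0"
  using assms coord_inv_in[OF assms(2)] metric_lorentzian metric_bilinear metric_sym time_field_timelike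
  by (auto simp: G_def TF_def)

lemma G_continuous:
  assumes "c \<in> atlas M" shows "continuous_on (snd c ` fst c) (\<lambda>x. G c x v w)"
  using continuous_map_compose[OF continuous_coord_inv metric_continuous, OF assms assms, of v w]
  by (simp add: G_def o_def)

lemma TF_continuous:
  assumes "c \<in> atlas M" shows "continuous_on (snd c ` fst c) (TF c)"
  using continuous_map_compose[OF continuous_coord_inv time_field_continuous, OF assms assms]
  by (simp add: TF_def[abs_def] o_def)

lemma G_expand:
  assumes "c \<in> atlas M" "x \<in> snd c ` fst c"
  shows "G c x v w = (\<Sum>i\<in>Basis. (v \<bullet> i) * G c x i w)"
proof -
  have "G c x v w = G c x (\<Sum>i\<in>Basis. (v \<bullet> i) *\<^sub>R i) w" by (simp add: euclidean_representation)
  moreover have lin: "linear (\<lambda>v. G c x v w)" using G_bilinear[OF assms] by (simp add: bilinear_def)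
  ultimately show ?thesis by (simp add: linear_sum[OF lin] linear_scale[OF lin])
qed

text \<open>Continuity of the metric is assumed separately for each pair of vectors. It is uniform on the unit ball
  since it is enough to consider the finitely many pairs of basis vectors.\<close>

lemma G_close:
  assumes c: "c \<in> atlas M" and x0: "x0 \<in> snd c ` fst c" and "\<eta> > 0"
  obtains r where "r > 0" "cball x0 r \<subseteq> snd c ` fst c"
    "\<And>x v w. x \<in> cball x0 r \<Longrightarrow> \<bar>G c x v w - G c x0 v w\<bar> \<le> \<eta> * norm v * norm w"
    "\<And>x v. x \<in> cball x0 r \<Longrightarrow> \<bar>G c x (TF c x) v - G c x0 (TF c x0) v\<bar> \<le> \<eta> * norm v"
proof -
  let ?S = "snd c ` fst c"
  have opS: "open ?S" using open_chart_image[OF c] .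
  define n where "n = real DIM('e)"
  have "n > 0" by (simp add: n_def)
  define \<eta>' where "\<eta>' = \<eta> / n\<^sup>2"
  have "\<eta>' > 0" using \<open>\<eta> > 0\<close> \<open>n > 0\<close> by (simp add: \<eta>'_def)
  have contT: "continuous_on ?S (\<lambda>x. G c x (TF c x) w)" for w
  proof -
    have "continuous_on ?S (\<lambda>x. \<Sum>i\<in>Basis. (TF c x \<bullet> i) * G c x i w)"
      by (intro continuous_intros TF_continuous G_continuous c)
    then show ?thesis using G_expand[OF c, of _ "TF c _" w] by (simp cong: continuous_on_cong)
  qed
  have ev: "\<forall>\<^sub>F x in nhds x0. \<bar>h x - h x0\<bar> < \<eta>'" if "continuous_on ?S h" for h :: "'e \<Rightarrow> real"
  proof -
    have "isCont h x0" using that opS x0 continuous_on_eq_continuous_at by blast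
    then have "(h \<longlongrightarrow> h x0) (nhds x0)" by (simp add: continuous_at tendsto_at_iff_tendsto_nhds)
    from tendstoD[OF this \<open>\<eta>' > 0\<close>] show ?thesis by (simp add: dist_real_def)
  qed
  have "\<forall>\<^sub>F x in nhds x0. \<forall>i\<in>Basis. \<forall>j\<in>Basis. \<bar>G c x i j - G c x0 i j\<bar> < \<eta>'"
    by (intro eventually_ball_finite ballI finite_Basis ev G_continuous c)
  moreover have "\<forall>\<^sub>F x in nhds x0. \<forall>j\<in>Basis. \<bar>G c x (TF c x) j - G c x0 (TF c x0) j\<bar> < \<eta>'"
    by (intro eventually_ball_finite ballI finite_Basis ev contT)
  moreover have "\<forall>\<^sub>F x in nhds x0. x \<in> ?S" using opS x0 eventually_nhds by blast
  ultimately have "\<forall>\<^sub>F x in nhds x0. x \<in> ?S \<and> (\<forall>i\<in>Basis. \<forall>j\<in>Basis. \<bar>G c x i j - G c x0 i j\<bar> < \<eta>') \<and>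
     (\<forall>j\<in>Basis. \<bar>G c x (TF c x) j - G c x0 (TF c x0) j\<bar> < \<eta>')" by eventually_elim auto
  then obtain d where d: "d > 0" "\<And>x. dist x x0 < d \<Longrightarrow> x \<in> ?S \<and> (\<forall>i\<in>Basis. \<forall>j\<in>Basis. \<bar>G c x i j - G c x0 i j\<bar> < \<eta>') \<and>
     (\<forall>j\<in>Basis. \<bar>G c x (TF c x) j - G c x0 (TF c x0) j\<bar> < \<eta>')"
    unfolding eventually_nhds_metric by blast
  have dx: "x \<in> ?S \<and> (\<forall>i\<in>Basis. \<forall>j\<in>Basis. \<bar>G c x i j - G c x0 i j\<bar> < \<eta>') \<and>
     (\<forall>j\<in>Basis. \<bar>G c x (TF c x) j - G c x0 (TF c x0) j\<bar> < \<eta>')" if "x \<in> cball x0 (d/2)" for x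
    using that d by (intro d(2)) (auto simp: dist_commute)
  show ?thesis
  proof
    show "d / 2 > 0" "cball x0 (d / 2) \<subseteq> ?S" using d dx by auto
    fix x assume x: "x \<in> cball x0 (d / 2)"
    then have xS: "x \<in> ?S" using dx by blast
    have bil: "bilinear (G c x)" "bilinear (G c x0)" using G_bilinear[OF c] xS x0 by auto
    fix v w
    have "bilinear (\<lambda>v w. G c x v w - G c x0 v w)"
      using bil unfolding bilinear_def by (auto intro: linear_compose_sub)
    then have "\<bar>G c x v w - G c x0 v w\<bar> \<le> n\<^sup>2 * \<eta>' * norm v * norm w"
      unfolding n_def by (rule bilinear_small) (use dx[OF x] in \<open>auto intro: less_imp_le\<close>)
    then show "\<bar>G c x v w - G c x0 v w\<bar> \<le> \<eta> * norm v * norm w" using \<open>n > 0\<close> by (simp add: \<eta>'_def)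
    have "G c x (TF c x) v - G c x0 (TF c x0) v = (\<Sum>j\<in>Basis. (v \<bullet> j) * (G c x (TF c x) j - G c x0 (TF c x0) j))"
      using G_expand[OF c xS, of v "TF c x"] G_expand[OF c x0, of v "TF c x0"] G_sym[OF c xS] G_sym[OF c x0]
      by (simp add: sum_subtractf right_diff_distrib)
    then have "\<bar>G c x (TF c x) v - G c x0 (TF c x0) v\<bar> \<le> (\<Sum>j\<in>Basis. \<bar>(v \<bullet> j) * (G c x (TF c x) j - G c x0 (TF c x0) j)\<bar>)"
      by simp
    also have "\<dots> \<le> (\<Sum>j\<in>(Basis :: 'e set). norm v * \<eta>')"
    proof (rule sum_mono)
      fix j :: 'e assume j: "j \<in> Basis"
      then have "\<bar>G c x (TF c x) j - G c x0 (TF c x0) j\<bar> \<le> \<eta>'" using dx[OF x] by (meson less_imp_le)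
      then show "\<bar>(v \<bullet> j) * (G c x (TF c x) j - G c x0 (TF c x0) j)\<bar> \<le> norm v * \<eta>'"
        unfolding abs_mult by (intro mult_mono Basis_le_norm j) auto
    qed
    also have "\<dots> = n * \<eta>' * norm v" by (simp add: n_def)
    also have "\<dots> \<le> n\<^sup>2 * \<eta>' * norm v"
    proof -
      have "n \<ge> 1" unfolding n_def using DIM_positive[where 'a = 'e] by linarith
      then have "n \<le> n\<^sup>2" by (simp add: power2_eq_square)
      then show ?thesis using \<open>\<eta>' > 0\<close> by (intro mult_right_mono) auto
    qed
    finally show "\<bar>G c x (TF c x) v - G c x0 (TF c x0) v\<bar> \<le> \<eta> * norm v" using \<open>n > 0\<close> by (simp add: \<eta>'_def)
  qed
qed

text \<open>A coordinate ball on which the metric varies so little that the constant vector \<open>T = TF c x0\<close> is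
  uniformly timelike and that every future causal vector \<open>v\<close> at any point \<open>x\<close> satisfies
  \<open>g(T, v) \<le> - k |v|\<close> when \<open>g\<close> is the metric at any other point \<open>y\<close>. Having \<open>x\<close> and \<open>y\<close> independent makes it
  possible to move a velocity vector to another point. One constant \<open>k\<close> serves all the bounds.\<close>

definition cone_ball :: "('m, 'e) chart \<Rightarrow> 'e \<Rightarrow> real \<Rightarrow> real \<Rightarrow> bool" where
  "cone_ball c x0 r k \<longleftrightarrow> c \<in> atlas M \<and> r > 0 \<and> k > 0 \<and> cball x0 r \<subseteq> snd c ` fst c \<and>
     (\<forall>x\<in>cball x0 r.
        (\<forall>v w. \<bar>G c x v w\<bar> \<le> norm v * norm w / k) \<and>
        G c x (TF c x0) (TF c x0) \<le> - k \<and> G c x (TF c x) (TF c x0) \<le> - k \<and>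
        (\<forall>v. fcv c x v \<longrightarrow> (\<forall>y\<in>cball x0 r.
           G c y (TF c x0) v \<le> - k * norm v \<and> G c y (TF c y) v \<le> - k * norm v)))"

lemma cone_ball_shrink:
  assumes "cone_ball c x0 r k" "0 < r'" "r' \<le> r" shows "cone_ball c x0 r' k"
proof -
  have "cball x0 r' \<subseteq> cball x0 r" using assms(3) by (rule subset_cball)
  then show ?thesis using assms(1,2) unfolding cone_ball_def by blast
qed

text \<open>For causal \<open>v\<close> at \<open>x0\<close> the number \<open>|B T v|\<close> dominates the norm of \<open>v\<close> (\<open>lorentzian_form_cone\<close>), and
  \<open>B T v\<close> is negative if \<open>v\<close> is future directed. Both facts tolerate a perturbation of the metric
  coefficients that is small compared with the margin.\<close>

lemma cone_ball_exists:
  assumes c: "c \<in> atlas M" and x0: "x0 \<in> snd c ` fst c"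
  obtains r k where "cone_ball c x0 r k"
proof -
  define T where "T = TF c x0"
  define B where "B = G c x0"
  have BTT: "B T T < 0" using G_TF[OF c x0] by (simp add: B_def T_def)
  have bil: "bilinear B" using G_bilinear[OF c x0] by (simp add: B_def)
  obtain k K where kK: "k > 0" "K > 0" "\<And>v. k * (norm v)\<^sup>2 \<le> B v v + K * (B T v)\<^sup>2"
    using lorentzian_form_cone[OF G_lorentzian[OF c x0], of T] BTT by (auto simp: B_def)
  obtain C where C: "C > 0" "\<And>v w. \<bar>B v w\<bar> \<le> C * norm v * norm w"
    using bilinear_bounded_pos[OF bil] by (auto simp: real_norm_def)
  define c1 where "c1 = sqrt (k / (2 * K))"
  have "c1 > 0" using kK by (simp add: c1_def)
  have "T \<noteq> 0" using BTT bil by (auto simp: bilinear_lzero)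
  define N where "N = 1 + norm T + (norm T)\<^sup>2"
  have N: "N > 0" "norm T \<le> N" "(norm T)\<^sup>2 \<le> N" "1 \<le> N" by (auto simp: N_def add_pos_nonneg)
  \<comment> \<open>The perturbation may use up half of each margin at \<open>x0\<close>; \<open>N\<close> absorbs the norm of \<open>T\<close>.\<close>
  define \<eta> where "\<eta> = Min {k / 2, c1 / (2 * N), - B T T / (2 * N)}"
  have \<eta>: "\<eta> > 0" "\<eta> \<le> k / 2" "\<eta> \<le> c1 / (2 * N)" "\<eta> \<le> - B T T / (2 * N)"
    using kK \<open>c1 > 0\<close> N BTT by (auto simp: \<eta>_def divide_neg_pos)
  have \<eta>N: "\<eta> * N \<le> c1 / 2" "\<eta> * N \<le> - B T T / 2"
    using \<eta>(3,4) N(1) by (simp_all add: field_simps)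
  obtain r where r: "r > 0" "cball x0 r \<subseteq> snd c ` fst c"
    "\<And>x v w. x \<in> cball x0 r \<Longrightarrow> \<bar>G c x v w - B v w\<bar> \<le> \<eta> * norm v * norm w"
    "\<And>x v. x \<in> cball x0 r \<Longrightarrow> \<bar>G c x (TF c x) v - B T v\<bar> \<le> \<eta> * norm v"
    using G_close[OF c x0 \<eta>(1)] unfolding B_def T_def by metis
  define k' where "k' = Min {c1 / 2, - B T T / 2, 1 / (C + \<eta>)}"
  have k': "k' > 0" "k' \<le> c1 / 2" "k' \<le> - B T T / 2" "k' \<le> 1 / (C + \<eta>)"
    using \<open>c1 > 0\<close> BTT C(1) \<eta>(1) by (auto simp: k'_def)
  have cone: "B T v \<le> - c1 * norm v" if x: "x \<in> cball x0 r" and v: "fcv c x v" for x v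
  proof -
    have "B v v \<le> \<eta> * (norm v)\<^sup>2"
      using r(3)[OF x, of v v] v unfolding fcv_def power2_eq_square mult.assoc by linarith
    also have "\<dots> \<le> k / 2 * (norm v)\<^sup>2" using \<eta>(2) by (intro mult_right_mono) auto
    finally have "k / 2 * (norm v)\<^sup>2 \<le> K * (B T v)\<^sup>2" using kK(3)[of v] by (simp add: field_simps)
    then have "c1\<^sup>2 * (norm v)\<^sup>2 \<le> (B T v)\<^sup>2" using kK by (simp add: c1_def field_simps)
    then have "(c1 * norm v)\<^sup>2 \<le> (B T v)\<^sup>2" by (simp add: power_mult_distrib)
    then have abs: "c1 * norm v \<le> \<bar>B T v\<bar>" using \<open>c1 > 0\<close> by (simp add: abs_le_square_iff[symmetric] abs_mult)
    have "norm v > 0" using v by (simp add: fcv_def)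
    have "\<eta> * 1 \<le> \<eta> * N" using \<eta>(1) N(4) by (intro mult_left_mono) auto
    then have "\<eta> < c1" using \<eta>N(1) \<open>c1 > 0\<close> by simp
    then have "\<eta> * norm v < c1 * norm v" using \<open>norm v > 0\<close> by simp
    then have "B T v < c1 * norm v" using r(4)[OF x, of v] v unfolding fcv_def by linarith
    then show ?thesis using abs by linarith
  qed
  have sm: "\<eta> * norm T * norm v \<le> c1 / 2 * norm v" "\<eta> * norm v \<le> c1 / 2 * norm v" for v
  proof -
    have "\<eta> * norm T \<le> \<eta> * N" "\<eta> * 1 \<le> \<eta> * N" using \<eta>(1) N by (auto intro!: mult_left_mono)
    then have "\<eta> * norm T \<le> c1 / 2" "\<eta> \<le> c1 / 2" using \<eta>N(1) by linarith+
    then show "\<eta> * norm T * norm v \<le> c1 / 2 * norm v" "\<eta> * norm v \<le> c1 / 2 * norm v"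
      by (intro mult_right_mono norm_ge_zero; simp)+
  qed
  have "cone_ball c x0 r k'"
    unfolding cone_ball_def
  proof (intro conjI ballI allI impI)
    fix x assume x: "x \<in> cball x0 r"
    fix v w
    have "\<bar>G c x v w\<bar> \<le> C * norm v * norm w + \<eta> * norm v * norm w"
      using r(3)[OF x, of v w] C(2)[of v w] by linarith
    also have "\<dots> = (C + \<eta>) * (norm v * norm w)" by (simp add: algebra_simps)
    also have "\<dots> \<le> 1 / k' * (norm v * norm w)"
    proof (rule mult_right_mono)
      show "C + \<eta> \<le> 1 / k'" using k'(1,4) C(1) \<eta>(1) by (simp add: field_simps)
    qed simp
    finally show "\<bar>G c x v w\<bar> \<le> norm v * norm w / k'" by simp
    have "\<eta> * norm T * norm T \<le> \<eta> * N"
      using \<eta>(1) N(3) by (simp add: mult.assoc power2_eq_square[symmetric])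
    then show "G c x (TF c x0) (TF c x0) \<le> - k'"
      using r(3)[OF x, of T T] \<eta>N(2) k'(3) unfolding T_def[symmetric] by linarith
    have "\<eta> * norm T \<le> \<eta> * N" using \<eta>(1) N(2) by simp
    then show "G c x (TF c x) (TF c x0) \<le> - k'"
      using r(4)[OF x, of T] \<eta>N(2) k'(3) unfolding T_def[symmetric] by linarith
  next
    fix x v y assume x: "x \<in> cball x0 r" and v: "fcv c x v" and y: "y \<in> cball x0 r"
    have kv: "k' * norm v \<le> c1 / 2 * norm v" using k'(2) by (intro mult_right_mono) auto
    show "G c y (TF c x0) v \<le> - k' * norm v"
      using cone[OF x v] r(3)[OF y, of T v] sm(1)[of v] kv unfolding T_def[symmetric] by linarith
    show "G c y (TF c y) v \<le> - k' * norm v"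
      using cone[OF x v] r(4)[OF y, of v] sm(2)[of v] kv by linarith
  qed (use c r k'(1) in auto)
  then show ?thesis by (rule that)
qed

section \<open>Lengths of curves in small sets\<close>

lemma cone_ballD:
  assumes "cone_ball c x0 r k"
  shows "c \<in> atlas M" "r > 0" "k > 0" "cball x0 r \<subseteq> snd c ` fst c"
    and "x \<in> cball x0 r \<Longrightarrow> \<bar>G c x v w\<bar> \<le> norm v * norm w / k"
    and "x \<in> cball x0 r \<Longrightarrow> G c x (TF c x0) (TF c x0) \<le> - k"
    and "x \<in> cball x0 r \<Longrightarrow> G c x (TF c x) (TF c x0) \<le> - k"
    and "x \<in> cball x0 r \<Longrightarrow> fcv c x v \<Longrightarrow> y \<in> cball x0 r \<Longrightarrow> G c y (TF c x0) v \<le> - k * norm v"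
    and "x \<in> cball x0 r \<Longrightarrow> fcv c x v \<Longrightarrow> y \<in> cball x0 r \<Longrightarrow> G c y (TF c y) v \<le> - k * norm v"
  using assms unfolding cone_ball_def by blast+

lemma chord_chron:
  assumes c: "c \<in> atlas M" and S: "cball x0 r \<subseteq> snd c ` fst c" and y: "y \<in> cball x0 r" and z: "z \<in> cball x0 r" and "\<mu> > 0"
    and tl: "\<And>x. x \<in> cball x0 r \<Longrightarrow> G c x (z - y) (z - y) \<le> - \<mu>"
    and fut: "\<And>x. x \<in> cball x0 r \<Longrightarrow> G c x (TF c x) (z - y) < 0"
  shows "chron ell (coord_inv c y) (coord_inv c z)"
proof -
  have seg: "y + s *\<^sub>R (z - y) \<in> cball x0 r" if "s \<in> {0..1}" for s
  proof -
    have "(1 - s) *\<^sub>R y + s *\<^sub>R z \<in> cball x0 r"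
      using that by (intro convexD[OF convex_cball y z]) auto
    moreover have "(1 - s) *\<^sub>R y + s *\<^sub>R z = y + s *\<^sub>R (z - y)" by (simp add: algebra_simps)
    ultimately show ?thesis by simp
  qed
  show ?thesis
  proof (rule segment_chron[OF c \<open>\<mu> > 0\<close>])
    fix s :: real assume "s \<in> {0..1}"
    note s = seg[OF this]
    show "y + s *\<^sub>R (z - y) \<in> snd c ` fst c" using s S by blast
    show "metric M c (coord_inv c (y + s *\<^sub>R (z - y))) (z - y) (z - y) \<le> - \<mu>"
      using tl[OF s] by (simp add: G_def)
    show "metric M c (coord_inv c (y + s *\<^sub>R (z - y))) (time_field M c (coord_inv c (y + s *\<^sub>R (z - y)))) (z - y) < 0"
      using fut[OF s] by (simp add: G_def TF_def)
  qed
qed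

lemma chron_along_time_field:
  assumes cb: "cone_ball c x0 r k" and "s > 0"
    and y: "y \<in> cball x0 r" and z: "y + s *\<^sub>R TF c x0 \<in> cball x0 r"
  shows "chron ell (coord_inv c y) (coord_inv c (y + s *\<^sub>R TF c x0))"
proof (rule chord_chron[OF cone_ballD(1,4)[OF cb] y z, of "s\<^sup>2 * k"])
  show "s\<^sup>2 * k > 0" using cone_ballD(3)[OF cb] \<open>s > 0\<close> by simp
  fix x assume x: "x \<in> cball x0 r"
  then have bil: "bilinear (G c x)" using G_bilinear cone_ballD(1,4)[OF cb] by blast
  have "s\<^sup>2 * G c x (TF c x0) (TF c x0) \<le> s\<^sup>2 * (- k)"
    using cone_ballD(6)[OF cb x] by (intro mult_left_mono) auto
  then show "G c x (y + s *\<^sub>R TF c x0 - y) (y + s *\<^sub>R TF c x0 - y) \<le> - (s\<^sup>2 * k)"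
    using bil by (simp add: bilinear_lmul bilinear_rmul power2_eq_square mult.assoc)
  have "s * G c x (TF c x) (TF c x0) < 0"
    using cone_ballD(7)[OF cb x] cone_ballD(3)[OF cb] \<open>s > 0\<close> by (intro mult_pos_neg) auto
  then show "G c x (TF c x) (y + s *\<^sub>R TF c x0 - y) < 0" using bil by (simp add: bilinear_rmul)
qed

lemma cone_ball_at:
  assumes "p \<in> topspace (mtop M)"
  obtains c r k where "cone_ball c (snd c p) r k" "p \<in> fst c"
proof -
  obtain c where c: "c \<in> atlas M" "p \<in> fst c" using chart_at[OF assms] by blast
  then have "snd c p \<in> snd c ` fst c" by blast
  from cone_ball_exists[OF c(1) this] obtain r k where "cone_ball c (snd c p) r k" .
  then show ?thesis using that c by blast
qed

text \<open>The straight lines in direction of the time field are timelike near \<open>p\<close>.\<close>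

lemma chron_accumulates:
  assumes W: "openin (mtop M) W" and p: "p \<in> W"
  shows "\<exists>q\<in>W. chron ell q p" and "\<exists>q\<in>W. chron ell p q"
proof -
  have pX: "p \<in> topspace (mtop M)" using assms openin_subset by blast
  obtain c r k where cb: "cone_ball c (snd c p) r k" and pc: "p \<in> fst c"
    by (rule cone_ball_at[OF pX]) (rule that)
  define x0 where "x0 = snd c p"
  note cb = cb[folded x0_def] and c = cone_ballD(1)[OF cb]
  have x0p: "coord_inv c x0 = p" using c pc by (simp add: x0_def coord_inv_coord)
  have "x0 \<in> snd c ` (fst c \<inter> W)" using pc p by (auto simp: x0_def)
  then obtain d where d: "d > 0" "ball x0 d \<subseteq> snd c ` (fst c \<inter> W)"
    using open_coord_image[OF c W] open_contains_ball by blast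
  define s where "s = min d r / (2 * (norm (TF c x0) + 1))"
  have n: "norm (TF c x0) + 1 > 0" by (simp add: add_nonneg_pos)
  have "s > 0" using d cone_ballD(2)[OF cb] n by (simp add: s_def)
  have "s * norm (TF c x0) \<le> s * (norm (TF c x0) + 1)" using \<open>s > 0\<close> by simp
  also have "\<dots> = min d r / 2" using n by (simp add: s_def field_simps)
  also have "\<dots> < min d r" using d(1) cone_ballD(2)[OF cb] by (auto simp: min_def)
  finally have small: "s * norm (TF c x0) < min d r" .
  have mem: "y \<in> cball x0 r" "coord_inv c y \<in> W" if "dist x0 y = s * norm (TF c x0)" for y
  proof -
    show "y \<in> cball x0 r" using that small by simp
    have "y \<in> ball x0 d" using that small by simp
    then obtain q where "q \<in> fst c \<inter> W" "y = snd c q" using d(2) by blast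
    then show "coord_inv c y \<in> W" using c by (simp add: coord_inv_coord)
  qed
  have x0: "x0 \<in> cball x0 r" using cone_ballD(2)[OF cb] by simp
  let ?y = "x0 - s *\<^sub>R TF c x0" and ?z = "x0 + s *\<^sub>R TF c x0"
  have dy: "dist x0 ?y = s * norm (TF c x0)" and dz: "dist x0 ?z = s * norm (TF c x0)"
    using \<open>s > 0\<close> by (simp_all add: dist_norm)
  have "chron ell (coord_inv c ?y) (coord_inv c (?y + s *\<^sub>R TF c x0))"
    by (rule chron_along_time_field[OF cb \<open>s > 0\<close>]) (use mem[OF dy] x0 in auto)
  then show "\<exists>q\<in>W. chron ell q p" using mem(2)[OF dy] x0p by (intro bexI[of _ "coord_inv c ?y"]) simp_all
  have "chron ell (coord_inv c x0) (coord_inv c ?z)"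
    by (rule chron_along_time_field[OF cb \<open>s > 0\<close>]) (use mem[OF dz] x0 in auto)
  then show "\<exists>q\<in>W. chron ell p q" using mem(2)[OF dz] x0p by (intro bexI[of _ "coord_inv c ?z"]) simp_all
qed

lemma curve_lipschitz_in_chart:
  assumes \<gamma>: "causal_curve M a b \<gamma>" and c: "c \<in> atlas M" and img: "\<gamma> ` {a..b} \<subseteq> fst c"
  obtains L where "L-lipschitz_on {a..b} (snd c \<circ> \<gamma>)"
proof -
  have "a \<le> b" using \<gamma> by (simp add: causal_curve_iff)
  moreover have "\<exists>\<delta>>0. \<exists>L. L-lipschitz_on ({a..b} \<inter> ball t \<delta>) (snd c \<circ> \<gamma>)" if "t \<in> {a..b}" for t
  proof -
    have "lipschitz_at {a..b} \<gamma> t" using \<gamma> that by (simp add: causal_curve_iff)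
    moreover have "\<gamma> t \<in> fst c" using img that by blast
    ultimately show ?thesis using c unfolding lipschitz_at_def by blast
  qed
  ultimately show ?thesis using locally_lipschitz_imp_lipschitz that by blast
qed

text \<open>Along a future causal curve the linear function \<open>- g(T, \<cdot>)\<close>, with \<open>g\<close> the metric at \<open>x0\<close>, grows at
  least at rate \<open>k |v|\<close>, while the speed is at most \<open>|v| / sqrt k\<close>. So the length is bounded by a multiple
  of the total growth of a linear function on a ball of radius \<open>r'\<close>.\<close>

lemma cone_ball_length:
  assumes cb: "cone_ball c x0 r k" and "r' \<le> r" and \<gamma>: "causal_curve M a b \<gamma>"
    and img: "\<And>t. t \<in> {a..b} \<Longrightarrow> \<gamma> t \<in> fst c \<and> snd c (\<gamma> t) \<in> cball x0 r'"
  shows "lorentzian_length M a b \<gamma> \<le> ereal (2 * norm (TF c x0) / (k\<^sup>2 * sqrt k) * r')"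
proof -
  note c = cone_ballD(1)[OF cb] and k = cone_ballD(3)[OF cb]
  define T where "T = TF c x0"
  define x where "x = snd c \<circ> \<gamma>"
  have x0: "x0 \<in> cball x0 r" using cone_ballD(2)[OF cb] by simp
  then have x0S: "x0 \<in> snd c ` fst c" using cone_ballD(4)[OF cb] by blast
  \<comment> \<open>Normalised such that the derivative of \<open>lam\<close> along the curve bounds the speed.\<close>
  define lam where "lam v = - G c x0 T v / (k * sqrt k)" for v
  have "linear (G c x0 T)" using G_bilinear[OF c x0S] by (simp add: bilinear_def)
  then have lin: "linear lam" unfolding lam_def
    by (intro linearI) (simp_all add: linear_add linear_scale diff_divide_distrib)
  then have bl: "bounded_linear lam" by (simp add: linear_conv_bounded_linear)
  have lam_bound: "\<bar>lam v\<bar> \<le> norm T / (k\<^sup>2 * sqrt k) * norm v" for v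
  proof -
    have "\<bar>lam v\<bar> = \<bar>G c x0 T v\<bar> / (k * sqrt k)" using k by (simp add: lam_def abs_mult)
    also have "\<dots> \<le> (norm T * norm v / k) / (k * sqrt k)"
      using cone_ballD(5)[OF cb x0, of T v] k by (intro divide_right_mono) auto
    finally show ?thesis by (simp add: power2_eq_square mult_ac)
  qed
  have ab: "a < b" and cont: "continuous_map (top_of_set {a..b}) (mtop M) \<gamma>"
    and ae: "AE t in lebesgue. t \<in> {a..b} \<longrightarrow> causal_at \<gamma> t" using \<gamma> by (auto simp: causal_curve_iff)
  obtain L where L: "L-lipschitz_on {a..b} x"
    using curve_lipschitz_in_chart[OF \<gamma> c] img unfolding x_def by blast
  define f where "f t = lam (x t)" for t
  define g where "g t = lam (vector_derivative x (at t))" for t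
  have flip: "(norm T / (k\<^sup>2 * sqrt k) * L)-lipschitz_on {a..b} f"
  proof (rule lipschitz_onI)
    have n: "norm T / (k\<^sup>2 * sqrt k) \<ge> 0" using k by simp
    then show "0 \<le> norm T / (k\<^sup>2 * sqrt k) * L" using lipschitz_on_nonneg[OF L] by (rule mult_nonneg_nonneg)
    fix s t assume st: "s \<in> {a..b}" "t \<in> {a..b}"
    have "dist (f s) (f t) = \<bar>lam (x s - x t)\<bar>" using lin by (simp add: f_def dist_real_def linear_diff)
    also have "\<dots> \<le> norm T / (k\<^sup>2 * sqrt k) * norm (x s - x t)" by (rule lam_bound)
    also have "\<dots> \<le> norm T / (k\<^sup>2 * sqrt k) * (L * dist s t)"
      using lipschitz_onD[OF L st] n by (intro mult_left_mono) (auto simp: dist_norm)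
    finally show "dist (f s) (f t) \<le> norm T / (k\<^sup>2 * sqrt k) * L * dist s t" by (simp add: mult.assoc)
  qed
  have sub: "cball x0 r' \<subseteq> cball x0 r" using \<open>r' \<le> r\<close> by (rule subset_cball)
  have "AE t in lebesgue. t \<notin> {a, b}" by (rule AE_not_in_finite) simp
  with ae have key: "AE t in lebesgue. t \<in> {a..b} \<longrightarrow> (f has_real_derivative g t) (at t) \<and> 0 \<le> g t \<and> causal_speed M \<gamma> t \<le> g t"
  proof eventually_elim
    case (elim t)
    show ?case
    proof
      assume t: "t \<in> {a..b}"
      then have "a < t" "t < b" using elim by auto
      have \<gamma>c: "\<gamma> t \<in> fst c" and xt: "x t \<in> cball x0 r" using img[OF t] sub by (auto simp: x_def)
      obtain v where v: "(x has_vector_derivative v) (at t)" "future_causal_vector M c (\<gamma> t) v"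
        using elim t c \<gamma>c unfolding causal_at_def x_def by blast
      have "coord_inv c (x t) = \<gamma> t" using c \<gamma>c by (simp add: x_def coord_inv_coord)
      then have fv: "fcv c (x t) v" using v(2) fcv_iff[of c "x t" v] by simp
      have vd: "vector_derivative x (at t) = v" using v(1) by (rule vector_derivative_at)
      have "((\<lambda>t. lam (x t)) has_vector_derivative lam v) (at t)"
        by (rule bounded_linear.has_vector_derivative[OF bl v(1)])
      then have 1: "(f has_real_derivative g t) (at t)"
        by (simp add: f_def[abs_def] g_def vd has_real_derivative_iff_has_vector_derivative)
      have cone: "k * norm v \<le> - G c x0 T v" using cone_ballD(8)[OF cb xt fv x0] by (simp add: T_def)
      have speed: "causal_speed M \<gamma> t = sqrt (- G c (x t) v v)"
        using causal_speed_chart[OF cont \<open>a < t\<close> \<open>t < b\<close> c \<gamma>c v(1)[unfolded x_def]]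
        by (simp add: G_def x_def coord_inv_coord c \<gamma>c)
      also have "\<dots> \<le> sqrt ((norm v)\<^sup>2 / k)"
        using cone_ballD(5)[OF cb xt, of v v] by (intro real_sqrt_le_mono) (simp add: power2_eq_square)
      also have "\<dots> = norm v / sqrt k" by (simp add: real_sqrt_divide)
      also have "\<dots> \<le> g t"
      proof -
        have "norm v / sqrt k = (k * norm v) / (k * sqrt k)" using k by simp
        also have "\<dots> \<le> - G c x0 T v / (k * sqrt k)" using cone k by (intro divide_right_mono) auto
        finally show ?thesis by (simp add: g_def vd lam_def)
      qed
      finally have 2: "causal_speed M \<gamma> t \<le> g t" .
      moreover have "0 \<le> causal_speed M \<gamma> t" using fv by (simp add: speed fcv_def)
      ultimately show "(f has_real_derivative g t) (at t) \<and> 0 \<le> g t \<and> causal_speed M \<gamma> t \<le> g t"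
        using 1 by simp
    qed
  qed
  have "(\<integral>\<^sup>+t\<in>{a..b}. ennreal (causal_speed M \<gamma> t) \<partial>lebesgue) \<le> (\<integral>\<^sup>+t\<in>{a..b}. ennreal (g t) \<partial>lebesgue)"
    using key by (intro nn_integral_mono_AE, eventually_elim) (auto simp: indicator_def intro: ennreal_leI)
  also have "\<dots> = ennreal (f b - f a)"
    by (rule lipschitz_fundamental_theorem[OF ab flip]) (use key in \<open>auto elim: eventually_mono\<close>)
  also have "f b - f a = lam (x b - x a)" using lin by (simp add: f_def linear_diff)
  also have "ennreal (lam (x b - x a)) \<le> ennreal (2 * norm T / (k\<^sup>2 * sqrt k) * r')"
  proof (rule ennreal_leI)
    have "norm (x b - x a) \<le> norm (x b - x0) + norm (x0 - x a)" using norm_triangle_ineq[of "x b - x0" "x0 - x a"] by simp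
    also have "\<dots> \<le> 2 * r'" using img[of a] img[of b] ab by (simp add: x_def dist_norm norm_minus_commute)
    finally have "norm T / (k\<^sup>2 * sqrt k) * norm (x b - x a) \<le> norm T / (k\<^sup>2 * sqrt k) * (2 * r')"
      using k by (intro mult_left_mono) auto
    also have "\<dots> = 2 * norm T / (k\<^sup>2 * sqrt k) * r'" by simp
    finally show "lam (x b - x a) \<le> 2 * norm T / (k\<^sup>2 * sqrt k) * r'" using lam_bound[of "x b - x a"] by linarith
  qed
  finally have *: "(\<integral>\<^sup>+t\<in>{a..b}. ennreal (causal_speed M \<gamma> t) \<partial>lebesgue) \<le> ennreal (2 * norm T / (k\<^sup>2 * sqrt k) * r')" .
  have "dist x0 (snd c (\<gamma> a)) \<le> r'" using img[of a] ab unfolding mem_cball by simp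
  then have "0 \<le> r'" using zero_le_dist order_trans by blast
  then have "0 \<le> 2 * norm T / (k\<^sup>2 * sqrt k) * r'" using k by simp
  then show ?thesis
    using * by (simp add: lorentzian_length_def less_eq_ennreal.rep_eq enn2ereal_ennreal T_def)
qed

lemma curve_near:
  fixes \<gamma> :: "real \<Rightarrow> 'm"
  assumes "continuous_map (top_of_set {a..b}) (mtop M) \<gamma>" "t \<in> {a..b}" "openin (mtop M) W" "\<gamma> t \<in> W"
  obtains \<delta> where "\<delta> > 0" "\<And>s. s \<in> {a..b} \<Longrightarrow> \<bar>s - t\<bar> < \<delta> \<Longrightarrow> \<gamma> s \<in> W"
proof -
  have "openin (top_of_set {a..b}) {s \<in> topspace (top_of_set {a..b}). \<gamma> s \<in> W}"
    using assms(1,3) by (rule openin_continuous_map_preimage)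
  then obtain V where V: "open V" "{s \<in> {a..b}. \<gamma> s \<in> W} = {a..b} \<inter> V"
    by (auto simp: openin_open)
  have "t \<in> {s \<in> {a..b}. \<gamma> s \<in> W}" using assms by simp
  then have "t \<in> V" unfolding V(2) by simp
  then obtain \<delta> where \<delta>: "\<delta> > 0" "ball t \<delta> \<subseteq> V" using V(1) open_contains_ball by blast
  have "\<gamma> s \<in> W" if "s \<in> {a..b}" "\<bar>s - t\<bar> < \<delta>" for s
  proof -
    have "s \<in> {a..b} \<inter> V" using that \<delta>(2) by (auto simp: dist_real_def abs_minus_commute)
    then show ?thesis unfolding V(2)[symmetric] by simp
  qed
  with \<delta>(1) that show ?thesis by blast
qed

text \<open>Let \<open>V\<close> contain the initial point and let \<open>t1\<close> be the supremum of the parameters at which the curve is in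
  \<open>V\<close>. Let \<open>V'\<close> contain \<open>\<gamma> t1\<close>, and choose \<open>s \<le> t1\<close> with \<open>\<gamma> s\<close> in \<open>V\<close> and \<open>V'\<close>. The length up to \<open>s\<close> is at
  most 1 because both end points are in \<open>V\<close>, and so is the length from \<open>s\<close> to \<open>t1\<close> because of \<open>V'\<close>. From \<open>t1\<close>
  on the curve avoids \<open>V\<close>, and the remaining sets of the cover suffice.\<close>

lemma finite_cover_length:
  assumes "finite F" and "\<And>V. V \<in> F \<Longrightarrow> openin (mtop M) V \<and> (\<forall>p\<in>V. \<forall>q\<in>V. ell p q \<le> 1)"
    and "causal_curve M a b \<gamma>" and "\<gamma> ` {a..b} \<subseteq> \<Union>F"
  shows "lorentzian_length M a b \<gamma> \<le> ereal (2 * real (card F))"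
  using assms
proof (induction "card F" arbitrary: F a rule: less_induct)
  case less
  have ab: "a < b" and cont: "continuous_map (top_of_set {a..b}) (mtop M) \<gamma>"
    using less.prems(3) by (auto simp: causal_curve_iff)
  have short: "lorentzian_length M s t \<gamma> \<le> 1" if "a \<le> s" "s \<le> t" "t \<le> b" "V \<in> F" "\<gamma> s \<in> V" "\<gamma> t \<in> V" for s t V
  proof (cases "s = t")
    case False
    then have "causal_curve M s t \<gamma>" using causal_curve_restrict[OF less.prems(3)] that by simp
    then have "lorentzian_length M s t \<gamma> \<le> ell (\<gamma> s) (\<gamma> t)" by (rule time_separation_ge_length)
    also have "\<dots> \<le> 1" using less.prems(2)[OF that(4)] that by blast
    finally show ?thesis .
  qed (simp add: length_degenerate)
  obtain V where V: "V \<in> F" "\<gamma> a \<in> V" using less.prems(4) ab by force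
  have card: "card (F - {V}) < card F" "card F = Suc (card (F - {V}))"
    using card.remove[OF less.prems(1) V(1)] by simp_all
  show ?case
  proof (cases "\<gamma> b \<in> V")
    case True
    have "lorentzian_length M a b \<gamma> \<le> 1" using short[of a b V] ab V True by simp
    also have "\<dots> \<le> ereal (2 * real (card F))" using card by (simp add: one_ereal_def)
    finally show ?thesis .
  next
    case False
    define S where "S = {t \<in> {a..b}. \<gamma> t \<in> V}"
    define t1 where "t1 = Sup S"
    have aS: "a \<in> S" and SV: "S \<subseteq> {a..b}" using V ab by (auto simp: S_def)
    have bdd: "bdd_above S" using SV by (meson bdd_above_Icc bdd_above_mono)
    have t1: "a \<le> t1" "t1 \<le> b" unfolding t1_def
    proof -
      show "a \<le> Sup S" by (rule cSup_upper[OF aS bdd])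
      show "Sup S \<le> b" by (rule cSup_least) (use aS SV in auto)
    qed
    have after: "t \<notin> S" if "t > t1" for t using that cSup_upper[OF _ bdd, of t] by (auto simp: t1_def)
    have V_open: "openin (mtop M) V" using less.prems(2)[OF V(1)] by blast
    have t1V: "\<gamma> t1 \<notin> V"
    proof
      assume "\<gamma> t1 \<in> V"
      then have "t1 < b" using False t1 by (cases "t1 = b") auto
      have "t1 \<in> {a..b}" using t1 by simp
      obtain \<delta> where \<delta>: "\<delta> > 0" "\<And>s. s \<in> {a..b} \<Longrightarrow> \<bar>s - t1\<bar> < \<delta> \<Longrightarrow> \<gamma> s \<in> V"
        using curve_near[OF cont \<open>t1 \<in> {a..b}\<close> V_open \<open>\<gamma> t1 \<in> V\<close>] by blast
      define s where "s = min b (t1 + \<delta> / 2)"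
      have "s \<in> {a..b}" "\<bar>s - t1\<bar> < \<delta>" "s > t1" using \<delta>(1) \<open>t1 < b\<close> t1 by (auto simp: s_def min_def)
      then show False using \<delta>(2)[of s] after[of s] by (auto simp: S_def)
    qed
    then have "a < t1" using V(2) t1 by (cases "a = t1") auto
    obtain V' where V': "V' \<in> F" "\<gamma> t1 \<in> V'" using less.prems(4) t1 by force
    have "t1 \<in> {a..b}" using t1 by simp
    obtain \<delta> where \<delta>: "\<delta> > 0" "\<And>s. s \<in> {a..b} \<Longrightarrow> \<bar>s - t1\<bar> < \<delta> \<Longrightarrow> \<gamma> s \<in> V'"
      using curve_near[OF cont \<open>t1 \<in> {a..b}\<close> _ V'(2)] less.prems(2)[OF V'(1)] by blast
    have "t1 - \<delta> < Sup S" using \<delta>(1) by (simp add: t1_def)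
    then obtain s where s: "s \<in> S" "t1 - \<delta> < s" using less_cSup_iff[of S "t1 - \<delta>"] aS bdd by blast
    have "s \<le> t1" using cSup_upper[OF s(1) bdd] by (simp add: t1_def)
    have sV: "\<gamma> s \<in> V" "a \<le> s" using s(1) by (auto simp: S_def)
    have sV': "\<gamma> s \<in> V'" using \<delta>(2)[of s] s \<open>s \<le> t1\<close> SV by auto
    have "lorentzian_length M a t1 \<gamma> \<le> lorentzian_length M a s \<gamma> + lorentzian_length M s t1 \<gamma>"
      by (rule length_split[OF sV(2) \<open>s \<le> t1\<close>])
    also have "\<dots> \<le> 1 + 1"
      using short[of a s V] short[of s t1 V'] V V' sV sV' t1 \<open>s \<le> t1\<close> by (intro add_mono) auto
    finally have first: "lorentzian_length M a t1 \<gamma> \<le> ereal 2" by (simp add: one_ereal_def)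
    have rest: "lorentzian_length M t1 b \<gamma> \<le> ereal (2 * real (card (F - {V})))"
    proof (cases "t1 = b")
      case True then show ?thesis by (simp add: length_degenerate)
    next
      case neq: False
      show ?thesis
      proof (rule less.hyps[OF card(1)])
        show "causal_curve M t1 b \<gamma>" using causal_curve_restrict[OF less.prems(3)] neq t1 by simp
        show "\<gamma> ` {t1..b} \<subseteq> \<Union> (F - {V})"
        proof
          fix p assume "p \<in> \<gamma> ` {t1..b}"
          then obtain t where t: "p = \<gamma> t" "t1 \<le> t" "t \<le> b" by auto
          then have nV: "p \<notin> V" using t1V after[of t] t1 by (cases "t = t1") (auto simp: S_def)
          have "t \<in> {a..b}" using t t1 by simp
          then have "p \<in> \<Union>F" using less.prems(4) t(1) by blast
          then show "p \<in> \<Union> (F - {V})" using nV by blast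
        qed
      qed (use less.prems in auto)
    qed
    have "lorentzian_length M a b \<gamma> \<le> lorentzian_length M a t1 \<gamma> + lorentzian_length M t1 b \<gamma>"
      by (rule length_split[OF t1])
    also have "\<dots> \<le> ereal 2 + ereal (2 * real (card (F - {V})))" by (intro add_mono first rest)
    also have "\<dots> = ereal (2 * real (card F))" by (simp add: card(2))
    finally show ?thesis .
  qed
qed

end

locale chron_open_spacetime = lorentz_spacetime +
  assumes gh: "globally_hyperbolic M"
    and chron_open: "openin (prod_topology (mtop M) (mtop M)) (chronological_relation M)"
begin

sublocale compact_diamond_space "mtop M" ell
proof
  show "Hausdorff_space (mtop M)" "second_countable (mtop M)"
    using manifold by (auto simp: smooth_manifold_def)
  show "topspace (mtop M) \<noteq> {}" using spacetime by (simp add: spacetime_def)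
  show "openin (prod_topology (mtop M) (mtop M))
      {(p, q) \<in> topspace (mtop M) \<times> topspace (mtop M). chron ell p q}"
    using chron_open by (simp add: chronological_relation_def)
  show "compactin (mtop M) (diamond (topspace (mtop M)) ell p q)"
    if "p \<in> topspace (mtop M)" "q \<in> topspace (mtop M)" for p q
    using gh that unfolding globally_hyperbolic_def by blast
qed (use time_separation_values in \<open>auto intro: time_separation_triangle time_separation_diag[OF gh]
      causal_ell_antisym[OF gh] chron_accumulates\<close>)

text \<open>A causal curve between two points near \<open>p\<close> cannot meet a given coordinate sphere around \<open>p\<close>
  (\<open>locally_avoids_compact\<close>), so it stays inside the sphere, where its length is at most a multiple of
  the radius.\<close>

lemma locally_small_separation:
  assumes p: "p \<in> topspace (mtop M)" and "\<epsilon> > 0"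
  shows "\<exists>V. openin (mtop M) V \<and> p \<in> V \<and> (\<forall>a\<in>V. \<forall>b\<in>V. ell a b \<le> ereal \<epsilon>)"
proof -
  obtain c r k where cb: "cone_ball c (snd c p) r k" and pc: "p \<in> fst c"
    by (rule cone_ball_at[OF p]) (rule that)
  define x0 where "x0 = snd c p"
  note cb = cb[folded x0_def] and c = cone_ballD(1)[OF cb] and r = cone_ballD(2)[OF cb] and k = cone_ballD(3)[OF cb]
  define C where "C = 2 * norm (TF c x0) / (k\<^sup>2 * sqrt k)"
  have "C \<ge> 0" using k by (simp add: C_def)
  define r' where "r' = min r (\<epsilon> / (C + 1))"
  have r': "r' > 0" "r' \<le> r" using r \<open>\<epsilon> > 0\<close> \<open>C \<ge> 0\<close> by (auto simp: r'_def)
  have "C * r' \<le> (C + 1) * (\<epsilon> / (C + 1))" using \<open>C \<ge> 0\<close> r' by (intro mult_mono) (auto simp: r'_def)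
  then have C_small: "C * r' \<le> \<epsilon>" using \<open>C \<ge> 0\<close> by simp
  define Out where "Out = {q \<in> fst c. snd c q \<in> ball x0 r'}"
  have Out: "openin (mtop M) Out" "p \<in> Out"
    using openin_chart_preimage[OF c open_ball] pc r' by (auto simp: Out_def x0_def)
  have comp: "compactin (mtop M) (coord_inv c ` K)" if "compact K" "K \<subseteq> cball x0 r'" for K
  proof (rule image_compactin)
    have "K \<subseteq> snd c ` fst c" using that(2) r'(2) cone_ballD(4)[OF cb] by (meson subset_cball subset_trans)
    then show "compactin (top_of_set (snd c ` fst c)) K" using that(1) by (simp add: compactin_subtopology)
    show "continuous_map (top_of_set (snd c ` fst c)) (mtop M) (coord_inv c)"
      using continuous_coord_inv[OF c] by (simp add: continuous_map_in_subtopology)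
  qed
  define K where "K = coord_inv c ` sphere x0 r'"
  have K: "compactin (mtop M) K" unfolding K_def by (rule comp) auto
  have "p \<notin> K"
  proof
    assume "p \<in> K"
    then obtain y where y: "y \<in> sphere x0 r'" "p = coord_inv c y" by (auto simp: K_def)
    then have "y \<in> cball x0 r" using r' by auto
    then have "snd c p = y" using y(2) cone_ballD(4)[OF cb] coord_coord_inv by blast
    then show False using y r' by (simp add: x0_def)
  qed
  obtain V where V: "openin (mtop M) V" "p \<in> V"
    "\<And>a b z. a \<in> V \<Longrightarrow> b \<in> V \<Longrightarrow> z \<in> K \<Longrightarrow> \<not> (causal ell a z \<and> causal ell z b)"
    by (rule locally_avoids_compact[OF p K \<open>p \<notin> K\<close>]) (rule that)
  define Far where "Far = topspace (mtop M) - coord_inv c ` cball x0 r'"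
  have Far: "openin (mtop M) Far" unfolding Far_def
    by (intro openin_diff openin_topspace compactin_imp_closedin[OF hausdorff] comp) auto
  have "ell a b \<le> ereal \<epsilon>" if ab: "a \<in> V \<inter> Out" "b \<in> V \<inter> Out" for a b
  proof (rule time_separation_least)
    fix s t \<gamma> assume \<gamma>: "causal_curve M s t \<gamma>" "\<gamma> s = a" "\<gamma> t = b"
    have st: "s < t" and cont: "continuous_map (top_of_set {s..t}) (mtop M) \<gamma>"
      using \<gamma> by (auto simp: causal_curve_iff)
    have noK: "\<gamma> u \<notin> K" if u: "u \<in> {s..t}" for u
    proof
      assume "\<gamma> u \<in> K"
      moreover have "causal ell a (\<gamma> u)" "causal ell (\<gamma> u) b"
        using causal_along_curve[OF \<gamma>(1), of s u] causal_along_curve[OF \<gamma>(1), of u t] u \<gamma>(2,3) by auto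
      ultimately show False using V(3) ab by blast
    qed
    have "connectedin (mtop M) (\<gamma> ` {s..t})"
      by (rule connectedin_continuous_map_image[OF cont]) (simp add: connectedin_subtopology)
    moreover have "\<gamma> ` {s..t} \<subseteq> Out \<union> Far"
    proof
      fix q assume "q \<in> \<gamma> ` {s..t}"
      then have q: "q \<in> topspace (mtop M)" "q \<notin> K" using noK curve_in_space[OF \<gamma>(1)] by auto
      show "q \<in> Out \<union> Far"
      proof (cases "q \<in> coord_inv c ` cball x0 r'")
        case True
        then obtain y where y: "y \<in> cball x0 r'" "q = coord_inv c y" by blast
        then have "y \<notin> sphere x0 r'" using q(2) by (auto simp: K_def)
        then have yb: "y \<in> ball x0 r'" using y(1) by auto
        have "y \<in> snd c ` fst c" using y(1) r'(2) cone_ballD(4)[OF cb] by (meson subset_cball subsetD)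
        then show ?thesis using yb y(2) coord_coord_inv coord_inv_in by (simp add: Out_def)
      qed (use q in \<open>simp add: Far_def\<close>)
    qed
    moreover have "Out \<inter> Far = {}"
    proof -
      have "q \<in> coord_inv c ` cball x0 r'" if "q \<in> Out" for q
      proof -
        have "q \<in> fst c" "snd c q \<in> cball x0 r'" using that by (auto simp: Out_def)
        then show ?thesis using coord_inv_coord[OF c] by (metis imageI)
      qed
      then show ?thesis by (auto simp: Far_def)
    qed
    moreover have "Out \<inter> \<gamma> ` {s..t} \<noteq> {}" using \<gamma>(2) ab st by auto
    ultimately have "Far \<inter> \<gamma> ` {s..t} = {}"
      using Out(1) Far unfolding connectedin by blast
    then have sub: "\<gamma> ` {s..t} \<subseteq> Out" using \<open>\<gamma> ` {s..t} \<subseteq> Out \<union> Far\<close> by blast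
    have "lorentzian_length M s t \<gamma> \<le> ereal (C * r')"
      unfolding C_def by (rule cone_ball_length[OF cb r'(2) \<gamma>(1)]) (use sub in \<open>auto simp: Out_def image_subset_iff less_imp_le\<close>)
    then show "lorentzian_length M s t \<gamma> \<le> ereal \<epsilon>" using C_small by (meson ereal_less_eq(3) order_trans)
  qed (use \<open>\<epsilon> > 0\<close> in simp)
  then show ?thesis using V Out by (intro exI[of _ "V \<inter> Out"]) (auto intro: openin_Int)
qed

lemma time_separation_finite:
  assumes p: "p \<in> topspace (mtop M)" and q: "q \<in> topspace (mtop M)"
  shows "ell p q < \<infinity>"
proof -
  let ?J = "diamond (topspace (mtop M)) ell p q"
  have "\<forall>z\<in>topspace (mtop M). \<exists>V. openin (mtop M) V \<and> z \<in> V \<and> (\<forall>a\<in>V. \<forall>b\<in>V. ell a b \<le> ereal 1)"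
    using locally_small_separation[of _ 1] by simp
  then obtain V where V: "\<And>z. z \<in> topspace (mtop M) \<Longrightarrow> openin (mtop M) (V z) \<and> z \<in> V z \<and> (\<forall>a\<in>V z. \<forall>b\<in>V z. ell a b \<le> ereal 1)"
    by metis
  have J: "compactin (mtop M) ?J" "?J \<subseteq> topspace (mtop M)" using compact_diamonds[OF p q] by (auto simp: diamond_def)
  obtain Z where Z: "finite Z" "Z \<subseteq> ?J" "?J \<subseteq> (\<Union>z\<in>Z. V z)"
  proof (rule compactin_finite_cover[OF J(1), of V])
    show "openin (mtop M) (V z) \<and> z \<in> V z" if "z \<in> ?J" for z using V[of z] J(2) that by blast
  qed (rule that)
  have "ell p q \<le> ereal (2 * real (card (V ` Z)))"
  proof (rule time_separation_least)
    fix a b \<gamma> assume \<gamma>: "causal_curve M a b \<gamma>" "\<gamma> a = p" "\<gamma> b = q"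
    have "\<gamma> t \<in> ?J" if t: "t \<in> {a..b}" for t
      using causal_along_curve[OF \<gamma>(1), of a t] causal_along_curve[OF \<gamma>(1), of t b] t \<gamma>(2,3)
        curve_in_space[OF \<gamma>(1) t] by (simp add: diamond_def)
    then have "\<gamma> ` {a..b} \<subseteq> \<Union>(V ` Z)" using Z(3) by blast
    then show "lorentzian_length M a b \<gamma> \<le> ereal (2 * real (card (V ` Z)))"
      using V Z J(2) by (intro finite_cover_length[OF _ _ \<gamma>(1)]) (auto simp: one_ereal_def)
  qed simp
  then show ?thesis by (rule le_less_trans) simp
qed

theorem spacetime_finite_approximation:
  "\<exists>b U. covered_lorentzian_prelength_space (mtop M) ell b U \<and>
           (\<exists>(X::nat \<Rightarrow> nat set) ls bs Us.
              (\<forall>n. finite (X n) \<and>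
                   covered_lorentzian_prelength_space (discrete_topology (X n)) (ls n) (bs n) (Us n)) \<and>
              strong_pLGH_convergence (\<lambda>n. discrete_topology (X n)) ls bs Us (mtop M) ell b U)"
  by (rule finite_approximation[OF time_separation_finite locally_small_separation])

end

section \<open>The chronological relation of a smooth metric\<close>

lemma has_vector_derivative_quotient:
  assumes "(f has_vector_derivative v) (at t)"
  shows "((\<lambda>s. (f s - f t) /\<^sub>R (s - t)) \<longlongrightarrow> v) (at t)"
proof -
  have "((\<lambda>s. norm ((f s - f t) - (s - t) *\<^sub>R v) / norm (s - t)) \<longlongrightarrow> 0) (at t)"
    using assms unfolding has_vector_derivative_def has_derivative_iff_norm by blast
  moreover have "\<forall>\<^sub>F s in at t. norm ((f s - f t) - (s - t) *\<^sub>R v) / norm (s - t) = norm ((f s - f t) /\<^sub>R (s - t) - v)"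
  proof -
    have "norm ((f s - f t) - (s - t) *\<^sub>R v) / norm (s - t) = norm ((f s - f t) /\<^sub>R (s - t) - v)" if "s \<noteq> t" for s
    proof -
      have "(f s - f t) /\<^sub>R (s - t) - v = ((f s - f t) - (s - t) *\<^sub>R v) /\<^sub>R (s - t)"
        using that by (simp add: scaleR_diff_right)
      then show ?thesis by (simp add: divide_inverse mult.commute)
    qed
    then show ?thesis by (simp add: eventually_at_filter)
  qed
  ultimately have "((\<lambda>s. norm ((f s - f t) /\<^sub>R (s - t) - v)) \<longlongrightarrow> 0) (at t)"
    by (rule Lim_transform_eventually)
  then show ?thesis by (simp add: tendsto_norm_zero_iff LIM_zero_iff)
qed

lemma lipschitz_vector_derivative_bound:
  fixes f :: "real \<Rightarrow> 'a::real_normed_vector"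
  assumes L: "L-lipschitz_on {a..b} f" and t: "a < t" "t < b" and v: "(f has_vector_derivative v) (at t)"
  shows "norm v \<le> L"
proof -
  have "((\<lambda>s. norm ((f s - f t) /\<^sub>R (s - t))) \<longlongrightarrow> norm v) (at t)"
    by (rule tendsto_norm[OF has_vector_derivative_quotient[OF v]])
  moreover have "\<forall>\<^sub>F s in at t. norm ((f s - f t) /\<^sub>R (s - t)) \<le> L"
  proof -
    have "\<forall>\<^sub>F s in at t. s \<in> {a<..<b} - {t}"
      by (rule eventually_at_in_open) (use t in auto)
    then show ?thesis
    proof eventually_elim
      case (elim s)
      then have "norm (f s - f t) \<le> L * \<bar>s - t\<bar>"
        using lipschitz_onD[OF L, of s t] t by (simp add: dist_norm)
      moreover have "norm ((f s - f t) /\<^sub>R (s - t)) = norm (f s - f t) / \<bar>s - t\<bar>"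
        by (simp add: divide_inverse mult.commute)
      ultimately show ?case using elim by (simp add: divide_le_eq)
    qed
  qed
  ultimately show ?thesis by (rule tendsto_upperbound) simp
qed

context lorentz_spacetime
begin

lemma causal_chron_causal:
  assumes "causal ell p p'" "chron ell p' q'" "causal ell q' q" shows "chron ell p q"
proof -
  have "0 \<le> ell p p'" "0 < ell p' q'" "0 \<le> ell q' q" using assms by (auto simp: causal_def chron_def)
  then have "0 < ell p p' + ell p' q'" by (simp add: add_nonneg_pos)
  also have "\<dots> \<le> ell p q'"
    using time_separation_triangle[of p p' q'] \<open>0 \<le> ell p p'\<close> \<open>0 < ell p' q'\<close> by (auto simp: ell_plus_def split: if_splits)
  finally have 1: "0 < ell p q'" .
  then have "0 < ell p q' + ell q' q" using \<open>0 \<le> ell q' q\<close> by (simp add: add_pos_nonneg)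
  also have "\<dots> \<le> ell p q"
    using time_separation_triangle[of p q' q] 1 \<open>0 \<le> ell q' q\<close> by (auto simp: ell_plus_def split: if_splits)
  finally show ?thesis by (simp add: chron_def)
qed

lemma timelike_velocity_stable:
  assumes c: "c \<in> atlas M" and x0: "x0 \<in> snd c ` fst c" and v: "G c x0 v v < 0" "G c x0 (TF c x0) v < 0"
  obtains r \<epsilon> \<mu> where "r > 0" "\<epsilon> > 0" "\<mu> > 0" "cball x0 r \<subseteq> snd c ` fst c"
    "\<And>x w. x \<in> cball x0 r \<Longrightarrow> dist w v < \<epsilon> \<Longrightarrow> G c x w w \<le> - \<mu> \<and> G c x (TF c x) w < 0"
proof -
  have bil: "bilinear (G c x0)" using G_bilinear[OF c x0] .
  define \<mu> where "\<mu> = min (- G c x0 v v) (- G c x0 (TF c x0) v) / 2"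
  have "\<mu> > 0" using v by (simp add: \<mu>_def)
  have less: "G c x0 v v < - \<mu>" "G c x0 (TF c x0) v < - \<mu>" using v by (auto simp: \<mu>_def min_def)
  have bb: "bounded_bilinear (G c x0)" using bil by (simp add: bilinear_conv_bounded_bilinear)
  have "((\<lambda>w. G c x0 w w) \<longlongrightarrow> G c x0 v v) (nhds v)"
    by (intro bounded_bilinear.tendsto[OF bb] tendsto_ident_at filterlim_ident)
  then have "\<forall>\<^sub>F w in nhds v. G c x0 w w < - \<mu>" using less(1) by (rule order_tendstoD)
  moreover have "((\<lambda>w. G c x0 (TF c x0) w) \<longlongrightarrow> G c x0 (TF c x0) v) (nhds v)"
    by (intro bounded_bilinear.tendsto[OF bb] tendsto_const filterlim_ident)
  then have "\<forall>\<^sub>F w in nhds v. G c x0 (TF c x0) w < - \<mu>" using less(2) by (rule order_tendstoD)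
  moreover have "\<forall>\<^sub>F w in nhds v. norm w < norm v + 1"
  proof -
    have "((\<lambda>w. norm w) \<longlongrightarrow> norm v) (nhds v)" by (intro tendsto_norm filterlim_ident)
    then show ?thesis by (rule order_tendstoD) simp
  qed
  ultimately have "\<forall>\<^sub>F w in nhds v. G c x0 w w < - \<mu> \<and> G c x0 (TF c x0) w < - \<mu> \<and> norm w < norm v + 1"
    by eventually_elim simp
  then obtain \<epsilon> where \<epsilon>: "\<epsilon> > 0"
    "\<And>w. dist w v < \<epsilon> \<Longrightarrow> G c x0 w w < - \<mu> \<and> G c x0 (TF c x0) w < - \<mu> \<and> norm w < norm v + 1"
    unfolding eventually_nhds_metric by blast
  define N where "N = norm v + 1"
  have N: "N \<ge> 1" by (simp add: N_def)
  define \<eta> where "\<eta> = \<mu> / (2 * N\<^sup>2)"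
  have \<eta>: "\<eta> > 0" "\<eta> * N\<^sup>2 = \<mu> / 2" using \<open>\<mu> > 0\<close> N by (auto simp: \<eta>_def)
  have \<eta>N: "\<eta> * N \<le> \<mu> / 2"
  proof -
    have "N * 1 \<le> N * N" using N by (intro mult_left_mono) auto
    then have "\<eta> * N \<le> \<eta> * N\<^sup>2" using \<eta>(1) by (simp add: power2_eq_square)
    then show ?thesis using \<eta>(2) by simp
  qed
  obtain r where r: "r > 0" "cball x0 r \<subseteq> snd c ` fst c"
    "\<And>x v w. x \<in> cball x0 r \<Longrightarrow> \<bar>G c x v w - G c x0 v w\<bar> \<le> \<eta> * norm v * norm w"
    "\<And>x v. x \<in> cball x0 r \<Longrightarrow> \<bar>G c x (TF c x) v - G c x0 (TF c x0) v\<bar> \<le> \<eta> * norm v"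
    by (rule G_close[OF c x0 \<eta>(1)]) (rule that)
  have "G c x w w \<le> - (\<mu> / 2) \<and> G c x (TF c x) w < 0" if x: "x \<in> cball x0 r" and w: "dist w v < \<epsilon>" for x w
  proof
    have w': "G c x0 w w < - \<mu>" "G c x0 (TF c x0) w < - \<mu>" "norm w \<le> N"
      using \<epsilon>(2)[OF w] by (auto simp: N_def)
    have "\<eta> * norm w * norm w \<le> \<eta> * N * N" using \<eta>(1) w'(3) N by (intro mult_mono) auto
    then show "G c x w w \<le> - (\<mu> / 2)"
      using r(3)[OF x, of w w] w'(1) \<eta>(2) unfolding power2_eq_square mult.assoc[symmetric] by linarith
    have "\<eta> * norm w \<le> \<eta> * N" using \<eta>(1) w'(3) by simp
    then show "G c x (TF c x) w < 0" using r(4)[OF x, of w] w'(2) \<eta>N \<open>\<mu> > 0\<close> by linarith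
  qed
  with r \<epsilon>(1) \<open>\<mu> > 0\<close> that[of r \<epsilon> "\<mu> / 2"] show ?thesis by simp
qed

lemma positive_length_timelike_velocity:
  assumes \<gamma>: "causal_curve M a b \<gamma>" and pos: "lorentzian_length M a b \<gamma> > 0"
  obtains t c v where "a < t" "t < b" "c \<in> atlas M" "\<gamma> t \<in> fst c"
    "((snd c \<circ> \<gamma>) has_vector_derivative v) (at t)" "G c (snd c (\<gamma> t)) v v < 0"
    "G c (snd c (\<gamma> t)) (TF c (snd c (\<gamma> t))) v < 0"
proof -
  have cont: "continuous_map (top_of_set {a..b}) (mtop M) \<gamma>"
    and ae: "AE t in lebesgue. t \<in> {a..b} \<longrightarrow> causal_at \<gamma> t" using \<gamma> by (auto simp: causal_curve_iff)
  have "\<exists>t. a < t \<and> t < b \<and> causal_at \<gamma> t \<and> causal_speed M \<gamma> t \<noteq> 0"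
  proof (rule ccontr)
    assume contra: "\<not> ?thesis"
    have "AE t in lebesgue. t \<notin> {a, b}" by (rule AE_not_in_finite) simp
    with ae have "AE t in lebesgue. ennreal (causal_speed M \<gamma> t) * indicator {a..b} t \<le> 0"
    proof eventually_elim
      case (elim t)
      then show ?case using contra by (cases "t \<in> {a..b}") auto
    qed
    then have "(\<integral>\<^sup>+t\<in>{a..b}. ennreal (causal_speed M \<gamma> t) \<partial>lebesgue) \<le> (\<integral>\<^sup>+t. 0 \<partial>(lebesgue :: real measure))"
      by (rule nn_integral_mono_AE)
    then show False using pos by (simp add: lorentzian_length_def zero_ennreal.rep_eq)
  qed
  then obtain t where t: "a < t" "t < b" "causal_at \<gamma> t" "causal_speed M \<gamma> t \<noteq> 0" by blast
  obtain c where c: "c \<in> atlas M" "\<gamma> t \<in> fst c" using chart_at[OF curve_in_space[OF \<gamma>, of t]] t by auto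
  obtain v where v: "((snd c \<circ> \<gamma>) has_vector_derivative v) (at t)" "future_causal_vector M c (\<gamma> t) v"
    using t(3) c unfolding causal_at_def by blast
  have "coord_inv c (snd c (\<gamma> t)) = \<gamma> t" using c by (simp add: coord_inv_coord)
  then have fv: "fcv c (snd c (\<gamma> t)) v" using v(2) fcv_iff[of c "snd c (\<gamma> t)" v] by simp
  have "causal_speed M \<gamma> t = sqrt (- G c (snd c (\<gamma> t)) v v)"
    using causal_speed_chart[OF cont t(1,2) c v(1)] by (simp add: G_def coord_inv_coord c)
  then have "G c (snd c (\<gamma> t)) v v \<noteq> 0" using t(4) by auto
  then show ?thesis using that[OF t(1,2) c v(1)] fv by (simp add: fcv_def)
qed

lemma chart_nhd:
  assumes c: "c \<in> atlas M" and p: "p \<in> fst c" and "\<delta> > 0"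
  shows "openin (mtop M) {q \<in> fst c. snd c q \<in> ball (snd c p) \<delta>}" "p \<in> {q \<in> fst c. snd c q \<in> ball (snd c p) \<delta>}"
  using openin_chart_preimage[OF c open_ball] p \<open>\<delta> > 0\<close> by auto

text \<open>The pairs in the interior of the chronological relation.\<close>

definition stably_chron :: "'m \<Rightarrow> 'm \<Rightarrow> bool" where
  "stably_chron p q \<longleftrightarrow> (\<exists>V W. openin (mtop M) V \<and> openin (mtop M) W \<and> p \<in> V \<and> q \<in> W \<and>
     (\<forall>p'\<in>V. \<forall>q'\<in>W. chron ell p' q'))"

text \<open>Where the velocity \<open>v\<close> exists, the chord from \<open>\<gamma> s\<close> to \<open>\<gamma> t\<close> is \<open>(t - s) v\<close> up to an error of smaller
  order. If \<open>v\<close> is timelike, then for \<open>t\<close> close to \<open>s\<close> this chord is timelike, and remains so when its end points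
  are moved by less than a small multiple of \<open>t - s\<close>. A single parameter with timelike velocity is
  enough for this.\<close>

lemma positive_length_stable_chord:
  assumes \<gamma>: "causal_curve M a b \<gamma>" and pos: "lorentzian_length M a b \<gamma> > 0"
  obtains s t where "a < s" "s < t" "t < b" "stably_chron (\<gamma> s) (\<gamma> t)"
proof -
  have cont: "continuous_map (top_of_set {a..b}) (mtop M) \<gamma>" using \<gamma> by (simp add: causal_curve_iff)
  obtain s c v where s: "a < s" "s < b" and c: "c \<in> atlas M" and sc: "\<gamma> s \<in> fst c"
    and v: "((snd c \<circ> \<gamma>) has_vector_derivative v) (at s)" "G c (snd c (\<gamma> s)) v v < 0"
      "G c (snd c (\<gamma> s)) (TF c (snd c (\<gamma> s))) v < 0"
    by (rule positive_length_timelike_velocity[OF \<gamma> pos]) (rule that)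
  define x where "x = snd c \<circ> \<gamma>"
  define x0 where "x0 = snd c (\<gamma> s)"
  have x0S: "x0 \<in> snd c ` fst c" using sc by (simp add: x0_def)
  obtain r \<epsilon> \<mu> where r: "r > 0" "\<epsilon> > 0" "\<mu> > 0" "cball x0 r \<subseteq> snd c ` fst c"
    "\<And>x w. x \<in> cball x0 r \<Longrightarrow> dist w v < \<epsilon> \<Longrightarrow> G c x w w \<le> - \<mu> \<and> G c x (TF c x) w < 0"
    by (rule timelike_velocity_stable[OF c x0S v(2,3)[folded x0_def]]) (rule that)
  have "((\<lambda>t. (x t - x s) /\<^sub>R (t - s)) \<longlongrightarrow> v) (at s)"
    by (rule has_vector_derivative_quotient[OF v(1)[folded x_def]])
  then have "\<forall>\<^sub>F t in at s. dist ((x t - x s) /\<^sub>R (t - s)) v < \<epsilon> / 2" using r(2) by (intro tendstoD) auto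
  then have "\<forall>\<^sub>F t in at_right s. dist ((x t - x s) /\<^sub>R (t - s)) v < \<epsilon> / 2"
    by (simp add: eventually_at_split)
  moreover have "\<forall>\<^sub>F t in at_right s. \<gamma> t \<in> {q \<in> fst c. snd c q \<in> ball x0 (r / 2)}"
  proof -
    have "\<forall>\<^sub>F t in nhds s. \<gamma> t \<in> {q \<in> fst c. snd c q \<in> ball x0 (r / 2)}"
      by (rule curve_eventually_in[OF cont s]) (use chart_nhd[OF c sc, of "r / 2"] r(1) in \<open>auto simp: x0_def\<close>)
    then show ?thesis unfolding eventually_at_filter by (rule eventually_mono) simp
  qed
  moreover have "\<forall>\<^sub>F t in at_right s. t \<in> {s<..<b}" using s(2) by (rule eventually_at_right_real)
  ultimately have "\<forall>\<^sub>F t in at_right s. dist ((x t - x s) /\<^sub>R (t - s)) v < \<epsilon> / 2 \<and>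
      \<gamma> t \<in> {q \<in> fst c. snd c q \<in> ball x0 (r / 2)} \<and> t \<in> {s<..<b}" by eventually_elim simp
  then obtain t where t: "dist ((x t - x s) /\<^sub>R (t - s)) v < \<epsilon> / 2" "\<gamma> t \<in> fst c"
      "snd c (\<gamma> t) \<in> ball x0 (r / 2)" "s < t" "t < b"
    using eventually_happens by fastforce
  define h where "h = t - s"
  have "h > 0" using t by (simp add: h_def)
  \<comment> \<open>Moving both end points by less than \<open>\<delta>\<close> changes the difference quotient by at most
  \<open>2 \<delta> / h \<le> \<epsilon> / 2\<close>.\<close>
  define \<delta> where "\<delta> = min (h * \<epsilon> / 4) (r / 2)"
  have "\<delta> > 0" using \<open>h > 0\<close> r by (simp add: \<delta>_def)
  have xs: "x s = x0" "x t = snd c (\<gamma> t)" by (simp_all add: x_def x0_def)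
  have chr: "chron ell p q" if p: "p \<in> {q \<in> fst c. snd c q \<in> ball (snd c (\<gamma> s)) \<delta>}"
    and q: "q \<in> {q \<in> fst c. snd c q \<in> ball (snd c (\<gamma> t)) \<delta>}" for p q
  proof -
    define y z where "y = snd c p" and "z = snd c q"
    have y: "norm (y - x s) < \<delta>" and z: "norm (z - x t) < \<delta>"
      using p q by (auto simp: y_def z_def x_def dist_norm norm_minus_commute)
    have yc: "y \<in> cball x0 r" using y r(1) by (simp add: xs \<delta>_def dist_norm norm_minus_commute)
    have "dist x0 z \<le> dist x0 (x t) + dist (x t) z" by (rule dist_triangle)
    also have "\<dots> \<le> r / 2 + r / 2"
      using t(3) z by (intro add_mono) (auto simp: xs(2) \<delta>_def dist_norm norm_minus_commute)
    finally have zc: "z \<in> cball x0 r" by simp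
    define w where "w = (z - y) /\<^sub>R h"
    have "w - (x t - x s) /\<^sub>R h = ((z - x t) - (y - x s)) /\<^sub>R h" by (simp add: w_def algebra_simps)
    then have "norm (w - (x t - x s) /\<^sub>R h) = norm ((z - x t) - (y - x s)) / h" using \<open>h > 0\<close> by (simp add: divide_inverse mult.commute)
    also have "\<dots> \<le> (\<delta> + \<delta>) / h"
      using y z \<open>h > 0\<close> norm_triangle_ineq4[of "z - x t" "y - x s"] by (intro divide_right_mono) auto
    also have "\<dots> \<le> \<epsilon> / 2"
    proof -
      have "\<delta> \<le> h * \<epsilon> / 4" unfolding \<delta>_def by (rule min.cobounded1)
      then have "\<delta> + \<delta> \<le> \<epsilon> / 2 * h" by (simp add: mult.commute)
      then show ?thesis using \<open>h > 0\<close> by (simp add: divide_le_eq)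
    qed
    finally have "dist w ((x t - x s) /\<^sub>R h) \<le> \<epsilon> / 2" by (simp add: dist_norm)
    then have wv: "dist w v < \<epsilon>"
      using t(1) dist_triangle[of w v "(x t - x s) /\<^sub>R h"] unfolding h_def by linarith
    have zy: "z - y = h *\<^sub>R w" using \<open>h > 0\<close> by (simp add: w_def)
    have "chron ell (coord_inv c y) (coord_inv c z)"
    proof (rule chord_chron[OF c r(4) yc zc, of "h\<^sup>2 * \<mu>"])
      show "h\<^sup>2 * \<mu> > 0" using \<open>h > 0\<close> r(3) by simp
      fix x assume x: "x \<in> cball x0 r"
      have bil: "bilinear (G c x)" using G_bilinear[OF c] r(4) x by blast
      have "h\<^sup>2 * G c x w w \<le> h\<^sup>2 * (- \<mu>)" using r(5)[OF x wv] by (intro mult_left_mono) auto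
      then show "G c x (z - y) (z - y) \<le> - (h\<^sup>2 * \<mu>)"
        unfolding zy using bil by (simp add: bilinear_lmul bilinear_rmul power2_eq_square mult.assoc)
      have "h * G c x (TF c x) w < 0" using r(5)[OF x wv] \<open>h > 0\<close> by (intro mult_pos_neg) auto
      then show "G c x (TF c x) (z - y) < 0" unfolding zy using bil by (simp add: bilinear_rmul)
    qed
    then show ?thesis using p q c by (simp add: y_def z_def coord_inv_coord)
  qed
  have "stably_chron (\<gamma> s) (\<gamma> t)"
    unfolding stably_chron_def using chart_nhd[OF c sc \<open>\<delta> > 0\<close>] chart_nhd[OF c t(2) \<open>\<delta> > 0\<close>] chr by blast
  then show ?thesis using that s t by blast
qed

text \<open>Lower semicontinuity of \<open>J\<^sup>+\<close> at \<open>p\<close> with respect to the value \<open>q\<close>; \<open>past_stable\<close> is the same property of \<open>J\<^sup>-\<close>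
  at \<open>q\<close>. Unlike \<open>stably_chron\<close> these hold also along null curves, and they compose along a curve.\<close>

definition future_stable :: "'m \<Rightarrow> 'm \<Rightarrow> bool" where
  "future_stable p q \<longleftrightarrow> (\<forall>W. openin (mtop M) W \<and> q \<in> W \<longrightarrow>
     (\<exists>V. openin (mtop M) V \<and> p \<in> V \<and> (\<forall>p'\<in>V. \<exists>q'\<in>W. causal ell p' q')))"

definition past_stable :: "'m \<Rightarrow> 'm \<Rightarrow> bool" where
  "past_stable p q \<longleftrightarrow> (\<forall>V. openin (mtop M) V \<and> p \<in> V \<longrightarrow>
     (\<exists>W. openin (mtop M) W \<and> q \<in> W \<and> (\<forall>q'\<in>W. \<exists>p'\<in>V. causal ell p' q')))"

lemma causal_ell_refl: "causal ell p p"
  by (simp add: causal_def time_separation_refl_nonneg)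

lemma future_stable_refl: "future_stable p p" and past_stable_refl: "past_stable p p"
  unfolding future_stable_def past_stable_def using causal_ell_refl by blast+

lemma future_stable_trans: "future_stable p q \<Longrightarrow> future_stable q r \<Longrightarrow> future_stable p r"
  unfolding future_stable_def by (meson causal_ell_trans)

lemma past_stable_trans: "past_stable p q \<Longrightarrow> past_stable q r \<Longrightarrow> past_stable p r"
  unfolding past_stable_def by (meson causal_ell_trans)

lemma stably_chronI:
  assumes "future_stable p p'" "stably_chron p' q'" "past_stable q' q" shows "stably_chron p q"
proof -
  obtain V W where VW: "openin (mtop M) V" "openin (mtop M) W" "p' \<in> V" "q' \<in> W"
     "\<And>a b. a \<in> V \<Longrightarrow> b \<in> W \<Longrightarrow> chron ell a b" using assms(2) unfolding stably_chron_def by blast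
  obtain V' where V': "openin (mtop M) V'" "p \<in> V'" "\<And>a. a \<in> V' \<Longrightarrow> \<exists>b\<in>V. causal ell a b"
    using assms(1)[unfolded future_stable_def, rule_format, of V] VW(1,3) by blast
  obtain W' where W': "openin (mtop M) W'" "q \<in> W'" "\<And>b. b \<in> W' \<Longrightarrow> \<exists>a\<in>W. causal ell a b"
    using assms(3)[unfolded past_stable_def, rule_format, of W] VW(2,4) by blast
  have "chron ell a b" if "a \<in> V'" "b \<in> W'" for a b
    using V'(3)[OF that(1)] W'(3)[OF that(2)] VW(5) causal_chron_causal by blast
  then show ?thesis using V' W' unfolding stably_chron_def by blast
qed

lemma metric_lipschitz:
  assumes smooth: "smooth_metric M" and c: "c \<in> atlas M" and x0: "x0 \<in> snd c ` fst c"
  obtains r L where "r > 0" "L \<ge> 0" "cball x0 r \<subseteq> snd c ` fst c"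
    "\<And>x y v w. x \<in> cball x0 r \<Longrightarrow> y \<in> cball x0 r \<Longrightarrow> \<bar>G c x v w - G c y v w\<bar> \<le> L * dist x y * norm v * norm w"
proof -
  let ?S = "snd c ` fst c"
  have "\<exists>r L. r > 0 \<and> cball x0 r \<subseteq> ?S \<and> L-lipschitz_on (cball x0 r) (\<lambda>x. G c x v w)" for v w
  proof -
    have "Ck_on (Suc 0) ?S (\<lambda>x. G c x v w)"
      using smooth c unfolding smooth_metric_def smooth_on_def G_def by blast
    from Ck1_locally_lipschitz[OF open_chart_image[OF c] x0 this] show ?thesis by metis
  qed
  then obtain r L where rL: "\<And>v w. r v w > 0 \<and> cball x0 (r v w) \<subseteq> ?S \<and> (L v w)-lipschitz_on (cball x0 (r v w)) (\<lambda>x. G c x v w)"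
    by metis
  let ?R = "(\<lambda>(i, j). r i j) ` (Basis \<times> Basis)"
  define r0 where "r0 = Min ?R"
  define L0 where "L0 = (\<Sum>(i, j)\<in>Basis \<times> Basis. L i j)"
  have fin: "finite ?R" "?R \<noteq> {}" by auto
  have "r0 > 0" unfolding r0_def using rL by (subst Min_gr_iff[OF fin]) auto
  have r0_le: "r0 \<le> r i j" if "i \<in> Basis" "j \<in> Basis" for i j
    unfolding r0_def using that by (intro Min_le[OF fin(1)]) force
  have Lpos: "L i j \<ge> 0" for i j using rL lipschitz_on_nonneg by blast
  have "L0 \<ge> 0" unfolding L0_def using Lpos by (intro sum_nonneg) auto
  have L_le: "L i j \<le> L0" if "i \<in> Basis" "j \<in> Basis" for i j
    unfolding L0_def using that Lpos member_le_sum[of "(i, j)" "Basis \<times> Basis" "\<lambda>(i, j). L i j"] by auto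
  obtain b :: 'e where b: "b \<in> Basis" using nonempty_Basis by blast
  have sub: "cball x0 r0 \<subseteq> ?S" using rL r0_le[OF b b] by (meson subset_cball subset_trans)
  show ?thesis
  proof
    show "r0 > 0" "(real DIM('e))\<^sup>2 * L0 \<ge> 0" "cball x0 r0 \<subseteq> ?S"
      using \<open>r0 > 0\<close> \<open>L0 \<ge> 0\<close> sub by auto
    fix x y v w assume x: "x \<in> cball x0 r0" and y: "y \<in> cball x0 r0"
    have "bilinear (G c x)" "bilinear (G c y)" using G_bilinear[OF c] sub x y by blast+
    then have bil: "bilinear (\<lambda>v w. G c x v w - G c y v w)"
      unfolding bilinear_def by (auto intro: linear_compose_sub)
    have "\<bar>G c x i j - G c y i j\<bar> \<le> L0 * dist x y" if ij: "i \<in> Basis" "j \<in> Basis" for i j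
    proof -
      have "x \<in> cball x0 (r i j)" "y \<in> cball x0 (r i j)" using x y r0_le[OF ij] by auto
      then have "\<bar>G c x i j - G c y i j\<bar> \<le> L i j * dist x y"
        using rL[of i j] lipschitz_onD[of "L i j" "cball x0 (r i j)" "\<lambda>x. G c x i j" x y] by (simp add: dist_real_def)
      also have "\<dots> \<le> L0 * dist x y" using L_le[OF ij] by (intro mult_right_mono) auto
      finally show ?thesis .
    qed
    from bilinear_small[OF bil this]
    show "\<bar>G c x v w - G c y v w\<bar> \<le> (real DIM('e))\<^sup>2 * L0 * dist x y * norm v * norm w" by (simp add: mult.assoc)
  qed
qed

text \<open>Let \<open>v\<close> be the velocity at \<open>x u\<close> and \<open>w = v + \<kappa> T\<close> the velocity of the perturbed curve at \<open>y u\<close>. Changing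
  the point costs at most \<open>K |y - x| |v|\<^sup>2 \<le> K L |y - x| |v|\<close> in \<open>g(v, v)\<close>, and the tilt gains
  \<open>2 \<kappa> g(T, v) \<le> - 2 \<kappa> k |v|\<close>. Both terms are linear in \<open>|v|\<close>, so the gain prevails for all velocities at once if
  \<open>K L |y - x| \<le> 2 \<kappa> k\<close>. The displacement \<open>y - x\<close> consists of \<open>h\<close> and of the effect of the tilt itself;
  the latter is compensated if the parameter interval is short, however small \<open>\<kappa>\<close> is.\<close>

lemma perturbed_curve:
  fixes h :: 'e
  assumes cb: "cone_ball c x0 r k"
    and lipG: "\<And>x y v w. x \<in> cball x0 r \<Longrightarrow> y \<in> cball x0 r \<Longrightarrow> \<bar>G c x v w - G c y v w\<bar> \<le> K * dist x y * norm v * norm w"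
    and "K \<ge> 0" and \<gamma>: "causal_curve M s t \<gamma>"
    and img: "\<And>u. u \<in> {s..t} \<Longrightarrow> \<gamma> u \<in> fst c \<and> snd c (\<gamma> u) \<in> cball x0 (r / 2)"
    and L: "L-lipschitz_on {s..t} (snd c \<circ> \<gamma>)"
    and "\<kappa> > 0" and u0: "u0 \<in> {s..t}"
    and short: "K * L * ((t - s) * norm (TF c x0)) \<le> k"
    and h: "K * L * norm h \<le> \<kappa> * k" and size: "norm h + \<kappa> * ((t - s) * norm (TF c x0)) \<le> r / 2"
  shows "causal ell (coord_inv c (snd c (\<gamma> s) + h + (\<kappa> * (s - u0)) *\<^sub>R TF c x0))
            (coord_inv c (snd c (\<gamma> t) + h + (\<kappa> * (t - u0)) *\<^sub>R TF c x0))"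
proof -
  note c = cone_ballD(1)[OF cb] and k = cone_ballD(3)[OF cb]
  define T where "T = TF c x0"
  define x where "x = snd c \<circ> \<gamma>"
  define y where "y u = x u + h + (\<kappa> * (u - u0)) *\<^sub>R T" for u
  have st: "s < t" and cont: "continuous_map (top_of_set {s..t}) (mtop M) \<gamma>"
    and ae: "AE u in lebesgue. u \<in> {s..t} \<longrightarrow> causal_at \<gamma> u" using \<gamma> by (auto simp: causal_curve_iff)
  have L0: "L \<ge> 0" using L by (rule lipschitz_on_nonneg)
  have disp: "norm (y u - x u) \<le> norm h + \<kappa> * ((t - s) * norm T)" if u: "u \<in> {s..t}" for u
  proof -
    have "\<bar>u - u0\<bar> \<le> t - s" using u u0 by auto
    have "norm (y u - x u) \<le> norm h + norm ((\<kappa> * (u - u0)) *\<^sub>R T)"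
      unfolding y_def using norm_triangle_ineq[of h "(\<kappa> * (u - u0)) *\<^sub>R T"] by (simp add: add.assoc)
    also have "norm ((\<kappa> * (u - u0)) *\<^sub>R T) = \<kappa> * (\<bar>u - u0\<bar> * norm T)" using \<open>\<kappa> > 0\<close> by (simp add: abs_mult)
    also have "\<dots> \<le> \<kappa> * ((t - s) * norm T)"
      using \<open>\<bar>u - u0\<bar> \<le> t - s\<close> \<open>\<kappa> > 0\<close> by (intro mult_left_mono mult_right_mono) auto
    finally show ?thesis by simp
  qed
  have xin: "x u \<in> cball x0 (r / 2)" if "u \<in> {s..t}" for u using img[OF that] by (simp add: x_def)
  have xr: "x u \<in> cball x0 r" if "u \<in> {s..t}" for u
    using xin[OF that] cone_ballD(2)[OF cb] by simp
  have yr: "y u \<in> cball x0 r" if u: "u \<in> {s..t}" for u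
  proof -
    have "dist x0 (y u) \<le> dist x0 (x u) + dist (x u) (y u)" by (rule dist_triangle)
    also have "\<dots> \<le> r / 2 + r / 2"
      using xin[OF u] disp[OF u] size by (intro add_mono) (auto simp: dist_norm norm_minus_commute T_def)
    finally show ?thesis by simp
  qed
  have drift: "K * L * norm (y u - x u) \<le> 2 * \<kappa> * k" if u: "u \<in> {s..t}" for u
  proof -
    have "K * L * norm (y u - x u) \<le> K * L * (norm h + \<kappa> * ((t - s) * norm T))"
      using disp[OF u] \<open>K \<ge> 0\<close> L0 by (intro mult_left_mono) auto
    also have "\<dots> = K * L * norm h + \<kappa> * (K * L * ((t - s) * norm T))" by (simp add: algebra_simps)
    also have "\<dots> \<le> \<kappa> * k + \<kappa> * k"
      using h short \<open>\<kappa> > 0\<close> by (intro add_mono mult_left_mono) (auto simp: T_def)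
    finally show ?thesis by simp
  qed
  have "causal_curve M s t (coord_inv c \<circ> y)"
  proof (rule chart_curveI[OF c st])
    show "y ` {s..t} \<subseteq> snd c ` fst c" using yr cone_ballD(4)[OF cb] by blast
    show "(L + \<kappa> * norm T)-lipschitz_on {s..t} y"
    proof (rule lipschitz_onI)
      show "0 \<le> L + \<kappa> * norm T" using L0 \<open>\<kappa> > 0\<close> by simp
      fix u w assume uw: "u \<in> {s..t}" "w \<in> {s..t}"
      have "y u - y w = (x u - x w) + (\<kappa> * (u - w)) *\<^sub>R T" by (simp add: y_def algebra_simps)
      then have "norm (y u - y w) \<le> norm (x u - x w) + norm ((\<kappa> * (u - w)) *\<^sub>R T)" by (metis norm_triangle_ineq)
      also have "\<dots> \<le> L * \<bar>u - w\<bar> + \<kappa> * norm T * \<bar>u - w\<bar>"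
        using lipschitz_onD[OF L uw] \<open>\<kappa> > 0\<close> by (intro add_mono) (auto simp: x_def dist_norm abs_mult)
      finally show "dist (y u) (y w) \<le> (L + \<kappa> * norm T) * dist u w" by (simp add: dist_norm algebra_simps)
    qed
    have "AE u in lebesgue. u \<notin> {s, t}" by (rule AE_not_in_finite) simp
    with ae show "AE u in lebesgue. u \<in> {s..t} \<longrightarrow>
        (\<exists>v. (y has_vector_derivative v) (at u) \<and> future_causal_vector M c (coord_inv c (y u)) v)"
    proof eventually_elim
      case (elim u)
      show ?case
      proof
        assume u: "u \<in> {s..t}"
        then have su: "s < u" "u < t" using elim by auto
        have uc: "\<gamma> u \<in> fst c" using img[OF u] by blast
        obtain v where v: "(x has_vector_derivative v) (at u)" "future_causal_vector M c (\<gamma> u) v"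
          using elim u c uc unfolding causal_at_def x_def by blast
        have "coord_inv c (x u) = \<gamma> u" using c uc by (simp add: x_def coord_inv_coord)
        then have fv: "fcv c (x u) v" using v(2) fcv_iff[of c "x u" v] by simp
        have vL: "norm v \<le> L" by (rule lipschitz_vector_derivative_bound[OF L su v(1)[unfolded x_def]])
        define w where "w = v + \<kappa> *\<^sub>R T"
        have yd: "(y has_vector_derivative w) (at u)"
          unfolding y_def w_def by (auto intro!: derivative_eq_intros v(1))
        let ?y = "y u"
        have yS: "?y \<in> snd c ` fst c" using yr[OF u] cone_ballD(4)[OF cb] by blast
        note bil = G_bilinear[OF c yS] and sym = G_sym[OF c yS, of v T]
        have "G c ?y v v \<le> G c (x u) v v + K * dist ?y (x u) * norm v * norm v"
          using lipG[OF yr[OF u] xr[OF u], of v v] by linarith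
        also have "\<dots> \<le> K * dist ?y (x u) * norm v * norm v" using fv by (simp add: fcv_def)
        also have "\<dots> \<le> K * dist ?y (x u) * L * norm v"
          using vL \<open>K \<ge> 0\<close> by (intro mult_right_mono mult_left_mono) auto
        also have "\<dots> = K * L * norm (?y - x u) * norm v" by (simp add: dist_norm)
        also have "\<dots> \<le> 2 * \<kappa> * k * norm v" using drift[OF u] by (intro mult_right_mono) auto
        finally have 1: "G c ?y v v \<le> 2 * \<kappa> * k * norm v" .
        have 2: "\<kappa> * G c ?y T v \<le> \<kappa> * (- k * norm v)"
          using cone_ballD(8)[OF cb xr[OF u] fv yr[OF u]] \<open>\<kappa> > 0\<close> by (intro mult_left_mono) (auto simp: T_def)
        have 3: "\<kappa>\<^sup>2 * G c ?y T T \<le> 0"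
          using cone_ballD(6)[OF cb yr[OF u]] k by (intro mult_nonneg_nonpos) (auto simp: T_def)
        have "G c ?y w w = G c ?y v v + 2 * (\<kappa> * G c ?y T v) + \<kappa>\<^sup>2 * G c ?y T T"
          unfolding w_def using bil sym
          by (simp add: bilinear_ladd bilinear_radd bilinear_lmul bilinear_rmul power2_eq_square algebra_simps)
        then have null: "G c ?y w w \<le> 0" using 1 2 3 by (simp add: algebra_simps)
        have "G c ?y (TF c ?y) v \<le> 0"
          using cone_ballD(9)[OF cb xr[OF u] fv yr[OF u]] k by (smt (verit) mult_nonneg_nonneg norm_ge_zero mult_minus_left)
        moreover have "\<kappa> * G c ?y (TF c ?y) T < 0"
          using cone_ballD(7)[OF cb yr[OF u]] k \<open>\<kappa> > 0\<close> by (intro mult_pos_neg) (auto simp: T_def)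
        ultimately have fut: "G c ?y (TF c ?y) w < 0"
          unfolding w_def using bil by (simp add: bilinear_radd bilinear_rmul)
        then have "w \<noteq> 0" using bil by (auto simp: bilinear_rzero)
        then have "fcv c ?y w" using null fut by (simp add: fcv_def)
        then show "\<exists>v. (y has_vector_derivative v) (at u) \<and> future_causal_vector M c (coord_inv c (y u)) v"
          using yd fcv_iff by blast
      qed
    qed
  qed
  then have "causal ell ((coord_inv c \<circ> y) s) ((coord_inv c \<circ> y) t)" unfolding causal_iff by blast
  then show ?thesis by (simp add: y_def x_def T_def)
qed

text \<open>In \<open>perturbed_curve\<close> the choice \<open>u0 = s\<close> prescribes the displacement \<open>h\<close> of the initial point, and
  \<open>u0 = t\<close> that of the end point. The displacement of the other end point is of the size of \<open>h\<close> and \<open>\<kappa>\<close>.\<close>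

lemma curve_locally_stable:
  assumes smooth: "smooth_metric M" and \<gamma>: "causal_curve M a b \<gamma>" and u: "u \<in> {a..b}"
  shows "\<exists>d>0. \<forall>s t. a \<le> s \<and> s \<le> u \<and> u \<le> t \<and> t \<le> b \<and> t - s < d \<longrightarrow>
           future_stable (\<gamma> s) (\<gamma> t) \<and> past_stable (\<gamma> s) (\<gamma> t)"
proof -
  have cont: "continuous_map (top_of_set {a..b}) (mtop M) \<gamma>" using \<gamma> by (simp add: causal_curve_iff)
  obtain c where c: "c \<in> atlas M" and uc: "\<gamma> u \<in> fst c" using chart_at[OF curve_in_space[OF \<gamma> u]] by blast
  define x0 where "x0 = snd c (\<gamma> u)"
  have x0S: "x0 \<in> snd c ` fst c" using uc by (simp add: x0_def)
  obtain r1 k where cb1: "cone_ball c x0 r1 k" by (rule cone_ball_exists[OF c x0S]) (rule that)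
  obtain r2 K where K: "r2 > 0" "K \<ge> 0"
    "\<And>x y v w. x \<in> cball x0 r2 \<Longrightarrow> y \<in> cball x0 r2 \<Longrightarrow> \<bar>G c x v w - G c y v w\<bar> \<le> K * dist x y * norm v * norm w"
    by (rule metric_lipschitz[OF smooth c x0S]) (rule that)
  define r where "r = min r1 r2"
  have r: "r > 0" using K(1) cone_ballD(2)[OF cb1] by (simp add: r_def)
  have cb: "cone_ball c x0 r k" by (rule cone_ball_shrink[OF cb1 r]) (simp add: r_def)
  have k: "k > 0" by (rule cone_ballD(3)[OF cb])
  have lipG: "\<bar>G c x v w - G c y v w\<bar> \<le> K * dist x y * norm v * norm w" if "x \<in> cball x0 r" "y \<in> cball x0 r" for x y v w
    by (rule K(3)) (use that in \<open>auto simp: r_def\<close>)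
  define T where "T = TF c x0"
  have "lipschitz_at {a..b} \<gamma> u" using \<gamma> u by (simp add: causal_curve_iff)
  then obtain \<delta>1 L where \<delta>1: "\<delta>1 > 0" "\<gamma> ` ({a..b} \<inter> ball u \<delta>1) \<subseteq> fst c"
    "L-lipschitz_on ({a..b} \<inter> ball u \<delta>1) (snd c \<circ> \<gamma>)"
    using c uc unfolding lipschitz_at_def by blast
  have L0: "L \<ge> 0" using \<delta>1(3) by (rule lipschitz_on_nonneg)
  have "openin (mtop M) {q \<in> fst c. snd c q \<in> ball x0 (r / 2)}" "\<gamma> u \<in> {q \<in> fst c. snd c q \<in> ball x0 (r / 2)}"
    using chart_nhd[OF c uc, of "r / 2"] r by (simp_all add: x0_def)
  then obtain \<delta>2 where \<delta>2: "\<delta>2 > 0"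
    "\<And>s. s \<in> {a..b} \<Longrightarrow> \<bar>s - u\<bar> < \<delta>2 \<Longrightarrow> \<gamma> s \<in> {q \<in> fst c. snd c q \<in> ball x0 (r / 2)}"
    using curve_near[OF cont u] by blast
  \<comment> \<open>With the last bound the tilt outweighs the displacement that it causes itself.\<close>
  define d where "d = Min {\<delta>1, \<delta>2, k / (K * L * norm T + 1)}"
  have KLT: "K * L * norm T \<ge> 0" using K(2) L0 by simp
  have d: "d > 0" "d \<le> \<delta>1" "d \<le> \<delta>2" "d \<le> k / (K * L * norm T + 1)"
    using \<delta>1(1) \<delta>2(1) k KLT by (auto simp: d_def intro: divide_pos_pos add_nonneg_pos)
  have "future_stable (\<gamma> s) (\<gamma> t) \<and> past_stable (\<gamma> s) (\<gamma> t)"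
    if st: "a \<le> s" "s \<le> u" "u \<le> t" "t \<le> b" "t - s < d" for s t
  proof (cases "s = t")
    case True then show ?thesis by (simp add: future_stable_refl past_stable_refl)
  next
    case False
    then have "s < t" using st by simp
    have \<gamma>st: "causal_curve M s t \<gamma>" by (rule causal_curve_restrict[OF \<gamma> st(1) \<open>s < t\<close> st(4)])
    have img: "\<gamma> v \<in> fst c \<and> snd c (\<gamma> v) \<in> cball x0 (r / 2)" if "v \<in> {s..t}" for v
    proof -
      have "v \<in> {a..b}" "\<bar>v - u\<bar> < \<delta>2" using that st d(3) by auto
      from \<delta>2(2)[OF this] show ?thesis by auto
    qed
    have Lst: "L-lipschitz_on {s..t} (snd c \<circ> \<gamma>)"
    proof (rule lipschitz_on_subset[OF \<delta>1(3)])
      show "{s..t} \<subseteq> {a..b} \<inter> ball u \<delta>1" using st d(2) by (auto simp: dist_real_def)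
    qed
    have short: "K * L * ((t - s) * norm (TF c x0)) \<le> k"
    proof -
      have "(K * L * norm T) * (t - s) \<le> (K * L * norm T + 1) * d"
        using KLT st(5) d(1) \<open>s < t\<close> by (intro mult_mono) auto
      also have "\<dots> \<le> k" using d(4) KLT by (simp add: pos_le_divide_eq mult.commute add_nonneg_pos)
      finally show ?thesis by (simp add: T_def mult_ac)
    qed
    have sc: "\<gamma> s \<in> fst c" and tc: "\<gamma> t \<in> fst c" using img[of s] img[of t] \<open>s < t\<close> by auto
    let ?xs = "snd c (\<gamma> s)" and ?xt = "snd c (\<gamma> t)"
    have perturb: "\<exists>\<eta>>0. \<forall>h. norm h < \<eta> \<longrightarrow>
        (\<exists>k. norm k < \<rho> \<and> causal ell (coord_inv c (?xs + h)) (coord_inv c (?xt + k))) \<and>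
        (\<exists>k. norm k < \<rho> \<and> causal ell (coord_inv c (?xs + k)) (coord_inv c (?xt + h)))" if "\<rho> > 0" for \<rho>
    proof -
      define m where "m = min \<rho> (r / 2)"
      have m: "m > 0" using that r by (simp add: m_def)
      define D where "D = (t - s) * norm T"
      have D: "D \<ge> 0" using \<open>s < t\<close> by (simp add: D_def)
      \<comment> \<open>The tilt displaces the end points by at most \<open>\<kappa> D \<le> m / 2\<close>; the rest of \<open>m\<close> is left for \<open>h\<close>.\<close>
      define \<kappa> where "\<kappa> = m / (2 * (D + 1))"
      have \<kappa>: "\<kappa> > 0" using m D by (simp add: \<kappa>_def)
      have "\<kappa> * D \<le> \<kappa> * (D + 1)" using \<kappa> by simp
      also have "\<dots> = m / 2" using D by (simp add: \<kappa>_def field_simps)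
      finally have \<kappa>D: "\<kappa> * D \<le> m / 2" .
      define \<eta> where "\<eta> = min (m / 2) (\<kappa> * k / (K * L + 1))"
      have KL: "K * L \<ge> 0" using K(2) L0 by simp
      have "\<eta> > 0" using m \<kappa> k KL by (auto simp: \<eta>_def intro: divide_pos_pos add_nonneg_pos)
      moreover have "(\<exists>k. norm k < \<rho> \<and> causal ell (coord_inv c (?xs + h)) (coord_inv c (?xt + k))) \<and>
        (\<exists>k. norm k < \<rho> \<and> causal ell (coord_inv c (?xs + k)) (coord_inv c (?xt + h)))" if h: "norm h < \<eta>" for h
      proof -
        have "norm h < m / 2" using h by (simp add: \<eta>_def)
        then have hm: "norm h + \<kappa> * D < m" using \<kappa>D by simp
        have "K * L * norm h \<le> (K * L + 1) * (\<kappa> * k / (K * L + 1))"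
          using h KL \<kappa> k by (intro mult_mono) (auto simp: \<eta>_def)
        also have "\<dots> = \<kappa> * k" using KL by simp
        finally have hk: "K * L * norm h \<le> \<kappa> * k" .
        have "norm h + \<kappa> * ((t - s) * norm (TF c x0)) \<le> r / 2" using hm by (simp add: m_def D_def T_def)
        note pc = perturbed_curve[OF cb lipG K(2) \<gamma>st img Lst \<kappa> _ short hk this]
        have shift: "norm (h + z *\<^sub>R T) < \<rho>" if "\<bar>z\<bar> = \<kappa> * (t - s)" for z
          using norm_triangle_ineq[of h "z *\<^sub>R T"] hm that by (simp add: m_def D_def mult.assoc)
        have "causal ell (coord_inv c (?xs + h)) (coord_inv c (?xt + (h + (\<kappa> * (t - s)) *\<^sub>R T)))"
          using pc[of s] \<open>s < t\<close> by (simp add: T_def add.assoc)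
        moreover have "causal ell (coord_inv c (?xs + (h + (\<kappa> * (s - t)) *\<^sub>R T))) (coord_inv c (?xt + h))"
          using pc[of t] \<open>s < t\<close> by (simp add: T_def add.assoc)
        moreover have "\<bar>\<kappa> * (t - s)\<bar> = \<kappa> * (t - s)" "\<bar>\<kappa> * (s - t)\<bar> = \<kappa> * (t - s)"
          using \<kappa> \<open>s < t\<close> by (auto simp: abs_mult)
        ultimately show ?thesis using shift by blast
      qed
      ultimately show ?thesis by blast
    qed
    have near: "\<exists>\<rho>>0. \<forall>k. norm k < \<rho> \<longrightarrow> coord_inv c (snd c p + k) \<in> W" if W: "openin (mtop M) W" "p \<in> W" "p \<in> fst c" for W p
    proof -
      have "snd c p \<in> snd c ` (fst c \<inter> W)" using W by blast
      then obtain \<rho> where \<rho>: "\<rho> > 0" "ball (snd c p) \<rho> \<subseteq> snd c ` (fst c \<inter> W)"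
        using open_coord_image[OF c W(1)] open_contains_ball by blast
      have "coord_inv c (snd c p + k) \<in> W" if "norm k < \<rho>" for k
      proof -
        have "snd c p + k \<in> ball (snd c p) \<rho>" using that by (simp add: dist_norm)
        then have "snd c p + k \<in> snd c ` (fst c \<inter> W)" using \<rho>(2) by blast
        then show ?thesis using c by (auto simp: coord_inv_coord)
      qed
      then show ?thesis using \<rho>(1) by blast
    qed
    have split: "\<exists>h. norm h < \<eta> \<and> coord_inv c (snd c p + h) = q" if "q \<in> {q \<in> fst c. snd c q \<in> ball (snd c p) \<eta>}" for p q \<eta>
      using that c by (intro exI[of _ "snd c q - snd c p"]) (simp add: coord_inv_coord dist_norm norm_minus_commute)
    have "future_stable (\<gamma> s) (\<gamma> t)"
      unfolding future_stable_def
    proof (intro allI impI)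
      fix W assume "openin (mtop M) W \<and> \<gamma> t \<in> W"
      then obtain \<rho> where \<rho>: "\<rho> > 0" "\<And>k. norm k < \<rho> \<Longrightarrow> coord_inv c (?xt + k) \<in> W"
        using near tc by blast
      obtain \<eta> where \<eta>: "\<eta> > 0" "\<And>h. norm h < \<eta> \<Longrightarrow>
        \<exists>k. norm k < \<rho> \<and> causal ell (coord_inv c (?xs + h)) (coord_inv c (?xt + k))"
        using perturb[OF \<rho>(1)] by blast
      have "\<exists>q'\<in>W. causal ell p' q'" if "p' \<in> {q \<in> fst c. snd c q \<in> ball ?xs \<eta>}" for p'
        using split[OF that] \<eta>(2) \<rho>(2) by blast
      then show "\<exists>V. openin (mtop M) V \<and> \<gamma> s \<in> V \<and> (\<forall>p'\<in>V. \<exists>q'\<in>W. causal ell p' q')"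
        using chart_nhd[OF c sc \<eta>(1)] by blast
    qed
    moreover have "past_stable (\<gamma> s) (\<gamma> t)"
      unfolding past_stable_def
    proof (intro allI impI)
      fix V assume "openin (mtop M) V \<and> \<gamma> s \<in> V"
      then obtain \<rho> where \<rho>: "\<rho> > 0" "\<And>k. norm k < \<rho> \<Longrightarrow> coord_inv c (?xs + k) \<in> V"
        using near sc by blast
      obtain \<eta> where \<eta>: "\<eta> > 0" "\<And>h. norm h < \<eta> \<Longrightarrow>
        \<exists>k. norm k < \<rho> \<and> causal ell (coord_inv c (?xs + k)) (coord_inv c (?xt + h))"
        using perturb[OF \<rho>(1)] by blast
      have "\<exists>p'\<in>V. causal ell p' q'" if "q' \<in> {q \<in> fst c. snd c q \<in> ball ?xt \<eta>}" for q'
        using split[OF that] \<eta>(2) \<rho>(2) by blast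
      then show "\<exists>W. openin (mtop M) W \<and> \<gamma> t \<in> W \<and> (\<forall>q'\<in>W. \<exists>p'\<in>V. causal ell p' q')"
        using chart_nhd[OF c tc \<eta>(1)] by blast
    qed
    ultimately show ?thesis by blast
  qed
  then show ?thesis using d(1) by blast
qed

lemma curve_stable:
  assumes smooth: "smooth_metric M" and \<gamma>: "causal_curve M a b \<gamma>" and "a \<le> s" "s \<le> t" "t \<le> b"
  shows "future_stable (\<gamma> s) (\<gamma> t) \<and> past_stable (\<gamma> s) (\<gamma> t)"
proof -
  have "s \<le> s \<and> t \<le> t \<longrightarrow> future_stable (\<gamma> s) (\<gamma> t) \<and> past_stable (\<gamma> s) (\<gamma> t)"
    using \<open>s \<le> t\<close>
  proof (induction rule: Bolzano[where P = "\<lambda>x y. s \<le> x \<and> y \<le> t \<longrightarrow> future_stable (\<gamma> x) (\<gamma> y) \<and> past_stable (\<gamma> x) (\<gamma> y)"])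
    case (trans x y z)
    then show ?case using future_stable_trans past_stable_trans by (meson order_trans)
  next
    case (local u)
    then have "u \<in> {a..b}" using assms by auto
    from curve_locally_stable[OF smooth \<gamma> this] obtain d where d: "d > 0"
      "\<And>s t. a \<le> s \<Longrightarrow> s \<le> u \<Longrightarrow> u \<le> t \<Longrightarrow> t \<le> b \<Longrightarrow> t - s < d \<Longrightarrow>
           future_stable (\<gamma> s) (\<gamma> t) \<and> past_stable (\<gamma> s) (\<gamma> t)" by blast
    show ?case
      by (rule exI[of _ d]) (use d assms in auto)
  qed
  then show ?thesis by simp
qed

theorem smooth_imp_chron_open:
  assumes smooth: "smooth_metric M"
  shows "openin (prod_topology (mtop M) (mtop M)) (chronological_relation M)"
  unfolding openin_prod_topology_alt
proof (intro allI impI)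
  fix p q assume pq: "(p, q) \<in> chronological_relation M"
  then have "chron ell p q" by (simp add: chronological_relation_def)
  then obtain a b \<gamma> where \<gamma>: "causal_curve M a b \<gamma>" "\<gamma> a = p" "\<gamma> b = q" "lorentzian_length M a b \<gamma> > 0"
    by (rule chron_curve) (rule that)
  obtain s t where st: "a < s" "s < t" "t < b" "stably_chron (\<gamma> s) (\<gamma> t)"
    by (rule positive_length_stable_chord[OF \<gamma>(1,4)]) (rule that)
  have "stably_chron p q"
    using stably_chronI[OF _ st(4)] curve_stable[OF smooth \<gamma>(1), of a s] curve_stable[OF smooth \<gamma>(1), of t b] st \<gamma>(2,3)
    by simp
  then obtain V W where VW: "openin (mtop M) V" "openin (mtop M) W" "p \<in> V" "q \<in> W"
     "\<And>a b. a \<in> V \<Longrightarrow> b \<in> W \<Longrightarrow> chron ell a b" unfolding stably_chron_def by blast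
  moreover have "V \<times> W \<subseteq> chronological_relation M"
    using VW openin_subset by (fastforce simp: chronological_relation_def)
  ultimately show "\<exists>U V. openin (mtop M) U \<and> openin (mtop M) V \<and> p \<in> U \<and> q \<in> V \<and> U \<times> V \<subseteq> chronological_relation M"
    by blast
qed

end

section \<open>Finite approximations of spacetimes\<close>

theorem theorem7p6:
  fixes M :: "('m, 'e::euclidean_space) lorentz_structure"
  assumes "spacetime M"
    and "globally_hyperbolic M"
    and "smooth_metric M \<or>
         openin (prod_topology (mtop M) (mtop M)) (chronological_relation M)"
  shows "\<exists>(b::'m) (U::nat \<Rightarrow> 'm set).
           covered_lorentzian_prelength_space (mtop M) (time_separation M) b U \<and>
           (\<exists>(X::nat \<Rightarrow> nat set) (ls::nat \<Rightarrow> nat \<Rightarrow> nat \<Rightarrow> ereal) (bs::nat \<Rightarrow> nat)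
              (Us::nat \<Rightarrow> nat \<Rightarrow> nat set).
              (\<forall>n. finite (X n) \<and>
                   covered_lorentzian_prelength_space
                     (discrete_topology (X n)) (ls n) (bs n) (Us n)) \<and>
              strong_pLGH_convergence (\<lambda>n. discrete_topology (X n)) ls bs Us
                (mtop M) (time_separation M) b U)"
proof -
  interpret lorentz_spacetime M by (rule lorentz_spacetime.intro) (rule assms(1))
  have "openin (prod_topology (mtop M) (mtop M)) (chronological_relation M)"
    using assms(3) smooth_imp_chron_open by blast
  then interpret chron_open_spacetime M by (intro chron_open_spacetime.intro lorentz_spacetime_axioms chron_open_spacetime_axioms.intro assms(2))
  show ?thesis by (rule spacetime_finite_approximation)
qed

end
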